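(* For every positive integer $d$ there exists $v(d)>0$, and for every integer $p\ge d+1$ there exists an integer $r=r(p,d)$, such that the following holds. Let $\mathcal{F}$ be a finite family of convex sets in $\mathbb{R}^d$, each of volume at least $1$, such that among any $p$ members of $\mathcal{F}$ there exist $d+1$ whose intersection has volume at least $1$. Then $\mathcal{F}$ has a quantitative $v(d)$-transversal of size at most $r$.
   Context: $\mathrm{vol}$ denotes $d$-dimensional Lebesgue measure. For $v>0$, a family $T$ of convex bodies (compact convex sets with nonempty interior), each of volume $v$, is a quantitative $v$-transversal of a family $\mathcal{F}$ of convex sets if every member of $\mathcal{F}$ contains at least one member of $T$. (In fact the members of $T$ can be taken to be ellipsoids of volume $v(d)$.) *)

theory Defs
  imports "HOL-Analysis.Analysis"
begin

definition convex_body :: "'a::euclidean_space set \<Rightarrow> bool" where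
  "convex_body K \<longleftrightarrow> compact K \<and> convex K \<and> interior K \<noteq> {}"

definition quant_transversal :: "real \<Rightarrow> 'a::euclidean_space set set \<Rightarrow> 'a set set \<Rightarrow> bool" where
  "quant_transversal v T F \<longleftrightarrow>
     (\<forall>K\<in>T. convex_body K \<and> measure lebesgue K = v) \<and> (\<forall>C\<in>F. \<exists>K\<in>T. K \<subseteq> C)"

end

theory Submission
  imports Defs "HOL-Library.Ramsey"
begin

text \<open>
  A simplex that is triangular with respect to a fixed orthonormal basis is determined by its
  vertices, and those contained in a convex set with volume bounded below form a convex set in a
  Euclidean space of dimension \<open>D\<close> depending on \<open>d\<close> only. The theorem for \<open>D + 1\<close> in place of
  \<open>d + 1\<close> is therefore the classical \<open>(p, q)\<close>-theorem of Alon and Kleitman in dimension \<open>D\<close>.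
  By Ramsey's theorem it remains to find, among many convex sets any \<open>d + 1\<close> of which intersect in
  large volume, \<open>D + 1\<close> sets with a large intersection. This is shown in a colourful version with
  \<open>d + 1\<close> classes, by induction on the dimension: each transversal of the classes has an interval
  of levels at which the slices of its intersection are large. Intervals, with position and length
  together, behave like points of a tree, so by a Ramsey argument one class can be dropped such that
  the remaining transversals have large slices throughout one common interval.
\<close>

section \<open>Volume through slices\<close>

text \<open>With d = \<open>DIM('a)\<close>, a parameter consists of d + 1 vertices in dimension d,
  so D = d * (d + 1). Helly-type arguments on parameters need D + 1 sets with one common large
  simplex, whereas the hypothesis controls only d + 1 sets at a time. The obstacle is the absence of
  a scale: a set of volume 1 may be arbitrarily long and thin, so the intervals of levels cannot be
  compared with a fixed subdivision of the line. Only scale-free statements about intervals are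
  used, and the unit of length comes from the family itself, as the shortest window that captures a
  subgrid. Classes are needed because each slice direction is paid for by a whole class: its members
  serve to move big slices into one common window, and the other classes must still form all
  transversals. After d directions one class is left, whose flat sets share a point. The volume
  constant does not depend on p because the selection of D + 1 sets involves only d; p enters
  through the Ramsey number and the size of the transversal.\<close>

text \<open>
  \<open>big bs V C\<close> is a combinatorial substitute for "the volume of \<open>C\<close> in the directions \<open>bs\<close> is at
  least \<open>V\<close>": there is an interval of levels of some length \<open>l\<close> all of whose slices are big for
  \<open>V / l\<close> in the remaining directions. For convex sets it is equivalent to a volume bound up to
  a constant depending on the dimension only. In direction-free form (\<open>bs = []\<close>) the set is
  meant to lie in a single point, so only \<open>V \<le> 1\<close> and nonemptiness are left.
\<close>

fun big :: "'a::euclidean_space list \<Rightarrow> real \<Rightarrow> 'a set \<Rightarrow> bool" where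
  "big [] V C \<longleftrightarrow> C \<noteq> {} \<and> V \<le> 1"
| "big (b # bs) V C \<longleftrightarrow>
     (\<exists>a l. l > 0 \<and> (\<forall>t\<in>{a..a + l}. big bs (V / l) (C \<inter> {x. x \<bullet> b = t})))"

lemma big_ConsE:
  assumes "big (b # bs) V C"
  obtains a l where "l > 0"
    "\<And>t. t \<in> {a..a + l} \<Longrightarrow> big bs (V / l) (C \<inter> {x. x \<bullet> b = t})"
  using assms by (metis big.simps(2))

lemma big_mono: "big bs V C \<Longrightarrow> C \<subseteq> C' \<Longrightarrow> V' \<le> V \<Longrightarrow> big bs V' C'"
proof (induction bs arbitrary: V V' C C')
  case Nil
  then show ?case by auto
next
  case (Cons b bs)
  from Cons.prems(1) obtain a l where l: "l > 0"
    and sl: "\<And>t. t \<in> {a..a + l} \<Longrightarrow> big bs (V / l) (C \<inter> {x. x \<bullet> b = t})"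
    by (rule big_ConsE) blast
  have "big bs (V' / l) (C' \<inter> {x. x \<bullet> b = t})" if "t \<in> {a..a + l}" for t
    by (rule Cons.IH[OF sl[OF that]]) (use Cons.prems l in \<open>auto simp: divide_right_mono\<close>)
  with l show ?case unfolding big.simps by blast
qed

lemma big_nonempty: "big bs V C \<Longrightarrow> C \<noteq> {}"
proof (induction bs arbitrary: V C)
  case Nil
  then show ?case by auto
next
  case (Cons b bs)
  from Cons.prems obtain a l where l: "l > 0"
    and sl: "\<And>t. t \<in> {a..a + l} \<Longrightarrow> big bs (V / l) (C \<inter> {x. x \<bullet> b = t})"
    by (rule big_ConsE) blast
  from Cons.IH[OF sl[of a]] l show ?case by auto
qed

section \<open>Scaling, and slices of a convex set near a big slice\<close>

lemma big_homothety:
  assumes "big bs V C" "r > 0"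
  shows "big bs (r ^ length bs * V) ((\<lambda>x. r *\<^sub>R x + y) ` C)"
  using assms(1)
proof (induction bs arbitrary: V C)
  case Nil
  then show ?case by auto
next
  case (Cons b bs)
  from Cons.prems obtain a l where l: "l > 0"
    and sl: "\<And>t. t \<in> {a..a + l} \<Longrightarrow> big bs (V / l) (C \<inter> {x. x \<bullet> b = t})"
    by (rule big_ConsE) blast
  let ?h = "\<lambda>x. r *\<^sub>R x + y"
  have "big bs (r ^ length (b # bs) * V / (r * l)) (?h ` C \<inter> {x. x \<bullet> b = t})"
    if t: "t \<in> {r * a + y \<bullet> b..(r * a + y \<bullet> b) + r * l}" for t
  proof -
    define s where "s = (t - y \<bullet> b) / r"
    have "r * a \<le> t - y \<bullet> b" "t - y \<bullet> b \<le> r * (a + l)"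
      using t by (auto simp: algebra_simps)
    then have "s \<in> {a..a + l}"
      using \<open>r > 0\<close> by (auto simp: s_def field_simps)
    from Cons.IH[OF sl[OF this]]
    have "big bs (r ^ length bs * (V / l)) (?h ` (C \<inter> {x. x \<bullet> b = s}))" .
    moreover have "?h ` (C \<inter> {x. x \<bullet> b = s}) \<subseteq> ?h ` C \<inter> {x. x \<bullet> b = t}"
      using \<open>r > 0\<close> by (auto simp: s_def inner_add_left)
    moreover have "r ^ length (b # bs) * V / (r * l) = r ^ length bs * (V / l)"
      using \<open>r > 0\<close> l by simp
    ultimately show ?thesis
      by (metis big_mono order_refl)
  qed
  moreover have "r * l > 0" using \<open>r > 0\<close> l by simp
  ultimately show ?case
    unfolding big.simps by blast
qed

text \<open>The cone over the big slice with apex \<open>y\<close> lies in \<open>C\<close>, and its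
  section at level \<open>t\<close> is a homothetic copy of that slice with ratio
  \<open>1 - s\<close>, which is at least 1/2. This elementary bound takes the place of the
  Brunn-Minkowski inequality, at the price of the factor \<open>2 ^ length bs\<close>.\<close>

lemma big_slice_interpolate:
  assumes C: "convex C" and big: "big bs V (C \<inter> {x. x \<bullet> b = p})"
    and y: "y \<in> C" "y \<bullet> b = q"
    and t: "t = (1 - s) * p + s * q" and s: "0 \<le> s" "s \<le> 1/2" and V: "V \<ge> 0"
  shows "big bs (V / 2 ^ length bs) (C \<inter> {x. x \<bullet> b = t})"
proof -
  have "big bs ((1 - s) ^ length bs * V) ((\<lambda>x. (1 - s) *\<^sub>R x + s *\<^sub>R y) ` (C \<inter> {x. x \<bullet> b = p}))"
    by (rule big_homothety[OF big]) (use s in auto)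
  moreover have "(\<lambda>x. (1 - s) *\<^sub>R x + s *\<^sub>R y) ` (C \<inter> {x. x \<bullet> b = p}) \<subseteq> C \<inter> {x. x \<bullet> b = t}"
    using C y s by (auto simp: t inner_add_left intro!: convexD)
  moreover have "(1/2) ^ length bs * V \<le> (1 - s) ^ length bs * V"
    using s V by (intro mult_right_mono power_mono) auto
  ultimately show ?thesis
    by (auto elim!: big_mono simp: power_one_over divide_simps mult.commute)
qed

corollary big_slice_midpoint_right:
  assumes C: "convex C" and big: "big bs V (C \<inter> {x. x \<bullet> b = p})"
    and y: "y \<in> C" and t: "p \<le> t" "2 * t \<le> p + y \<bullet> b" and V: "V \<ge> 0"
  shows "big bs (V / 2 ^ length bs) (C \<inter> {x. x \<bullet> b = t})"
proof (cases "y \<bullet> b = p")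
  case True
  with t have "t = p" by auto
  then show ?thesis
    using big_slice_interpolate[OF C big y refl, of p 0] V by simp
next
  case False
  then have "y \<bullet> b > p" using t by auto
  define s where "s = (t - p) / (y \<bullet> b - p)"
  have "s * (y \<bullet> b - p) = t - p" "0 \<le> s" "s \<le> 1/2"
    using \<open>y \<bullet> b > p\<close> t by (auto simp: s_def field_simps)
  then show ?thesis
    using V by (intro big_slice_interpolate[OF C big y refl, where s = s]) (auto simp: algebra_simps)
qed

corollary big_slice_midpoint_left:
  assumes C: "convex C" and big: "big bs V (C \<inter> {x. x \<bullet> b = p})"
    and y: "y \<in> C" and t: "t \<le> p" "p + y \<bullet> b \<le> 2 * t" and V: "V \<ge> 0"
  shows "big bs (V / 2 ^ length bs) (C \<inter> {x. x \<bullet> b = t})"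
proof (cases "y \<bullet> b = p")
  case True
  with t have "t = p" by auto
  then show ?thesis
    using big_slice_interpolate[OF C big y refl, of p 0] V by simp
next
  case False
  then have "y \<bullet> b < p" using t by auto
  define s where "s = (p - t) / (p - y \<bullet> b)"
  have "s * (p - y \<bullet> b) = p - t" "0 \<le> s" "s \<le> 1/2"
    using \<open>y \<bullet> b < p\<close> t by (auto simp: s_def field_simps)
  then show ?thesis
    using V by (intro big_slice_interpolate[OF C big y refl, where s = s]) (auto simp: algebra_simps)
qed

section \<open>Comparison with iterated integrals\<close>

fun iterated_measure :: "'a::euclidean_space list \<Rightarrow> 'a set \<Rightarrow> 'a \<Rightarrow> ennreal" where
  "iterated_measure [] C z = indicator C z"
| "iterated_measure (b # bs) C z = (\<integral>\<^sup>+t. iterated_measure bs C (z + t *\<^sub>R b) \<partial>lborel)"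

text \<open>The section of \<open>C\<close> by the flat through \<open>z\<close> parallel to the
  span of \<open>bs\<close>. Peeling off one direction moves the base point, which is why both this
  set and \<open>iterated_measure\<close> carry \<open>z\<close>.\<close>

definition flat_part :: "'a::euclidean_space list \<Rightarrow> 'a \<Rightarrow> 'a set \<Rightarrow> 'a set" where
  "flat_part bs z C = {x \<in> C. \<forall>b\<in>Basis - set bs. x \<bullet> b = z \<bullet> b}"

lemma iterated_measure_eq_PiM:
  fixes bs :: "'a::euclidean_space list"
  assumes C: "C \<in> sets borel" and "distinct bs" "set bs \<subseteq> Basis"
  shows "iterated_measure bs C z =
    (\<integral>\<^sup>+f. indicator C (z + (\<Sum>b\<in>set bs. f b *\<^sub>R b)) \<partial>(\<Pi>\<^sub>M b\<in>set bs. (lborel :: real measure)))"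
  using assms(2,3)
proof (induction bs arbitrary: z)
  case Nil
  show ?case
    by (simp add: PiM_empty nn_integral_count_space_finite)
next
  case (Cons b bs)
  interpret product_sigma_finite "\<lambda>_. lborel :: real measure" ..
  note [measurable] = C
  have "iterated_measure (b # bs) C z =
    (\<integral>\<^sup>+t. (\<integral>\<^sup>+f. indicator C (z + t *\<^sub>R b + (\<Sum>b\<in>set bs. f b *\<^sub>R b)) \<partial>(\<Pi>\<^sub>M b\<in>set bs. (lborel :: real measure))) \<partial>lborel)"
    using Cons by simp
  also have "\<dots> = (\<integral>\<^sup>+t. (\<integral>\<^sup>+f. indicator C (z + (\<Sum>b'\<in>insert b (set bs). (f(b := t)) b' *\<^sub>R b')) \<partial>(\<Pi>\<^sub>M b\<in>set bs. (lborel :: real measure))) \<partial>lborel)"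
  proof (intro nn_integral_cong)
    fix t :: real and f :: "'a \<Rightarrow> real"
    have "(\<Sum>b'\<in>insert b (set bs). (f(b := t)) b' *\<^sub>R b') = t *\<^sub>R b + (\<Sum>b'\<in>set bs. (f(b := t)) b' *\<^sub>R b')"
      using Cons.prems by (subst sum.insert) auto
    also have "(\<Sum>b'\<in>set bs. (f(b := t)) b' *\<^sub>R b') = (\<Sum>b'\<in>set bs. f b' *\<^sub>R b')"
      using Cons.prems by (intro sum.cong) auto
    finally show "indicator C (z + t *\<^sub>R b + (\<Sum>b\<in>set bs. f b *\<^sub>R b)) =
      (indicator C (z + (\<Sum>b'\<in>insert b (set bs). (f(b := t)) b' *\<^sub>R b')) :: ennreal)"
      by (simp add: add.assoc)
  qed
  also have "\<dots> = (\<integral>\<^sup>+f. indicator C (z + (\<Sum>b'\<in>insert b (set bs). f b' *\<^sub>R b')) \<partial>(\<Pi>\<^sub>M b\<in>insert b (set bs). (lborel :: real measure)))"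
    using Cons.prems by (intro product_nn_integral_insert_rev[symmetric]) auto
  finally show ?case by simp
qed

lemma emeasure_lborel_iterated:
  fixes bs :: "'a::euclidean_space list"
  assumes C: "C \<in> sets borel" and "distinct bs" "set bs = Basis"
  shows "emeasure lborel C = iterated_measure bs C 0"
proof -
  note [measurable] = C
  have "emeasure lborel C = (\<integral>\<^sup>+x. indicator C x \<partial>lborel)"
    by simp
  also have "\<dots> = (\<integral>\<^sup>+f. indicator C (\<Sum>b\<in>Basis. f b *\<^sub>R b) \<partial>(\<Pi>\<^sub>M b\<in>Basis. (lborel :: real measure)))"
    unfolding lborel_eq[where 'a = 'a] by (rule nn_integral_distr) measurable
  finally show ?thesis
    using iterated_measure_eq_PiM[OF C, of bs 0] assms by simp
qed

lemma flat_part_slice: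
  assumes "b \<in> Basis" "b \<notin> set bs" "z \<bullet> b = 0" "set bs \<subseteq> Basis"
  shows "flat_part (b # bs) z C \<inter> {x. x \<bullet> b = t} = flat_part bs (z + t *\<^sub>R b) C"
  using assms by (auto simp: flat_part_def inner_add_left inner_not_same_Basis inner_Basis split: if_splits)

lemma iterated_measure_big_ge:
  fixes bs :: "'a::euclidean_space list"
  assumes C: "C \<in> sets borel" and "distinct bs" "set bs \<subseteq> Basis" "\<forall>b\<in>set bs. z \<bullet> b = 0"
    and "big bs V (flat_part bs z C)"
  shows "ennreal V \<le> iterated_measure bs C z"
  using assms(2-)
proof (induction bs arbitrary: z V)
  case Nil
  then obtain x where "x \<in> flat_part [] z C" "V \<le> 1" by auto
  moreover from this have "x = z" "x \<in> C"
    by (auto simp: flat_part_def intro: euclidean_eqI)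
  ultimately show ?case
    using ennreal_leI[of V 1] by simp
next
  case (Cons b bs)
  from Cons.prems(4) obtain a l where l: "l > 0"
    and sl: "\<And>t. t \<in> {a..a + l} \<Longrightarrow> big bs (V / l) (flat_part (b # bs) z C \<inter> {x. x \<bullet> b = t})"
    by (rule big_ConsE) blast
  have *: "ennreal (V / l) \<le> iterated_measure bs C (z + t *\<^sub>R b)" if t: "t \<in> {a..a + l}" for t
  proof (rule Cons.IH)
    show "\<forall>b'\<in>set bs. (z + t *\<^sub>R b) \<bullet> b' = 0"
      using Cons.prems by (auto simp: inner_add_left inner_not_same_Basis inner_Basis)
    show "big bs (V / l) (flat_part bs (z + t *\<^sub>R b) C)"
      using sl[OF t] flat_part_slice[of b bs z C t] Cons.prems by simp
  qed (use Cons.prems in auto)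
  have "ennreal V = ennreal (V / l) * ennreal l"
    using l by (cases "V \<ge> 0") (auto simp: ennreal_mult'[symmetric] ennreal_neg divide_nonpos_pos)
  also have "\<dots> = (\<integral>\<^sup>+t. ennreal (V / l) * indicator {a..a + l} t \<partial>lborel)"
    using l by (simp add: nn_integral_cmult)
  also have "\<dots> \<le> (\<integral>\<^sup>+t. iterated_measure bs C (z + t *\<^sub>R b) \<partial>lborel)"
    using * by (intro nn_integral_mono) (auto split: split_indicator)
  finally show ?case by simp
qed

text \<open>Some slice has at least half of the average measure over the width \<open>d\<close>. The
  farther end of the convex set is at distance at least \<open>d / 2\<close> from its level, so a
  point beyond distance \<open>d / 3\<close> exists even if the end is not attained, and all levels
  within \<open>d / 6\<close> on that side inherit the size of the slice up to a power of
  two.\<close>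

lemma big_of_iterated_measure:
  fixes bs :: "'a::euclidean_space list"
  assumes "distinct bs" "set bs \<subseteq> Basis"
  shows "\<exists>c>0. \<forall>C z V. convex C \<and> bounded C \<and> C \<in> sets borel \<and> (\<forall>b\<in>set bs. z \<bullet> b = 0) \<and>
    V > 0 \<and> ennreal V \<le> iterated_measure bs C z \<longrightarrow> big bs (c * V) (flat_part bs z C)"
  using assms
proof (induction bs)
  case Nil
  have "big [] (1 * V) (flat_part [] z C)"
    if "V > 0" "ennreal V \<le> iterated_measure [] C z" for C V and z :: 'a
    using that by (auto simp: flat_part_def split: split_indicator_asm)
  then show ?case by (intro exI[of _ 1]) auto
next
  case (Cons b bs)
  then obtain c where c: "c > 0" and IH: "\<And>C z V. convex C \<Longrightarrow> bounded C \<Longrightarrow> C \<in> sets borel \<Longrightarrow> \<forall>b\<in>set bs. z \<bullet> b = 0 \<Longrightarrow>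
    V > 0 \<Longrightarrow> ennreal V \<le> iterated_measure bs C z \<Longrightarrow> big bs (c * V) (flat_part bs z C)"
    by auto
  \<comment> \<open>12 = 2 * 6: the chosen slice is only known to have half of the average, and the
    interval of levels has length \<open>d / 6\<close>. The power of two is the loss in
    \<open>big_slice_interpolate\<close>.\<close>
  define c' where "c' = c / (12 * 2 ^ length bs)"
  show ?case
  proof (intro exI[of _ c'] conjI allI impI)
    show "c' > 0" using c by (simp add: c'_def)
    fix C z V
    assume "convex C \<and> bounded C \<and> C \<in> sets borel \<and> (\<forall>b\<in>set (b # bs). z \<bullet> b = 0) \<and>
      V > 0 \<and> ennreal V \<le> iterated_measure (b # bs) C z"
    then have C: "convex C" "bounded C" "C \<in> sets borel" and z: "\<forall>b\<in>set bs. z \<bullet> b = 0" "z \<bullet> b = 0"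
      and V: "V > 0" "ennreal V \<le> (\<integral>\<^sup>+t. iterated_measure bs C (z + t *\<^sub>R b) \<partial>lborel)" by auto
    let ?F = "flat_part (b # bs) z C"
    define g where "g t = iterated_measure bs C (z + t *\<^sub>R b)" for t
    have sl: "?F \<inter> {x. x \<bullet> b = t} = flat_part bs (z + t *\<^sub>R b) C" for t
      using Cons.prems z by (intro flat_part_slice) auto
    have zt: "\<forall>b'\<in>set bs. (z + t *\<^sub>R b) \<bullet> b' = 0" for t
      using Cons.prems z by (auto simp: inner_add_left inner_not_same_Basis inner_Basis)
    have big: "big bs (c * r) (?F \<inter> {x. x \<bullet> b = t})" if "r > 0" "ennreal r \<le> g t" for r t
      unfolding sl using that zt by (intro IH C) (auto simp: g_def)
    have bigz: "?F \<inter> {x. x \<bullet> b = t} \<noteq> {}" if "g t \<noteq> 0" for t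
    proof -
      have "\<exists>r>0. ennreal r \<le> g t"
        using that by (cases "g t") (use that in \<open>auto intro: exI[of _ 1] exI[of _ "enn2real (g t)"]\<close>)
      then show ?thesis using big big_nonempty by blast
    qed
    define U where "U = (\<lambda>x. x \<bullet> b) ` ?F"
    have convF: "convex ?F"
    proof -
      have "?F = C \<inter> (\<Inter>b'\<in>Basis - set (b # bs). {x. x \<bullet> b' = z \<bullet> b'})" by (auto simp: flat_part_def)
      moreover have "convex \<dots>"
        using convex_hyperplane by (intro convex_Int C convex_INT) (simp add: inner_commute)
      ultimately show ?thesis by simp
    qed
    have "bounded U"
      unfolding U_def using C(2)
      by (intro bounded_linear_image[OF _ bounded_linear_inner_left]) (auto simp: flat_part_def intro: bounded_subset)
    have gU: "t \<in> U" if "g t \<noteq> 0" for t using bigz[OF that] by (auto simp: U_def)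
    have "U \<noteq> {}"
    proof
      assume "U = {}"
      then have "g t = 0" for t using gU by blast
      then show False using V by (simp add: g_def)
    qed
    define lo hi where "lo = Inf U" and "hi = Sup U"
    have lohi: "lo \<le> t" "t \<le> hi" if "t \<in> U" for t
      using that \<open>bounded U\<close> by (auto simp: lo_def hi_def intro!: cInf_lower cSup_upper bounded_imp_bdd_below bounded_imp_bdd_above)
    define d where "d = hi - lo"
    have "d \<ge> 0" using \<open>U \<noteq> {}\<close> lohi by (force simp: d_def)
    \<comment> \<open>Slices all below \<open>V / (2 * d)\<close> would give a total of at most
      \<open>V / 2\<close>. If \<open>d = 0\<close>, the integrand lives on one level and the
      integral vanishes.\<close>
    have "\<exists>t. ennreal (V / (2 * d)) \<le> g t \<and> d > 0"
    proof (rule ccontr)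
      assume no: "\<not> ?thesis"
      have "(\<integral>\<^sup>+t. g t \<partial>lborel) \<le> (\<integral>\<^sup>+t. ennreal (V / (2 * d)) * indicator {lo..hi} t \<partial>lborel)"
      proof (cases "d = 0")
        case True
        have "(\<integral>\<^sup>+t. g t \<partial>lborel) \<le> (\<integral>\<^sup>+t. \<infinity> * indicator {lo} t \<partial>lborel)"
          using gU lohi True by (intro nn_integral_mono) (force simp: d_def split: split_indicator)
        also have "\<dots> = 0" by (simp add: nn_integral_cmult_indicator)
        finally show ?thesis by simp
      next
        case False
        then have "d > 0" using \<open>d \<ge> 0\<close> by simp
        with no have "g t \<le> ennreal (V / (2 * d))" for t by (meson linear)
        then show ?thesis
          using gU lohi by (intro nn_integral_mono) (auto split: split_indicator)
      qed
      also have "\<dots> = ennreal (V / (2 * d)) * ennreal d"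
        using \<open>d \<ge> 0\<close> by (simp add: nn_integral_cmult d_def)
      also have "\<dots> \<le> ennreal (V / 2)"
        using V \<open>d \<ge> 0\<close> by (cases "d = 0") (auto simp: ennreal_mult'[symmetric])
      finally have "ennreal V \<le> ennreal (V / 2)"
        using V(2) unfolding g_def by (rule order_trans[rotated])
      then show False using V by (simp add: ennreal_le_iff)
    qed
    then obtain t0 where t0: "ennreal (V / (2 * d)) \<le> g t0" and d: "d > 0" by blast
    have b0: "big bs (c * (V / (2 * d))) (?F \<inter> {x. x \<bullet> b = t0})"
      using t0 d V by (intro big) auto
    define q where "q = c * (V / (2 * d)) / 2 ^ length bs"
    have q0: "c * (V / (2 * d)) \<ge> 0" using c V d by simp
    have "\<exists>a. \<forall>t\<in>{a..a + d / 6}. big bs q (?F \<inter> {x. x \<bullet> b = t})"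
    proof (cases "t0 - lo \<le> hi - t0")
      case True
      then have "t0 + d / 3 < hi" using d by (auto simp: d_def field_simps)
      then obtain y where "y \<in> U" "t0 + d / 3 < y"
        unfolding hi_def using \<open>U \<noteq> {}\<close> by (rule less_cSupE)
      then obtain x where x: "x \<in> ?F" "t0 + d / 3 < x \<bullet> b" by (auto simp: U_def)
      show ?thesis
      proof (rule exI[of _ t0], rule ballI)
        fix t assume "t \<in> {t0..t0 + d / 6}"
        with x show "big bs q (?F \<inter> {x. x \<bullet> b = t})"
          unfolding q_def by (intro big_slice_midpoint_right[OF convF b0 x(1) _ _ q0]) auto
      qed
    next
      case False
      then have "lo < t0 - d / 3" using d by (auto simp: d_def field_simps)
      then obtain y where "y \<in> U" "y < t0 - d / 3"
        unfolding lo_def using cInf_lessD[OF \<open>U \<noteq> {}\<close>] by blast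
      then obtain x where x: "x \<in> ?F" "x \<bullet> b < t0 - d / 3" by (auto simp: U_def)
      show ?thesis
      proof (rule exI[of _ "t0 - d / 6"], rule ballI)
        fix t assume "t \<in> {t0 - d / 6..t0 - d / 6 + d / 6}"
        with x show "big bs q (?F \<inter> {x. x \<bullet> b = t})"
          unfolding q_def by (intro big_slice_midpoint_left[OF convF b0 x(1) _ _ q0]) auto
      qed
    qed
    moreover have "c' * V / (d / 6) = q"
      using d by (simp add: c'_def q_def field_simps)
    ultimately show "big (b # bs) (c' * V) ?F"
      unfolding big.simps using d by (metis divide_pos_pos zero_less_numeral)
  qed
qed

section \<open>Interval-valued functions on grids\<close>

text \<open>Product Ramsey theorem by induction on the classes. A point \<open>s\<close> of the
  smaller grid is coloured by the whole function that assigns to each \<open>x\<close> in a fixed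
  finite \<open>Z\<close> the colour of \<open>s(c := x)\<close>. Where this function is constant,
  the colour depends on the new coordinate alone, and the pigeonhole principle on \<open>Z\<close>
  applies.\<close>

lemma grid_ramsey:
  assumes "finite Ct"
  shows "\<exists>N. \<forall>X (f :: ('a \<Rightarrow> 'b) \<Rightarrow> nat).
    (\<forall>c\<in>Ct. finite (X c) \<and> card (X c) \<ge> N) \<and> f ` PiE Ct X \<subseteq> {..<q} \<longrightarrow>
    (\<exists>Y col. (\<forall>c\<in>Ct. Y c \<subseteq> X c \<and> card (Y c) = t) \<and> (\<forall>s\<in>PiE Ct Y. f s = col))"
  using assms
proof (induction Ct arbitrary: q rule: finite_induct)
  case empty
  have "\<exists>Y col. (\<forall>c\<in>{}. Y c \<subseteq> X c \<and> card (Y c) = t) \<and> (\<forall>s\<in>PiE {} Y. f s = col)"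
    for X :: "'a \<Rightarrow> 'b set" and f :: "('a \<Rightarrow> 'b) \<Rightarrow> nat"
    by (rule exI[of _ X], rule exI[of _ "f (\<lambda>x. undefined)"]) simp
  then show ?case by simp
next
  case (insert c Ct)
  \<comment> \<open>With more than \<open>q * t\<close> points some colour occurs more than
    \<open>t\<close> times on \<open>Z\<close>. There are \<open>q ^ N1\<close> colour functions on
    \<open>Z\<close>; the bijection \<open>h\<close> renumbers them, since colours have to be
    natural numbers.\<close>
  define N1 where "N1 = q * t + 1"
  define Q where "Q = q ^ N1"
  from insert.IH[of Q] obtain N where N:
    "\<forall>X (f :: ('a \<Rightarrow> 'b) \<Rightarrow> nat).
      (\<forall>c\<in>Ct. finite (X c) \<and> card (X c) \<ge> N) \<and> f ` PiE Ct X \<subseteq> {..<Q} \<longrightarrow>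
      (\<exists>Y col. (\<forall>c\<in>Ct. Y c \<subseteq> X c \<and> card (Y c) = t) \<and> (\<forall>s\<in>PiE Ct Y. f s = col))" ..
  show ?case
  proof (intro exI[of _ "max N N1"] allI impI)
    fix X :: "'a \<Rightarrow> 'b set" and f :: "('a \<Rightarrow> 'b) \<Rightarrow> nat"
    assume "(\<forall>c\<in>insert c Ct. finite (X c) \<and> card (X c) \<ge> max N N1) \<and> f ` PiE (insert c Ct) X \<subseteq> {..<q}"
    then have X: "\<And>c'. c' \<in> Ct \<Longrightarrow> finite (X c') \<and> card (X c') \<ge> N" "finite (X c)" "card (X c) \<ge> N1"
      and f: "\<And>s. s \<in> PiE (insert c Ct) X \<Longrightarrow> f s < q"
      by auto
    obtain Z where Z: "Z \<subseteq> X c" "card Z = N1" "finite Z"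
      using obtain_subset_with_card_n[OF X(3)] by metis
    have fin: "finite (PiE Z (\<lambda>_. {..<q}))" "card (PiE Z (\<lambda>_. {..<q})) = Q"
      using Z by (auto simp: finite_PiE card_PiE Q_def)
    obtain h where h: "bij_betw h (PiE Z (\<lambda>_. {..<q})) {0..<Q}"
      using ex_bij_betw_finite_nat[OF fin(1)] fin(2) by auto
    define g where "g s = (\<lambda>x\<in>Z. f (s(c := x)))" for s
    have g: "g s \<in> PiE Z (\<lambda>_. {..<q})" if "s \<in> PiE Ct X" for s
    proof -
      have "s(c := x) \<in> PiE (insert c Ct) X" if "x \<in> Z" for x
        using \<open>s \<in> PiE Ct X\<close> that Z(1) by (intro PiE_fun_upd) auto
      then show ?thesis using f by (simp add: g_def)
    qed
    have "(\<forall>c\<in>Ct. finite (X c) \<and> card (X c) \<ge> N) \<and> (\<lambda>s. h (g s)) ` PiE Ct X \<subseteq> {..<Q}"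
    proof (intro conjI ballI subsetI)
      fix y assume "y \<in> (\<lambda>s. h (g s)) ` PiE Ct X"
      then obtain s where s: "s \<in> PiE Ct X" "y = h (g s)" by blast
      then have "h (g s) \<in> {0..<Q}" using bij_betwE[OF h] g by blast
      then show "y \<in> {..<Q}" using s by simp
    qed (use X in auto)
    with N have "\<exists>Y col. (\<forall>c\<in>Ct. Y c \<subseteq> X c \<and> card (Y c) = t) \<and> (\<forall>s\<in>PiE Ct Y. h (g s) = col)"
      by (elim allE impE)
    then obtain Y col where
      Y: "\<And>c. c \<in> Ct \<Longrightarrow> Y c \<subseteq> X c \<and> card (Y c) = t" and col: "\<And>s. s \<in> PiE Ct Y \<Longrightarrow> h (g s) = col"
      by blast
    have YX: "PiE Ct Y \<subseteq> PiE Ct X"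
      using Y by (intro PiE_mono) auto
    have gg: "g s = g s'" if "s \<in> PiE Ct Y" "s' \<in> PiE Ct Y" for s s'
    proof (rule inj_onD[OF bij_betw_imp_inj_on[OF h]])
      show "h (g s) = h (g s')" using col[OF that(1)] col[OF that(2)] by simp
    qed (use g YX that in blast)+
    define ph where "ph x = (if PiE Ct Y = {} then 0 else g (SOME s. s \<in> PiE Ct Y) x)" for x
    have ph: "f (s(c := x)) = ph x" if "s \<in> PiE Ct Y" "x \<in> Z" for s x
    proof -
      have "(SOME s. s \<in> PiE Ct Y) \<in> PiE Ct Y" using that by (metis someI)
      from gg[OF that(1) this] have "g s x = ph x"
        using that by (auto simp: ph_def)
      then show ?thesis using that by (simp add: g_def)
    qed
    have "\<exists>W col. W \<subseteq> Z \<and> card W = t \<and> (\<forall>x\<in>W. \<forall>s\<in>PiE Ct Y. f (s(c := x)) = col)"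
    \<comment> \<open>On an empty grid the colour condition is vacuous and only a set
      \<open>W\<close> of size \<open>t\<close> has to be found; for \<open>q = 0\<close> this works
      because then \<open>t = 0\<close>.\<close>
    proof (cases "PiE Ct Y = {}")
      case True
      show ?thesis
      proof (cases "q = 0")
        case True
        then show ?thesis
        proof (cases "t = 0")
          case False
          then have "Y c' \<noteq> {}" if "c' \<in> Ct" for c'
            using Y[OF that] by auto
          then have "PiE Ct Y \<noteq> {}"
            by (simp add: PiE_eq_empty_iff)
          then show ?thesis using \<open>PiE Ct Y = {}\<close> by simp
        qed (auto intro!: exI[of _ "{}"])
      next
        case False
        then have "t \<le> q * t" by (cases q) auto
        then have "t \<le> card Z" unfolding Z(2) N1_def by linarith
        then obtain W where "W \<subseteq> Z" "card W = t"
          using obtain_subset_with_card_n by metis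
        with True show ?thesis by auto
      qed
    next
      case False
      have phZ: "ph \<in> Z \<rightarrow> {..<q}"
      proof
        fix x assume "x \<in> Z"
        obtain s where s: "s \<in> PiE Ct Y" using False by auto
        then have "g s \<in> PiE Z (\<lambda>_. {..<q})" using g YX by blast
        then have "g s x < q" using PiE_mem[of "g s" Z "\<lambda>_. {..<q}" x] \<open>x \<in> Z\<close> by simp
        then show "ph x \<in> {..<q}"
          using ph[OF s \<open>x \<in> Z\<close>] \<open>x \<in> Z\<close> by (simp add: g_def)
      qed
      have "card Z > card {..<q} * t" using Z by (simp add: N1_def)
      have "\<exists>y<q. card (ph -` {y} \<inter> Z) > t"
      proof (rule ccontr)
        assume *: "\<not> (\<exists>y<q. card (ph -` {y} \<inter> Z) > t)"
        have "card Z = (\<Sum>y<q. card (ph -` {y} \<inter> Z))"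
        proof -
          have "Z = (\<Union>y<q. ph -` {y} \<inter> Z)" using phZ by auto
          then have "card Z = card (\<Union>y<q. ph -` {y} \<inter> Z)" by simp
          also have "\<dots> = (\<Sum>y<q. card (ph -` {y} \<inter> Z))"
            using Z by (intro card_UN_disjoint) auto
          finally show ?thesis .
        qed
        also have "\<dots> \<le> (\<Sum>y<q. t)"
          by (intro sum_mono) (use * in \<open>meson lessThan_iff not_less\<close>)
        finally show False using \<open>card Z > card {..<q} * t\<close> by simp
      qed
      then obtain y where y: "y < q" "card (ph -` {y} \<inter> Z) > t" by blast
      then obtain W where W: "W \<subseteq> ph -` {y} \<inter> Z" "card W = t"
        by (meson obtain_subset_with_card_n order.strict_implies_order)
      have "f (s(c := x)) = y" if "x \<in> W" "s \<in> PiE Ct Y" for x s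
        using ph[of s x] W that by auto
      then show ?thesis
        using W by (intro exI[of _ W] exI[of _ y]) auto
    qed
    then obtain W col' where W: "W \<subseteq> Z" "card W = t"
      and col': "\<And>x s. x \<in> W \<Longrightarrow> s \<in> PiE Ct Y \<Longrightarrow> f (s(c := x)) = col'" by blast
    have "f s = col'" if s: "s \<in> PiE (insert c Ct) (Y(c := W))" for s
    proof -
      have "s(c := undefined) \<in> PiE Ct Y"
      proof (rule PiE_I)
        fix c' assume "c' \<in> Ct"
        then show "(s(c := undefined)) c' \<in> Y c'"
          using PiE_mem[OF s, of c'] insert.hyps(2) by auto
      next
        fix c' assume "c' \<notin> Ct"
        then show "(s(c := undefined)) c' = undefined"
          using PiE_arb[OF s, of c'] by auto
      qed
      moreover have "s c \<in> W" using PiE_mem[OF s, of c] by auto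
      ultimately have "f ((s(c := undefined))(c := s c)) = col'" by (rule col'[rotated])
      then show ?thesis by simp
    qed
    moreover have "\<forall>c'\<in>insert c Ct. (Y(c := W)) c' \<subseteq> X c' \<and> card ((Y(c := W)) c') = t"
      using Y W Z by auto
    ultimately show "\<exists>Y col. (\<forall>c\<in>insert c Ct. Y c \<subseteq> X c \<and> card (Y c) = t) \<and> (\<forall>s\<in>PiE (insert c Ct) Y. f s = col)"
      by (intro exI[of _ "Y(c := W)"] exI[of _ col'] conjI ballI) blast+
  qed
qed

text \<open>
  To every transversal \<open>s\<close> of the classes \<open>X c\<close> belongs an interval \<open>[a s, b s]\<close>. Either all
  intervals of a subgrid share an interval of comparable length, or some class \<open>c\<close> can be given
  up: every line of the subgrid in direction \<open>c\<close> carries one interval inside the window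
  \<open>[x, x + l]\<close> and another one reaching far beyond it, on the same side for all lines.
\<close>

definition aligned_subgrid ::
  "'a set \<Rightarrow> nat \<Rightarrow> real \<Rightarrow> ('a \<Rightarrow> 'b set) \<Rightarrow> (('a \<Rightarrow> 'b) \<Rightarrow> real) \<Rightarrow> (('a \<Rightarrow> 'b) \<Rightarrow> real) \<Rightarrow> bool" where
  "aligned_subgrid Ct n k X a b \<longleftrightarrow>
    (\<exists>Y x l. l > 0 \<and> (\<forall>c\<in>Ct. Y c \<subseteq> X c \<and> card (Y c) = n) \<and>
      ((\<forall>s\<in>PiE Ct Y. a s \<le> x \<and> x + l \<le> b s \<and> k * (b s - a s) \<le> l) \<or>
       (\<exists>c\<in>Ct. \<forall>t\<in>PiE (Ct - {c}) Y. \<exists>i\<in>X c. \<exists>j\<in>X c.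
          x \<le> a (t(c := i)) \<and> b (t(c := i)) \<le> x + l \<and> x + 4 * l \<le> b (t(c := j))) \<or>
       (\<exists>c\<in>Ct. \<forall>t\<in>PiE (Ct - {c}) Y. \<exists>i\<in>X c. \<exists>j\<in>X c.
          x \<le> a (t(c := i)) \<and> b (t(c := i)) \<le> x + l \<and> a (t(c := j)) \<le> x - 3 * l)))"

lemma subgrid_of_card:
  assumes "\<And>c. c \<in> Ct \<Longrightarrow> n \<le> card (Y c)"
  obtains Y' where "\<And>c. c \<in> Ct \<Longrightarrow> Y' c \<subseteq> Y c \<and> card (Y' c) = n"
proof -
  have "\<exists>Z. Z \<subseteq> Y c \<and> card Z = n" if "c \<in> Ct" for c
    using obtain_subset_with_card_n[OF assms[OF that]] by metis
  then show thesis using that by metis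
qed

text \<open>
  Replaces the sides of the grid \<open>A\<close> by sides of \<open>B\<close> one at a time. As long as no class can be
  given up, the intervals stay in a window that grows by a factor 7 per replacement.
\<close>

lemma hybrid_chain:
  fixes F :: "nat \<Rightarrow> nat" and a b :: "('a \<Rightarrow> 'b) \<Rightarrow> real"
  assumes "finite Ct" and F0: "F 0 \<ge> 1" and Fmono: "mono F"
    and F: "\<And>j X (f :: ('a \<Rightarrow> 'b) \<Rightarrow> nat). (\<And>c. c \<in> Ct \<Longrightarrow> finite (X c) \<and> card (X c) \<ge> F (Suc j)) \<Longrightarrow>
      f ` PiE Ct X \<subseteq> {..<3} \<Longrightarrow>
      \<exists>Y col. (\<forall>c\<in>Ct. Y c \<subseteq> X c \<and> card (Y c) = F j) \<and> (\<forall>s\<in>PiE Ct Y. f s = col)"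
    and A: "\<And>c. c \<in> Ct \<Longrightarrow> finite (A c) \<and> card (A c) = F (card Ct) \<and> A c \<subseteq> X c"
    and B: "\<And>c. c \<in> Ct \<Longrightarrow> finite (B c) \<and> card (B c) \<ge> F (card Ct) \<and> B c \<subseteq> X c"
    and w: "w > 0" and AW: "\<And>s. s \<in> PiE Ct A \<Longrightarrow> x0 \<le> a s \<and> b s \<le> x0 + w"
    and no: "\<not> aligned_subgrid Ct (F 0) k X a b"
    and D: "D \<subseteq> Ct"
  shows "\<exists>Z x. (\<forall>c\<in>Ct. Z c \<subseteq> (if c \<in> D then B c else A c) \<and> card (Z c) = F (card Ct - card D)) \<and>
    (\<forall>s\<in>PiE Ct Z. x \<le> a s \<and> b s \<le> x + 7 ^ card D * w) \<and> x0 - 7 ^ card D * w \<le> x \<and> x \<le> x0"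
  using finite_subset[OF D \<open>finite Ct\<close>] D
proof (induction D rule: finite_subset_induct')
  case empty
  show ?case
    by (rule exI[of _ A], rule exI[of _ x0]) (use A AW w in auto)
next
  case (insert c D)
  from insert.IH obtain Z x where
    Z': "\<forall>c\<in>Ct. Z c \<subseteq> (if c \<in> D then B c else A c) \<and> card (Z c) = F (card Ct - card D)"
    and ZW': "\<forall>s\<in>PiE Ct Z. x \<le> a s \<and> b s \<le> x + 7 ^ card D * w"
    and x: "x0 - 7 ^ card D * w \<le> x" "x \<le> x0"
    by (elim exE conjE) (rule that; assumption)
  note Z = bspec[OF Z'] and ZW = bspec[OF ZW']
  define v where "v = 7 ^ card D * w"
  have v: "v > 0" using w by (simp add: v_def)
  note ZW = ZW[folded v_def] and x = x[folded v_def]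
  have "card (insert c D) \<le> card Ct"
    using insert \<open>finite Ct\<close> by (intro card_mono) auto
  then have cD: "card D < card Ct" "card (insert c D) = Suc (card D)" using insert by auto
  then obtain j where j: "card Ct - card D = Suc j" "card Ct - card (insert c D) = j"
    by (metis Suc_diff_Suc)
  have FF: "F (Suc j) \<le> F (card Ct)" using j by (intro monoD[OF Fmono]) auto
  define S where "S = Z(c := B c)"
  \<comment> \<open>Colours 0 and 1 mark intervals that reach far to the right or left of the window
    \<open>[x, x + v]\<close>, the situations in which class \<open>c\<close> could be given up.
    Colour 2 confines the interval to \<open>[x - 3 * v, x + 4 * v]\<close>, whence the factor
    7.\<close>
  define f where "f s = (if x + 4 * v \<le> b s then 0 else if a s \<le> x - 3 * v then 1 else 2 :: nat)" for s
  have finZ: "finite (Z e) \<and> Z e \<subseteq> X e" if "e \<in> Ct" for e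
    using A[OF that] B[OF that] Z[OF that] by (auto split: if_splits intro: finite_subset)
  have "\<exists>Y col. (\<forall>c\<in>Ct. Y c \<subseteq> S c \<and> card (Y c) = F j) \<and> (\<forall>s\<in>PiE Ct Y. f s = col)"
  proof (rule F)
    show "finite (S e) \<and> card (S e) \<ge> F (Suc j)" if "e \<in> Ct" for e
      using B[OF that] Z[OF that] finZ[OF that] FF j by (auto simp: S_def)
  qed (auto simp: f_def)
  then obtain Y col where Y: "\<forall>c\<in>Ct. Y c \<subseteq> S c \<and> card (Y c) = F j"
    and col: "\<forall>s\<in>PiE Ct Y. f s = col"
    by (elim exE conjE) (rule that; assumption)
  note Y = bspec[OF Y] and col = bspec[OF col]
  have "F 0 \<le> F j" by (intro monoD[OF Fmono]) auto
  then have "F 0 \<le> card (Y e)" if "e \<in> Ct" for e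
    using Y[OF that] by simp
  then obtain Y' where Y': "\<And>c. c \<in> Ct \<Longrightarrow> Y' c \<subseteq> Y c \<and> card (Y' c) = F 0"
    using subgrid_of_card[of Ct "F 0" Y] by metis
  have YX: "Y e \<subseteq> X e" if "e \<in> Ct" for e
    using Y[OF that] finZ[OF that] B[OF that] by (auto simp: S_def split: if_splits)
  \<comment> \<open>On each line in direction \<open>c\<close> the old side \<open>Z c\<close>
    supplies an interval in the window and the new side one of colour \<open>col\<close>. The other
    coordinates fit both grids, as \<open>S\<close> differs from \<open>Z\<close> in side
    \<open>c\<close> only.\<close>
  have line: "\<exists>i\<in>X c. \<exists>i'\<in>X c. x \<le> a (t(c := i)) \<and> b (t(c := i)) \<le> x + v \<and> f (t(c := i')) = col"
    if t: "t \<in> PiE (Ct - {c}) Y'" for t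
  proof -
    have "Z c \<noteq> {}" "Y c \<noteq> {}"
      using Z[OF \<open>c \<in> Ct\<close>] Y[OF \<open>c \<in> Ct\<close>] \<open>F 0 \<le> F j\<close> F0 monoD[OF Fmono, of 0 "Suc j"] j by force+
    then obtain i i' where i: "i \<in> Z c" "i' \<in> Y c" by auto
    have ins: "insert c (Ct - {c}) = Ct" using \<open>c \<in> Ct\<close> by auto
    have "t(c := i) \<in> PiE (insert c (Ct - {c})) Z"
    proof (rule PiE_fun_upd[where T = Z, OF i(1)])
      show "t \<in> PiE (Ct - {c}) Z"
        using t by (rule subsetD[OF PiE_mono, rotated]) (use Y Y' in \<open>force simp: S_def\<close>)
    qed
    moreover have "t(c := i') \<in> PiE (insert c (Ct - {c})) Y"
    proof (rule PiE_fun_upd[where T = Y, OF i(2)])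
      show "t \<in> PiE (Ct - {c}) Y"
        using t by (rule subsetD[OF PiE_mono, rotated]) (use Y Y' in force)
    qed
    ultimately show ?thesis
      using ZW col i finZ[OF \<open>c \<in> Ct\<close>] YX[OF \<open>c \<in> Ct\<close>] unfolding ins by blast
  qed
  have Y'X: "\<forall>c\<in>Ct. Y' c \<subseteq> X c \<and> card (Y' c) = F 0" using Y' YX by blast
  have "col \<noteq> 0"
  proof
    assume 0: "col = 0"
    have "\<forall>t\<in>PiE (Ct - {c}) Y'. \<exists>i\<in>X c. \<exists>j\<in>X c.
        x \<le> a (t(c := i)) \<and> b (t(c := i)) \<le> x + v \<and> x + 4 * v \<le> b (t(c := j))"
    proof
      fix t assume "t \<in> PiE (Ct - {c}) Y'"
      from line[OF this] obtain i i' where "i \<in> X c" "i' \<in> X c" "x \<le> a (t(c := i))" "b (t(c := i)) \<le> x + v"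
         "f (t(c := i')) = 0" using 0 by blast
      moreover from this have "x + 4 * v \<le> b (t(c := i'))" by (auto simp: f_def split: if_splits)
      ultimately show "\<exists>i\<in>X c. \<exists>j\<in>X c.
        x \<le> a (t(c := i)) \<and> b (t(c := i)) \<le> x + v \<and> x + 4 * v \<le> b (t(c := j))" by blast
    qed
    then have "aligned_subgrid Ct (F 0) k X a b"
      unfolding aligned_subgrid_def using v Y'X \<open>c \<in> Ct\<close> by blast
    with no show False by simp
  qed
  moreover have "col \<noteq> 1"
  proof
    assume 1: "col = 1"
    have "\<forall>t\<in>PiE (Ct - {c}) Y'. \<exists>i\<in>X c. \<exists>j\<in>X c.
        x \<le> a (t(c := i)) \<and> b (t(c := i)) \<le> x + v \<and> a (t(c := j)) \<le> x - 3 * v"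
    proof
      fix t assume "t \<in> PiE (Ct - {c}) Y'"
      from line[OF this] obtain i i' where "i \<in> X c" "i' \<in> X c" "x \<le> a (t(c := i))" "b (t(c := i)) \<le> x + v"
         "f (t(c := i')) = 1" using 1 by blast
      moreover from this have "a (t(c := i')) \<le> x - 3 * v" by (auto simp: f_def split: if_splits)
      ultimately show "\<exists>i\<in>X c. \<exists>j\<in>X c.
        x \<le> a (t(c := i)) \<and> b (t(c := i)) \<le> x + v \<and> a (t(c := j)) \<le> x - 3 * v" by blast
    qed
    then have "aligned_subgrid Ct (F 0) k X a b"
      unfolding aligned_subgrid_def using v Y'X \<open>c \<in> Ct\<close> by blast
    with no show False by simp
  qed
  ultimately have in': "x - 3 * v \<le> a s \<and> b s \<le> x - 3 * v + 7 * v" if "s \<in> PiE Ct Y" for s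
    using col[OF that] by (auto simp: f_def split: if_splits)
  have w7: "7 ^ card (insert c D) * w = 7 * v" using cD by (simp add: v_def)
  show ?case
  proof (intro exI[of _ Y] exI[of _ "x - 3 * v"] conjI ballI)
    show "Y e \<subseteq> (if e \<in> insert c D then B e else A e)" if "e \<in> Ct" for e
      using Y[OF that] Z[OF that] by (auto simp: S_def split: if_splits)
    show "card (Y e) = F (card Ct - card (insert c D))" if "e \<in> Ct" for e
      using Y[OF that] j by simp
  qed (use in' w7 x v in auto)
qed

text \<open>Intervals come without a unit of length, so one is manufactured: among the finitely many
  subgrids of side \<open>s\<close>, take one whose intervals have the shortest hull. Subgrids are
  restricted to \<open>Ct\<close> to make their number finite.\<close>

lemma shortest_captured_subgrid:
  fixes a b :: "('a \<Rightarrow> 'b) \<Rightarrow> real"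
  assumes "finite Ct" "s \<ge> 1" and X: "\<And>c. c \<in> Ct \<Longrightarrow> finite (X c) \<and> card (X c) \<ge> s"
    and ab: "\<And>t. t \<in> PiE Ct X \<Longrightarrow> a t < b t"
  obtains G y l where "\<And>c. c \<in> Ct \<Longrightarrow> G c \<subseteq> X c \<and> card (G c) = s" "l > 0"
    "\<And>t. t \<in> PiE Ct G \<Longrightarrow> y \<le> a t \<and> b t \<le> y + l"
    "\<And>G' y' l'. (\<And>c. c \<in> Ct \<Longrightarrow> G' c \<subseteq> X c \<and> card (G' c) = s) \<Longrightarrow>
      (\<And>t. t \<in> PiE Ct G' \<Longrightarrow> y' \<le> a t \<and> b t \<le> y' + l') \<Longrightarrow> l \<le> l'"
proof -
  define GG where "GG = PiE Ct (\<lambda>c. {Z. Z \<subseteq> X c \<and> card Z = s})"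
  define len where "len G = Max (b ` PiE Ct G) - Min (a ` PiE Ct G)" for G
  have fin: "finite (PiE Ct G)" "PiE Ct G \<noteq> {}" "PiE Ct G \<subseteq> PiE Ct X"
    if "\<And>c. c \<in> Ct \<Longrightarrow> G c \<subseteq> X c \<and> card (G c) = s" for G
  proof -
    have "finite (G c) \<and> G c \<noteq> {}" if "c \<in> Ct" for c
      using X[OF that] \<open>\<And>c. c \<in> Ct \<Longrightarrow> G c \<subseteq> X c \<and> card (G c) = s\<close>[OF that] \<open>s \<ge> 1\<close>
      by (metis card.empty finite_subset not_one_le_zero)
    then show "finite (PiE Ct G)" "PiE Ct G \<noteq> {}"
      using \<open>finite Ct\<close> by (auto intro!: finite_PiE simp: PiE_eq_empty_iff)
    show "PiE Ct G \<subseteq> PiE Ct X"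
      using that by (intro PiE_mono) auto
  qed
  have "finite GG"
    unfolding GG_def using \<open>finite Ct\<close> X by (intro finite_PiE) (auto intro: finite_subset[of _ "Pow _"])
  have mem: "restrict G Ct \<in> GG" if "\<And>c. c \<in> Ct \<Longrightarrow> G c \<subseteq> X c \<and> card (G c) = s" for G
    using that by (simp add: GG_def)
  have PiE_restrict: "PiE Ct (restrict G Ct) = PiE Ct G" for G :: "'a \<Rightarrow> 'b set"
    by (rule PiE_cong) simp
  obtain G0 where G0: "\<And>c. c \<in> Ct \<Longrightarrow> G0 c \<subseteq> X c \<and> card (G0 c) = s"
    using subgrid_of_card[of Ct s X] X by metis
  have "finite (len ` GG)" "len ` GG \<noteq> {}"
    using \<open>finite GG\<close> mem[OF G0] by auto
  from Min_in[OF this] obtain G where G: "G \<in> GG" "len G = Min (len ` GG)" by auto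
  have Gp: "G c \<subseteq> X c \<and> card (G c) = s" if "c \<in> Ct" for c
    using PiE_mem[OF G(1)[unfolded GG_def] that] by simp
  note fG = fin[OF Gp]
  have bnd: "Min (a ` PiE Ct G) \<le> a t" "b t \<le> Max (b ` PiE Ct G)" if "t \<in> PiE Ct G" for t
    using fG(1) that by auto
  show thesis
  proof (rule that[OF Gp])
    obtain t where t: "t \<in> PiE Ct G" using fG(2) by blast
    with fG(3) have "a t < b t" using ab by blast
    with bnd[OF t] show "0 < len G" by (simp add: len_def)
    show "Min (a ` PiE Ct G) \<le> a t \<and> b t \<le> Min (a ` PiE Ct G) + len G" if "t \<in> PiE Ct G" for t
      using bnd[OF that] by (simp add: len_def)
    fix G' y' l'
    assume G': "\<And>c. c \<in> Ct \<Longrightarrow> G' c \<subseteq> X c \<and> card (G' c) = s"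
      and yl: "\<And>t. t \<in> PiE Ct G' \<Longrightarrow> y' \<le> a t \<and> b t \<le> y' + l'"
    have "len G \<le> len (restrict G' Ct)"
      using mem[OF G'] \<open>finite GG\<close> by (simp add: G(2))
    also have "\<dots> = Max (b ` PiE Ct G') - Min (a ` PiE Ct G')"
      by (simp only: len_def PiE_restrict)
    also have "\<dots> \<le> l'"
    proof -
      note f = fin[OF G']
      have "Max (b ` PiE Ct G') \<le> y' + l'" "y' \<le> Min (a ` PiE Ct G')"
        using f(1,2) yl by auto
      then show ?thesis by simp
    qed
    finally show "len G \<le> l'" .
  qed
qed

lemma nat_floor_div_bounds:
  fixes z u :: real
  assumes "u > 0" "z \<ge> 0"
  shows "real (nat \<lfloor>z / u\<rfloor>) * u \<le> z" "z < (real (nat \<lfloor>z / u\<rfloor>) + 1) * u"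
proof -
  have "real (nat \<lfloor>z / u\<rfloor>) = of_int \<lfloor>z / u\<rfloor>" using assms by simp
  then show "real (nat \<lfloor>z / u\<rfloor>) * u \<le> z" "z < (real (nat \<lfloor>z / u\<rfloor>) + 1) * u"
    using floor_divide_lower[OF assms(1), of z] floor_divide_upper[OF assms(1), of z] by simp_all
qed

text \<open>Inside the shortest captured grid \<open>G\<close> there is a subgrid \<open>A\<close>
  whose intervals start nearly at the same place. If they are long, they share an interval. If they
  are short, they lie in a tiny window; exchanging the sides of \<open>A\<close> for those of a grid
  \<open>B\<close> outside \<open>G\<close> ends, unless some class can be given up on the way, with
  intervals of \<open>B\<close> that are still short and near \<open>G\<close>. But minimality of
  \<open>G\<close> forces the intervals of \<open>B\<close> to be long or far away.\<close>

theorem aligned_subgrid_exists: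
  assumes "finite Ct" "n \<ge> 1"
  shows "\<exists>N k. k > 0 \<and> (\<forall>X (a :: ('a \<Rightarrow> 'b) \<Rightarrow> real) b.
    (\<forall>c\<in>Ct. finite (X c) \<and> card (X c) \<ge> N) \<and> (\<forall>s\<in>PiE Ct X. a s < b s) \<longrightarrow>
    aligned_subgrid Ct n k X a b)"
proof -
  define R where "R q t N \<longleftrightarrow> (\<forall>X (f :: ('a \<Rightarrow> 'b) \<Rightarrow> nat).
    (\<forall>c\<in>Ct. finite (X c) \<and> card (X c) \<ge> N) \<and> f ` PiE Ct X \<subseteq> {..<q} \<longrightarrow>
    (\<exists>Y col. (\<forall>c\<in>Ct. Y c \<subseteq> X c \<and> card (Y c) = t) \<and> (\<forall>s\<in>PiE Ct Y. f s = col)))" for q t N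
  have "\<exists>N. R q t N" for q t
    unfolding R_def by (rule grid_ramsey[OF \<open>finite Ct\<close>])
  then obtain NR where NR: "\<And>q t. R q t (NR q t)" by metis
  have ramsey: "\<exists>Y col. (\<forall>c\<in>Ct. Y c \<subseteq> X c \<and> card (Y c) = t) \<and> (\<forall>s\<in>PiE Ct Y. f s = col)"
    if "\<And>c. c \<in> Ct \<Longrightarrow> finite (X c) \<and> card (X c) \<ge> NR q t" "f ` PiE Ct X \<subseteq> {..<q}"
    for X q t and f :: "('a \<Rightarrow> 'b) \<Rightarrow> nat"
    by (rule NR[unfolded R_def, THEN spec, THEN spec, THEN mp]) (use that in blast)
  define F where "F = rec_nat n (\<lambda>_ m. max m (NR 3 m))"
  have F0: "F 0 = n" and FS: "F (Suc j) = max (F j) (NR 3 (F j))" for j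
    by (simp_all add: F_def)
  have Fmono: "mono F" by (rule incseq_SucI) (simp add: FS)
  have F: "\<exists>Y col. (\<forall>c\<in>Ct. Y c \<subseteq> X c \<and> card (Y c) = F j) \<and> (\<forall>s\<in>PiE Ct Y. f s = col)"
    if "\<And>c. c \<in> Ct \<Longrightarrow> finite (X c) \<and> card (X c) \<ge> F (Suc j)" "f ` PiE Ct X \<subseteq> {..<3}"
    for X j and f :: "('a \<Rightarrow> 'b) \<Rightarrow> nat"
    by (rule ramsey[OF _ that(2)]) (use that(1) in \<open>simp add: FS\<close>)
  define m where "m = card Ct"
  define K :: nat where "K = 7 ^ m"
  have K: "K \<ge> 1" by (simp add: K_def)
  \<comment> \<open>One side length for two purposes: \<open>G\<close> must contain a homogeneous
    \<open>A\<close>, and \<open>B\<close> must be large enough for the exchange. The summand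
    \<open>s\<close> in \<open>N\<close> is the room taken by \<open>G\<close>.\<close>
  define s where "s = max (F m) (NR (48 * K) (F m))"
  have "F m \<ge> 1" using monoD[OF Fmono, of 0 m] F0 \<open>n \<ge> 1\<close> by simp
  then have s: "s \<ge> 1" by (simp add: s_def)
  define N where "N = s + NR 15 s"
  define k where "k = 1 / (24 * real K)"
  show ?thesis
  proof (intro exI[of _ N] exI[of _ k] conjI allI impI)
    show "k > 0" using K by (simp add: k_def)
    fix X and a b :: "('a \<Rightarrow> 'b) \<Rightarrow> real"
    assume "(\<forall>c\<in>Ct. finite (X c) \<and> card (X c) \<ge> N) \<and> (\<forall>s\<in>PiE Ct X. a s < b s)"
    then have X: "\<And>c. c \<in> Ct \<Longrightarrow> finite (X c) \<and> card (X c) \<ge> N"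
      and ab: "\<And>t. t \<in> PiE Ct X \<Longrightarrow> a t < b t" by blast+
    have Xs: "\<And>c. c \<in> Ct \<Longrightarrow> finite (X c) \<and> card (X c) \<ge> s"
      using X by (force simp: N_def)
    obtain G y l where G: "\<And>c. c \<in> Ct \<Longrightarrow> G c \<subseteq> X c \<and> card (G c) = s" and l: "l > 0"
      and Gl: "\<And>t. t \<in> PiE Ct G \<Longrightarrow> y \<le> a t \<and> b t \<le> y + l"
      and min: "\<And>G' y' l'. (\<And>c. c \<in> Ct \<Longrightarrow> G' c \<subseteq> X c \<and> card (G' c) = s) \<Longrightarrow>
        (\<And>t. t \<in> PiE Ct G' \<Longrightarrow> y' \<le> a t \<and> b t \<le> y' + l') \<Longrightarrow> l \<le> l'"
      by (rule shortest_captured_subgrid[OF \<open>finite Ct\<close> s Xs ab]) blast+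
    have sub: "PiE Ct W \<subseteq> PiE Ct W'" if "\<And>c. c \<in> Ct \<Longrightarrow> W c \<subseteq> W' c" for W W' :: "'a \<Rightarrow> 'b set"
      using that by (intro PiE_mono) auto

    \<comment> \<open>On a grid disjoint from \<open>G\<close> the intervals cannot all be short and close to each other, since
      \<open>G\<close> is captured by a shortest possible interval; so they are far from \<open>G\<close> or long.\<close>
    define g where "g t = (if y + 2 * l \<le> b t then 0 else if a t \<le> y - l then 1
      else if l / 4 \<le> b t - a t then 2 else 3 + nat \<lfloor>(a t - (y - l)) / (l / 4)\<rfloor>)" for t
    have "\<exists>B col. (\<forall>c\<in>Ct. B c \<subseteq> X c - G c \<and> card (B c) = s) \<and> (\<forall>t\<in>PiE Ct B. g t = col)"
    proof (rule ramsey[where q = 15])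
      show "finite (X c - G c) \<and> NR 15 s \<le> card (X c - G c)" if "c \<in> Ct" for c
        using X[OF that] G[OF that] by (auto simp: card_Diff_subset finite_subset N_def)
      have "g t < 15" if t: "t \<in> PiE Ct (\<lambda>c. X c - G c)" for t
      proof -
        have "t \<in> PiE Ct X" using t sub[of "\<lambda>c. X c - G c" X] by blast
        then have "a t < b t" by (rule ab)
        define z where "z = a t - (y - l)"
        \<comment> \<open>15 = 3 + 12: the remaining starting points lie strictly between
          \<open>y - l\<close> and \<open>y + 2 * l\<close>, a range cut into cells of length
          \<open>l / 4\<close>.\<close>
        have "nat \<lfloor>z / (l / 4)\<rfloor> < 12" if "0 < z" "z < 3 * l"
        proof -
          have "z / (l / 4) < 12" using that l by (simp add: field_simps)
          then show ?thesis using that l by (simp add: nat_less_iff floor_less_iff)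
        qed
        then show ?thesis
          using \<open>a t < b t\<close> by (auto simp: g_def z_def)
      qed
      then show "g ` (\<Pi>\<^sub>E c\<in>Ct. X c - G c) \<subseteq> {..<15}" by blast
    qed
    then obtain B col where B': "\<forall>c\<in>Ct. B c \<subseteq> X c - G c \<and> card (B c) = s" and col': "\<forall>t\<in>PiE Ct B. g t = col"
      by (elim exE conjE) (rule that; assumption)
    note B = bspec[OF B'] and col = bspec[OF col']
    have BX: "PiE Ct B \<subseteq> PiE Ct X" using B by (intro sub) blast
    have Bfar: "y + 2 * l \<le> b t \<or> a t \<le> y - l \<or> l / 4 \<le> b t - a t" if "t \<in> PiE Ct B" for t
    proof (rule ccontr)
      assume "\<not> ?thesis"
      with col[OF that] have c3: "col \<ge> 3" by (auto simp: g_def)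
      \<comment> \<open>All intervals of \<open>B\<close> would start in one cell and be shorter
        than a cell, so a window of length \<open>l / 2\<close> would capture
        \<open>B\<close>.\<close>
      define z where "z = y - l + real (col - 3) * (l / 4)"
      have "z \<le> a t' \<and> b t' \<le> z + l / 2" if t': "t' \<in> PiE Ct B" for t'
      proof -
        have a1: "\<not> a t' \<le> y - l" "b t' - a t' < l / 4" "col - 3 = nat \<lfloor>(a t' - (y - l)) / (l / 4)\<rfloor>"
          using col[OF t'] c3 by (auto simp: g_def split: if_splits)
        have "real (col - 3) * (l / 4) \<le> a t' - (y - l)" "a t' - (y - l) < (real (col - 3) + 1) * (l / 4)"
          unfolding a1(3) using nat_floor_div_bounds[of "l / 4" "a t' - (y - l)"] l a1(1) by auto
        then show ?thesis using a1(2) by (simp add: z_def algebra_simps)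
      qed
      from min[OF _ this] B have "l \<le> l / 2" by blast
      then show False using l by simp
    qed

    \<comment> \<open>The cells are so fine that the window \<open>3 * u\<close> grows only to
      \<open>7 ^ card Ct * (3 * u) = l / 8\<close> in \<open>card Ct\<close> exchanges, below the
      threshold \<open>l / 4\<close> for \<open>B\<close>. The parity of \<open>h\<close> records
      whether the interval is long, hence \<open>48 * K\<close> colours for \<open>24 * K\<close>
      cells.\<close>
    define u where "u = l / (24 * real K)"
    have u: "u > 0" "24 * real K * u = l" using l K by (auto simp: u_def)
    define h where "h t = 2 * nat \<lfloor>(a t - y) / u\<rfloor> + (if 2 * u \<le> b t - a t then 1 else 0)" for t
    have "\<exists>A col. (\<forall>c\<in>Ct. A c \<subseteq> G c \<and> card (A c) = F m) \<and> (\<forall>t\<in>PiE Ct A. h t = col)"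
    proof (rule ramsey[where q = "48 * K"])
      show "finite (G c) \<and> NR (48 * K) (F m) \<le> card (G c)" if "c \<in> Ct" for c
        using G[OF that] X[OF that] by (auto simp: s_def intro: finite_subset)
      have "h t < 48 * K" if t: "t \<in> PiE Ct G" for t
      proof -
        have "t \<in> PiE Ct X" using t sub[of G X] G by blast
        then have "a t < b t" by (rule ab)
        with Gl[OF t] have "0 \<le> a t - y" "a t - y < 24 * real K * u" using u by auto
        then have "(a t - y) / u < of_nat (24 * K)" "0 \<le> (a t - y) / u"
          using u(1) by (auto simp: pos_divide_less_eq)
        then have "nat \<lfloor>(a t - y) / u\<rfloor> < 24 * K"
          by (metis floor_less_iff nat_less_iff of_int_of_nat_eq zero_le_floor)
        then show ?thesis by (auto simp: h_def)
      qed
      then show "h ` PiE Ct G \<subseteq> {..<48 * K}" by blast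
    qed
    then obtain A hol where A': "\<forall>c\<in>Ct. A c \<subseteq> G c \<and> card (A c) = F m" and hol': "\<forall>t\<in>PiE Ct A. h t = hol"
      by (elim exE conjE) (rule that; assumption)
    note A = bspec[OF A'] and hol = bspec[OF hol']
    have AG: "PiE Ct A \<subseteq> PiE Ct G" using A by (intro sub) blast
    define x0 where "x0 = y + real (hol div 2) * u"
    have Ab: "x0 \<le> a t \<and> a t < x0 + u" if t: "t \<in> PiE Ct A" for t
    proof -
      have "hol div 2 = nat \<lfloor>(a t - y) / u\<rfloor>" using hol[OF t] by (auto simp: h_def)
      moreover have "0 \<le> a t - y" using Gl t AG by fastforce
      ultimately show ?thesis
        using nat_floor_div_bounds[of u "a t - y"] u(1) by (auto simp: x0_def algebra_simps)
    qed
    have finA: "finite (A c) \<and> A c \<subseteq> X c" if "c \<in> Ct" for c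
      using A[OF that] G[OF that] X[OF that] by (auto intro: finite_subset)
    show "aligned_subgrid Ct n k X a b"
    proof (cases "odd hol")
      case True
      have "n \<le> card (A c)" if "c \<in> Ct" for c
        using A[OF that] monoD[OF Fmono, of 0 m] F0 by simp
      then obtain Y where Y: "\<And>c. c \<in> Ct \<Longrightarrow> Y c \<subseteq> A c \<and> card (Y c) = n"
        using subgrid_of_card[of Ct n A] by metis
      have "a t \<le> x0 + u \<and> x0 + u + u \<le> b t \<and> k * (b t - a t) \<le> u" if "t \<in> PiE Ct Y" for t
      proof -
        have t: "t \<in> PiE Ct A" using that sub[of Y A] Y by blast
        have "2 * u \<le> b t - a t" using hol[OF t] True by (auto simp: h_def split: if_splits)
        moreover have "k * (b t - a t) \<le> k * l"
          using Gl[of t] t AG K by (intro mult_left_mono) (auto simp: k_def)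
        moreover have "k * l = u" by (simp add: k_def u_def)
        ultimately show ?thesis using Ab[OF t] by auto
      qed
      then have "\<forall>t\<in>PiE Ct Y. a t \<le> x0 + u \<and> x0 + u + u \<le> b t \<and> k * (b t - a t) \<le> u"
        by blast
      moreover have "\<forall>c\<in>Ct. Y c \<subseteq> X c \<and> card (Y c) = n" using Y finA by blast
      ultimately show ?thesis
        unfolding aligned_subgrid_def
        by (intro exI[of _ Y] exI[of _ "x0 + u"] exI[of _ u] conjI disjI1 u(1))
    next
      case False
      show ?thesis
      proof (rule ccontr)
        assume no: "\<not> aligned_subgrid Ct n k X a b"
        have AW: "x0 \<le> a t \<and> b t \<le> x0 + 3 * u" if t: "t \<in> PiE Ct A" for t
        proof -
          have "b t - a t < 2 * u" using hol[OF t] False by (auto simp: h_def split: if_splits)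
          then show ?thesis using Ab[OF t] by auto
        qed
        have "\<exists>Z x. (\<forall>c\<in>Ct. Z c \<subseteq> (if c \<in> Ct then B c else A c) \<and> card (Z c) = F (card Ct - card Ct)) \<and>
          (\<forall>s\<in>PiE Ct Z. x \<le> a s \<and> b s \<le> x + 7 ^ card Ct * (3 * u)) \<and> x0 - 7 ^ card Ct * (3 * u) \<le> x \<and> x \<le> x0"
        proof (rule hybrid_chain[OF \<open>finite Ct\<close> _ Fmono F, where X = X and k = k])
          show "finite (A c) \<and> card (A c) = F (card Ct) \<and> A c \<subseteq> X c" if "c \<in> Ct" for c
            using finA[OF that] A[OF that] by (simp add: m_def)
          show "finite (B c) \<and> F (card Ct) \<le> card (B c) \<and> B c \<subseteq> X c" if "c \<in> Ct" for c
            using B[OF that] X[OF that] by (auto simp: s_def m_def intro: finite_subset)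
        qed (use AW no u F0 \<open>n \<ge> 1\<close> in auto)
        then obtain Z x where Z': "\<forall>c\<in>Ct. Z c \<subseteq> (if c \<in> Ct then B c else A c) \<and> card (Z c) = F (card Ct - card Ct)"
          and ZW: "\<forall>s\<in>PiE Ct Z. x \<le> a s \<and> b s \<le> x + 7 ^ card Ct * (3 * u)"
          and x: "x0 - 7 ^ card Ct * (3 * u) \<le> x" "x \<le> x0"
          by (elim exE conjE) (rule that; assumption)
        have K7: "7 ^ card Ct * (3 * u) = l / 8"
          using u(2) by (simp add: K_def m_def)
        have Z: "Z c \<subseteq> B c" "Z c \<noteq> {}" if "c \<in> Ct" for c
          using bspec[OF Z' that] that F0 \<open>n \<ge> 1\<close> by auto
        then have "PiE Ct Z \<noteq> {}" by (simp add: PiE_eq_empty_iff)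
        then obtain t where t: "t \<in> PiE Ct Z" by blast
        have tB: "t \<in> PiE Ct B" using t sub[of Z B] Z by blast
        have "A c \<noteq> {}" if "c \<in> Ct" for c using A[OF that] \<open>F m \<ge> 1\<close> by auto
        then have "PiE Ct A \<noteq> {}" by (simp add: PiE_eq_empty_iff)
        then obtain t' where t': "t' \<in> PiE Ct A" by blast
        have "t' \<in> PiE Ct X" "t' \<in> PiE Ct G" using t' AG sub[of G X] G by blast+
        with ab[of t'] Gl[of t'] Ab[OF t'] have "x0 \<le> y + l" by linarith
        moreover have "y \<le> x0" using u(1) by (simp add: x0_def)
        moreover have "x \<le> a t" "b t \<le> x + l / 8" using ZW t K7 by auto
        ultimately show False using Bfar[OF tB] x l unfolding K7 by auto
      qed
    qed
  qed
qed

section \<open>Colourful selection of sets with large intersection\<close>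

lemma common_slices:
  fixes b :: "'a::euclidean_space"
  assumes "finite Ct" "Ct \<noteq> {}" "n \<ge> 1"
  shows "\<exists>N k. k > 0 \<and> (\<forall>X (C :: 'c \<Rightarrow> 'i \<Rightarrow> 'a set) V.
    (\<forall>c\<in>Ct. finite (X c) \<and> card (X c) \<ge> N) \<and> (\<forall>c\<in>Ct. \<forall>i\<in>X c. convex (C c i)) \<and> V > 0 \<and>
    (\<forall>s\<in>PiE Ct X. big (b # bs) V (\<Inter>c\<in>Ct. C c (s c))) \<longrightarrow>
    (\<exists>c\<in>Ct. \<exists>Y x l. l > 0 \<and> (\<forall>c\<in>Ct. Y c \<subseteq> X c \<and> card (Y c) = n) \<and>
      (\<forall>t\<in>PiE (Ct - {c}) Y. \<forall>u\<in>{x..x + l}.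
        big bs (k * V / l) ((\<Inter>c\<in>Ct - {c}. C c (t c)) \<inter> {x. x \<bullet> b = u}))))"
proof -
  from aligned_subgrid_exists[OF assms(1,3), where ?'b = 'i] obtain N k where k: "k > 0"
    and al: "\<forall>X (a :: ('c \<Rightarrow> 'i) \<Rightarrow> real) b.
    (\<forall>c\<in>Ct. finite (X c) \<and> card (X c) \<ge> N) \<and> (\<forall>s\<in>PiE Ct X. a s < b s) \<longrightarrow>
    aligned_subgrid Ct n k X a b" by (elim exE conjE) (rule that; assumption)
  define k' where "k' = min k (1 / 2 ^ length bs)"
  have k': "k' > 0" "k' \<le> k" "k' \<le> 1 / 2 ^ length bs" using k by (auto simp: k'_def)
  show ?thesis
  proof (intro exI[of _ N] exI[of _ k'] conjI allI impI)
    show "k' > 0" by (rule k')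
    fix X and C :: "'c \<Rightarrow> 'i \<Rightarrow> 'a set" and V :: real
    assume *: "(\<forall>c\<in>Ct. finite (X c) \<and> card (X c) \<ge> N) \<and> (\<forall>c\<in>Ct. \<forall>i\<in>X c. convex (C c i)) \<and> V > 0 \<and>
      (\<forall>s\<in>PiE Ct X. big (b # bs) V (\<Inter>c\<in>Ct. C c (s c)))"
    then have V: "V > 0" and conv: "\<And>c i. c \<in> Ct \<Longrightarrow> i \<in> X c \<Longrightarrow> convex (C c i)" by blast+
    have "\<forall>s\<in>PiE Ct X. \<exists>al. snd al > 0 \<and>
      (\<forall>u\<in>{fst al..fst al + snd al}. big bs (V / snd al) ((\<Inter>c\<in>Ct. C c (s c)) \<inter> {x. x \<bullet> b = u}))"
      using * by auto
    from bchoice[OF this] obtain al where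
      al0: "\<And>s. s \<in> PiE Ct X \<Longrightarrow> snd (al s) > 0"
      and al1: "\<And>s u. s \<in> PiE Ct X \<Longrightarrow> u \<in> {fst (al s)..fst (al s) + snd (al s)} \<Longrightarrow>
        big bs (V / snd (al s)) ((\<Inter>c\<in>Ct. C c (s c)) \<inter> {x. x \<bullet> b = u})"
      by blast
    define lo hi where "lo s = fst (al s)" and "hi s = fst (al s) + snd (al s)" for s
    have lohi: "lo s < hi s" if "s \<in> PiE Ct X" for s using al0[OF that] by (simp add: lo_def hi_def)
    have bigT: "big bs (V / (hi s - lo s)) ((\<Inter>c\<in>Ct. C c (s c)) \<inter> {x. x \<bullet> b = u})"
      if "s \<in> PiE Ct X" "lo s \<le> u" "u \<le> hi s" for s u
      using al1[OF that(1), of u] that by (simp add: lo_def hi_def)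
    have "\<forall>s\<in>PiE Ct X. lo s < hi s" using lohi by (rule ballI)
    with conjunct1[OF *] have "aligned_subgrid Ct n k X lo hi"
      by (intro al[THEN spec, THEN spec, THEN spec, THEN mp] conjI)
    then obtain Y x l where l: "l > 0" and Y: "\<forall>c\<in>Ct. Y c \<subseteq> X c \<and> card (Y c) = n"
      and cases: "(\<forall>s\<in>PiE Ct Y. lo s \<le> x \<and> x + l \<le> hi s \<and> k * (hi s - lo s) \<le> l) \<or>
       (\<exists>c\<in>Ct. \<forall>t\<in>PiE (Ct - {c}) Y. \<exists>i\<in>X c. \<exists>j\<in>X c.
          x \<le> lo (t(c := i)) \<and> hi (t(c := i)) \<le> x + l \<and> x + 4 * l \<le> hi (t(c := j))) \<or>
       (\<exists>c\<in>Ct. \<forall>t\<in>PiE (Ct - {c}) Y. \<exists>i\<in>X c. \<exists>j\<in>X c.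
          x \<le> lo (t(c := i)) \<and> hi (t(c := i)) \<le> x + l \<and> lo (t(c := j)) \<le> x - 3 * l)"
      unfolding aligned_subgrid_def by (elim exE conjE) (rule that; assumption)
    have ins: "t(c := i) \<in> PiE Ct X" if "t \<in> PiE (Ct - {c}) Y" "c \<in> Ct" "i \<in> X c" for t c i
    proof -
      have "t \<in> PiE (Ct - {c}) X"
        using that(1) by (rule subsetD[OF PiE_mono, rotated]) (use Y in auto)
      then have "t(c := i) \<in> PiE (insert c (Ct - {c})) X"
        by (intro PiE_fun_upd that)
      then show ?thesis using that(2) by (simp add: insert_absorb)
    qed
    have sub: "(\<Inter>d\<in>Ct. C d ((t(c := i)) d)) \<subseteq> (\<Inter>d\<in>Ct - {c}. C d (t d))" for t c i
    proof -
      have eq: "(\<Inter>d\<in>Ct - {c}. C d ((t(c := i)) d)) = (\<Inter>d\<in>Ct - {c}. C d (t d))"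
        by (rule INF_cong) auto
      show ?thesis
        unfolding eq[symmetric] by (rule INF_superset_mono) auto
    qed
    have convI: "convex (\<Inter>d\<in>Ct - {c}. C d (t d))" if "t \<in> PiE (Ct - {c}) Y" for t c
      using that Y PiE_mem[OF that] by (intro convex_INT conv) auto
    have le: "k' * V / l \<le> V / (hi s - lo s) / 2 ^ length bs"
      if "s \<in> PiE Ct X" "x \<le> lo s" "hi s \<le> x + l" for s
    proof -
      have "k' * V / l \<le> (1 / 2 ^ length bs) * V / l"
        using k' V l by (intro divide_right_mono mult_right_mono) auto
      also have "\<dots> = V / l / 2 ^ length bs" by simp
      also have "\<dots> \<le> V / (hi s - lo s) / 2 ^ length bs"
        using V lohi[OF that(1)] that by (intro divide_right_mono divide_left_mono) auto
      finally show ?thesis .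
    qed
    from cases show "\<exists>c\<in>Ct. \<exists>Y x l. l > 0 \<and> (\<forall>c\<in>Ct. Y c \<subseteq> X c \<and> card (Y c) = n) \<and>
      (\<forall>t\<in>PiE (Ct - {c}) Y. \<forall>u\<in>{x..x + l}.
        big bs (k' * V / l) ((\<Inter>c\<in>Ct - {c}. C c (t c)) \<inter> {x. x \<bullet> b = u}))"
    proof (elim disjE bexE)
      assume 1: "\<forall>s\<in>PiE Ct Y. lo s \<le> x \<and> x + l \<le> hi s \<and> k * (hi s - lo s) \<le> l"
      obtain c where c: "c \<in> Ct" using \<open>Ct \<noteq> {}\<close> by auto
      have "big bs (k' * V / l) ((\<Inter>c\<in>Ct - {c}. C c (t c)) \<inter> {x. x \<bullet> b = u})"
        if t: "t \<in> PiE (Ct - {c}) Y" and u: "u \<in> {x..x + l}" for t u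
      proof -
        obtain i where i: "i \<in> Y c" using Y c \<open>n \<ge> 1\<close> by fastforce
        have "t(c := i) \<in> PiE (insert c (Ct - {c})) Y"
          by (intro PiE_fun_upd t i)
        then have tY: "t(c := i) \<in> PiE Ct Y" using c by (simp add: insert_absorb)
        have tX: "t(c := i) \<in> PiE Ct X" using ins[OF t c] i Y c by blast
        note 11 = bspec[OF 1 tY]
        have "k' * (hi (t(c := i)) - lo (t(c := i))) \<le> l"
          using 11 k' lohi[OF tX] by (meson diff_ge_0_iff_ge less_imp_le mult_right_mono order_trans)
        then have "V * (k' * (hi (t(c := i)) - lo (t(c := i)))) \<le> V * l"
          using V by (intro mult_left_mono) auto
        moreover have "hi (t(c := i)) - lo (t(c := i)) > 0" using lohi[OF tX] by simp
        ultimately have "k' * V / l \<le> V / (hi (t(c := i)) - lo (t(c := i)))"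
          using l by (simp only: pos_divide_le_eq pos_le_divide_eq times_divide_eq_left mult.assoc mult.left_commute[of k'])
        moreover have "big bs (V / (hi (t(c := i)) - lo (t(c := i)))) ((\<Inter>d\<in>Ct. C d ((t(c := i)) d)) \<inter> {x. x \<bullet> b = u})"
          using 11 u by (intro bigT tX) auto
        ultimately show ?thesis
          by - (rule big_mono[OF _ Int_mono[OF sub order_refl]], assumption+)
      qed
      then show ?thesis
        by (intro bexI[OF _ c] exI[of _ Y] exI[of _ "x"] exI[of _ l] conjI l Y ballI)
    next
      fix c assume c: "c \<in> Ct"
      assume 2: "\<forall>t\<in>PiE (Ct - {c}) Y. \<exists>i\<in>X c. \<exists>j\<in>X c.
          x \<le> lo (t(c := i)) \<and> hi (t(c := i)) \<le> x + l \<and> x + 4 * l \<le> hi (t(c := j))"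
      \<comment> \<open>To the right of the window each level is at least
        \<open>hi (t(c := i))\<close>, and twice the level is at most \<open>2 * x + 4 * l\<close>;
        this is where the 4 in the second alternative comes from.\<close>
      have "big bs (k' * V / l) ((\<Inter>c\<in>Ct - {c}. C c (t c)) \<inter> {x. x \<bullet> b = u})"
        if t: "t \<in> PiE (Ct - {c}) Y" and u: "u \<in> {x + l..x + l + l}" for t u
      proof -
        from bspec[OF 2 t] obtain i j where ij: "i \<in> X c" "j \<in> X c"
          and 22: "x \<le> lo (t(c := i))" "hi (t(c := i)) \<le> x + l" "x + 4 * l \<le> hi (t(c := j))" by blast
        note ti = ins[OF t c ij(1)] and tj = ins[OF t c ij(2)]
        let ?K = "\<Inter>c\<in>Ct - {c}. C c (t c)"
        have "big bs (V / (hi (t(c := i)) - lo (t(c := i)))) (?K \<inter> {x. x \<bullet> b = lo (t(c := i))})"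
          by (rule big_mono[OF bigT[OF ti] Int_mono[OF sub order_refl] order_refl]) (use lohi[OF ti] in auto)
        moreover obtain y where "y \<in> ?K" "y \<bullet> b = hi (t(c := j))"
        proof -
          have "(\<Inter>d\<in>Ct. C d ((t(c := j)) d)) \<inter> {x. x \<bullet> b = hi (t(c := j))} \<noteq> {}"
            by (rule big_nonempty[OF bigT[OF tj]]) (use lohi[OF tj] in auto)
          then show thesis using sub[of t c j] that by blast
        qed
        ultimately have "big bs (V / (hi (t(c := i)) - lo (t(c := i))) / 2 ^ length bs) (?K \<inter> {x. x \<bullet> b = u})"
          using u 22 lohi[OF ti] V by (intro big_slice_midpoint_right[OF convI[OF t], where y = y]) auto
        with le[OF ti 22(1,2)] show ?thesis by (elim big_mono) auto
      qed
      then show ?thesis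
        by (intro bexI[OF _ c] exI[of _ Y] exI[of _ "x + l"] exI[of _ l] conjI l Y ballI)
    next
      fix c assume c: "c \<in> Ct"
      assume 2: "\<forall>t\<in>PiE (Ct - {c}) Y. \<exists>i\<in>X c. \<exists>j\<in>X c.
          x \<le> lo (t(c := i)) \<and> hi (t(c := i)) \<le> x + l \<and> lo (t(c := j)) \<le> x - 3 * l"
      \<comment> \<open>The big slice at \<open>lo (t(c := i))\<close> may be almost as high as
        \<open>x + l\<close>; together with a point at level at most \<open>x - 3 * l\<close> it
        controls the levels from \<open>x - l\<close> on.\<close>
      have "big bs (k' * V / l) ((\<Inter>c\<in>Ct - {c}. C c (t c)) \<inter> {x. x \<bullet> b = u})"
        if t: "t \<in> PiE (Ct - {c}) Y" and u: "u \<in> {x - l..x - l + l}" for t u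
      proof -
        from bspec[OF 2 t] obtain i j where ij: "i \<in> X c" "j \<in> X c"
          and 22: "x \<le> lo (t(c := i))" "hi (t(c := i)) \<le> x + l" "lo (t(c := j)) \<le> x - 3 * l" by blast
        note ti = ins[OF t c ij(1)] and tj = ins[OF t c ij(2)]
        let ?K = "\<Inter>c\<in>Ct - {c}. C c (t c)"
        have "big bs (V / (hi (t(c := i)) - lo (t(c := i)))) (?K \<inter> {x. x \<bullet> b = lo (t(c := i))})"
          by (rule big_mono[OF bigT[OF ti] Int_mono[OF sub order_refl] order_refl]) (use lohi[OF ti] in auto)
        moreover obtain y where "y \<in> ?K" "y \<bullet> b = lo (t(c := j))"
        proof -
          have "(\<Inter>d\<in>Ct. C d ((t(c := j)) d)) \<inter> {x. x \<bullet> b = lo (t(c := j))} \<noteq> {}"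
            by (rule big_nonempty[OF bigT[OF tj]]) (use lohi[OF tj] in auto)
          then show thesis using sub[of t c j] that by blast
        qed
        ultimately have "big bs (V / (hi (t(c := i)) - lo (t(c := i))) / 2 ^ length bs) (?K \<inter> {x. x \<bullet> b = u})"
          using u 22 lohi[OF ti] V by (intro big_slice_midpoint_left[OF convI[OF t], where y = y]) auto
        with le[OF ti 22(1,2)] show ?thesis by (elim big_mono) auto
      qed
      then show ?thesis
        by (intro bexI[OF _ c] exI[of _ Y] exI[of _ "x - l"] exI[of _ l] conjI l Y ballI)
    qed
  qed
qed

theorem colorful_big_selection:
  fixes bs :: "'a::euclidean_space list"
  assumes "distinct bs" "set bs \<subseteq> Basis" "finite Ct" "card Ct = length bs + 1" "k \<ge> 1"
  shows "\<exists>N e. e > 0 \<and> (\<forall>X (C :: 'c \<Rightarrow> 'i \<Rightarrow> 'a set) V w.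
    (\<forall>c\<in>Ct. finite (X c) \<and> card (X c) \<ge> N) \<and>
    (\<forall>c\<in>Ct. \<forall>i\<in>X c. convex (C c i) \<and> (\<forall>x\<in>C c i. \<forall>b\<in>Basis - set bs. x \<bullet> b = w \<bullet> b)) \<and>
    V > 0 \<and> (\<forall>s\<in>PiE Ct X. big bs V (\<Inter>c\<in>Ct. C c (s c))) \<longrightarrow>
    (\<exists>c\<in>Ct. \<exists>Z\<subseteq>X c. card Z = k \<and> big bs (e * V) (\<Inter>i\<in>Z. C c i)))"
  using assms(1-4)
proof (induction bs arbitrary: Ct)
  case Nil
  then obtain c where Ct: "Ct = {c}" by (metis add_0 card_1_singletonE list.size(3))
  show ?case
  proof (intro exI[of _ k] exI[of _ 1] conjI allI impI)
    fix X and C :: "'c \<Rightarrow> 'i \<Rightarrow> 'a set" and V :: real and w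
    assume *: "(\<forall>c\<in>Ct. finite (X c) \<and> card (X c) \<ge> k) \<and>
      (\<forall>c\<in>Ct. \<forall>i\<in>X c. convex (C c i) \<and> (\<forall>x\<in>C c i. \<forall>b\<in>Basis - set []. x \<bullet> b = w \<bullet> b)) \<and>
      V > 0 \<and> (\<forall>s\<in>PiE Ct X. big [] V (\<Inter>c\<in>Ct. C c (s c)))"
    then have "k \<le> card (X c)" by (simp add: Ct)
    then obtain Z where Z: "Z \<subseteq> X c" "card Z = k" by (meson obtain_subset_with_card_n)
    have one: "w \<in> C c i \<and> V \<le> 1" if "i \<in> X c" for i
    proof -
      have "(\<lambda>x. undefined)(c := i) \<in> PiE (insert c {}) X"
        by (intro PiE_fun_upd that) simp
      with * have "big [] V (\<Inter>d\<in>Ct. C d (((\<lambda>x. undefined)(c := i)) d))"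
        unfolding Ct by blast
      then obtain x where "x \<in> C c i" "V \<le> 1" by (auto simp: Ct)
      moreover have "x = w"
      proof (rule euclidean_eqI)
        fix b :: 'a assume "b \<in> Basis"
        then show "x \<bullet> b = w \<bullet> b"
          using conjunct1[OF conjunct2[OF *]] that \<open>x \<in> C c i\<close> unfolding Ct by simp
      qed
      ultimately show ?thesis by simp
    qed
    have "Z \<noteq> {}" using Z \<open>k \<ge> 1\<close> by auto
    with one Z have "V \<le> 1" "w \<in> (\<Inter>i\<in>Z. C c i)" by blast+
    then have "big [] (1 * V) (\<Inter>i\<in>Z. C c i)" by auto
    with Z show "\<exists>c\<in>Ct. \<exists>Z\<subseteq>X c. card Z = k \<and> big [] (1 * V) (\<Inter>i\<in>Z. C c i)"
      by (intro bexI[of _ c] exI[of _ Z] conjI) (auto simp: Ct)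
  qed simp
next
  case (Cons b bs)
  \<comment> \<open>Which class will be dropped is unknown, so the induction hypothesis is prepared
    for every \<open>c\<close>; the sum in \<open>n\<close> and the minimum in \<open>e\<close>
    serve all of them.\<close>
  define Q where "Q c N e \<longleftrightarrow> e > 0 \<and> (\<forall>X (C :: 'c \<Rightarrow> 'i \<Rightarrow> 'a set) V w.
    (\<forall>c\<in>Ct - {c}. finite (X c) \<and> card (X c) \<ge> N) \<and>
    (\<forall>c\<in>Ct - {c}. \<forall>i\<in>X c. convex (C c i) \<and> (\<forall>x\<in>C c i. \<forall>b\<in>Basis - set bs. x \<bullet> b = w \<bullet> b)) \<and>
    V > 0 \<and> (\<forall>s\<in>PiE (Ct - {c}) X. big bs V (\<Inter>c\<in>Ct - {c}. C c (s c))) \<longrightarrow>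
    (\<exists>c\<in>Ct - {c}. \<exists>Z\<subseteq>X c. card Z = k \<and> big bs (e * V) (\<Inter>i\<in>Z. C c i)))" for c N e
  have "\<forall>c\<in>Ct. \<exists>p. Q c (fst p) (snd p)"
  proof
    fix c assume "c \<in> Ct"
    then have "card (Ct - {c}) = length bs + 1" using Cons.prems by simp
    then have "\<exists>N e. Q c N e"
      unfolding Q_def using Cons.prems by (intro Cons.IH) auto
    then show "\<exists>p. Q c (fst p) (snd p)" by auto
  qed
  from bchoice[OF this] obtain p where p: "\<And>c. c \<in> Ct \<Longrightarrow> Q c (fst (p c)) (snd (p c))" by blast
  define n where "n = 1 + (\<Sum>c\<in>Ct. fst (p c))"
  have "n \<ge> 1" by (simp add: n_def)
  have n: "fst (p c) \<le> n" if "c \<in> Ct" for c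
    using member_le_sum[of c Ct "\<lambda>c. fst (p c)"] that \<open>finite Ct\<close> by (simp add: n_def)
  define e where "e = Min ((\<lambda>c. snd (p c)) ` Ct)"
  have "Ct \<noteq> {}" using Cons.prems by auto
  have e: "e > 0" "\<And>c. c \<in> Ct \<Longrightarrow> e \<le> snd (p c)"
    using \<open>finite Ct\<close> \<open>Ct \<noteq> {}\<close> p by (auto simp: e_def Q_def)
  obtain N k' where k': "k' > 0" and cs: "\<forall>X (C :: 'c \<Rightarrow> 'i \<Rightarrow> 'a set) V.
    (\<forall>c\<in>Ct. finite (X c) \<and> card (X c) \<ge> N) \<and> (\<forall>c\<in>Ct. \<forall>i\<in>X c. convex (C c i)) \<and> V > 0 \<and>
    (\<forall>s\<in>PiE Ct X. big (b # bs) V (\<Inter>c\<in>Ct. C c (s c))) \<longrightarrow>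
    (\<exists>c\<in>Ct. \<exists>Y x l. l > 0 \<and> (\<forall>c\<in>Ct. Y c \<subseteq> X c \<and> card (Y c) = n) \<and>
      (\<forall>t\<in>PiE (Ct - {c}) Y. \<forall>u\<in>{x..x + l}.
        big bs (k' * V / l) ((\<Inter>c\<in>Ct - {c}. C c (t c)) \<inter> {x. x \<bullet> b = u})))"
    using common_slices[OF \<open>finite Ct\<close> \<open>Ct \<noteq> {}\<close> \<open>n \<ge> 1\<close>, where bs = bs and b = b and ?'i = 'i]
    by (elim exE conjE) (rule that; assumption)
  define M where "M = card Ct * 2 ^ n"
  have M: "M > 0" using \<open>finite Ct\<close> \<open>Ct \<noteq> {}\<close> by (auto simp: M_def card_gt_0_iff)
  \<comment> \<open>Distinct levels \<open>u i\<close> and \<open>u j\<close> are at least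
    \<open>l / real M\<close> apart, and the midpoint bound controls the nearer half of the gap;
    this is the origin of \<open>2 * real M\<close> and of \<open>l'\<close>.\<close>
  define e' where "e' = e * k' / (2 * real M * 2 ^ length bs)"
  show ?case
  proof (intro exI[of _ N] exI[of _ e'] conjI allI impI)
    show "e' > 0" using e k' M by (simp add: e'_def)
    fix X and C :: "'c \<Rightarrow> 'i \<Rightarrow> 'a set" and V :: real and w
    assume *: "(\<forall>c\<in>Ct. finite (X c) \<and> card (X c) \<ge> N) \<and>
      (\<forall>c\<in>Ct. \<forall>i\<in>X c. convex (C c i) \<and> (\<forall>x\<in>C c i. \<forall>b'\<in>Basis - set (b # bs). x \<bullet> b' = w \<bullet> b')) \<and>
      V > 0 \<and> (\<forall>s\<in>PiE Ct X. big (b # bs) V (\<Inter>c\<in>Ct. C c (s c)))"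
    then have fX: "\<And>c. c \<in> Ct \<Longrightarrow> finite (X c)" and V: "V > 0"
      and conv: "\<And>c i. c \<in> Ct \<Longrightarrow> i \<in> X c \<Longrightarrow> convex (C c i)"
      and flat: "\<And>c i x b'. c \<in> Ct \<Longrightarrow> i \<in> X c \<Longrightarrow> x \<in> C c i \<Longrightarrow> b' \<in> Basis - set (b # bs) \<Longrightarrow> x \<bullet> b' = w \<bullet> b'"
      by blast+
    have "\<exists>c\<in>Ct. \<exists>Y x l. l > 0 \<and> (\<forall>c\<in>Ct. Y c \<subseteq> X c \<and> card (Y c) = n) \<and>
      (\<forall>t\<in>PiE (Ct - {c}) Y. \<forall>u\<in>{x..x + l}.
        big bs (k' * V / l) ((\<Inter>c\<in>Ct - {c}. C c (t c)) \<inter> {x. x \<bullet> b = u}))"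
      by (rule cs[THEN spec, THEN spec, THEN spec, THEN mp]) (use * in \<open>intro conjI; simp\<close>)
    then obtain c Y x l where c: "c \<in> Ct" and l: "l > 0"
      and Y': "\<forall>c\<in>Ct. Y c \<subseteq> X c \<and> card (Y c) = n"
      and sl: "\<forall>t\<in>PiE (Ct - {c}) Y. \<forall>u\<in>{x..x + l}.
        big bs (k' * V / l) ((\<Inter>c\<in>Ct - {c}. C c (t c)) \<inter> {x. x \<bullet> b = u})"
      by (elim exE conjE bexE) (rule that; assumption)
    note Y = bspec[OF Y']
    define H where "H u = {x. x \<bullet> b = u}" for u :: real
    have bB: "b \<in> Basis" using Cons.prems by auto
    have level: "\<exists>q. fst q \<in> Ct - {c} \<and> snd q \<subseteq> Y (fst q) \<and> card (snd q) = k \<and>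
        big bs (e * (k' * V / l)) ((\<Inter>i\<in>snd q. C (fst q) i) \<inter> H u)" if u: "u \<in> {x..x + l}" for u
    proof -
      have ne: "Ct - {c} \<noteq> {}"
      proof
        assume "Ct - {c} = {}"
        then have "card (Ct - {c}) = 0" by (metis card.empty)
        then show False using Cons.prems c by simp
      qed
      have flat': "y \<bullet> b' = (w + (u - w \<bullet> b) *\<^sub>R b) \<bullet> b'"
        if "d \<in> Ct - {c}" "i \<in> Y d" "y \<in> C d i \<inter> H u" "b' \<in> Basis - set bs" for d i y b'
      proof (cases "b' = b")
        case True
        then show ?thesis using that bB by (simp add: H_def inner_add_left)
      next
        case False
        then have "y \<bullet> b' = w \<bullet> b'" using that Y[of d] by (intro flat) auto
        then show ?thesis using False bB that by (simp add: inner_add_left inner_not_same_Basis)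
      qed
      have "\<exists>d\<in>Ct - {c}. \<exists>Z\<subseteq>Y d. card Z = k \<and>
        big bs (snd (p c) * (k' * V / l)) (\<Inter>i\<in>Z. C d i \<inter> H u)"
      proof (rule conjunct2[OF p[OF c, unfolded Q_def], THEN spec, THEN spec, THEN spec, THEN spec, THEN mp], intro conjI ballI)
        show "finite (Y d)" "fst (p c) \<le> card (Y d)" if "d \<in> Ct - {c}" for d
          using that Y[of d] fX[of d] n[OF c] by (auto intro: finite_subset)
        show "convex (C d i \<inter> H u)" if "d \<in> Ct - {c}" "i \<in> Y d" for d i
          using that Y[of d] unfolding H_def
          by (intro convex_Int conv convex_hyperplane[of b, unfolded inner_commute[of b]]) auto
        show "0 < k' * V / l" using k' V l by simp
        show "big bs (k' * V / l) (\<Inter>d\<in>Ct - {c}. C d (t d) \<inter> H u)" if t: "t \<in> PiE (Ct - {c}) Y" for t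
        proof -
          have "(\<Inter>d\<in>Ct - {c}. C d (t d) \<inter> H u) = (\<Inter>d\<in>Ct - {c}. C d (t d)) \<inter> H u"
            using ne by (simp add: INF_inf_const2)
          then show ?thesis using sl t u by (simp add: H_def)
        qed
      qed (use flat' in blast)
      then obtain d Z where dZ: "d \<in> Ct - {c}" "Z \<subseteq> Y d" "card Z = k"
        and bg: "big bs (snd (p c) * (k' * V / l)) (\<Inter>i\<in>Z. C d i \<inter> H u)" by blast
      have "Z \<noteq> {}" using dZ \<open>k \<ge> 1\<close> by auto
      then have eq: "(\<Inter>i\<in>Z. C d i \<inter> H u) = (\<Inter>i\<in>Z. C d i) \<inter> H u"
        by (simp add: INF_inf_const2)
      have "e * (k' * V / l) \<le> snd (p c) * (k' * V / l)"
        using e(2)[OF c] k' V l by (intro mult_right_mono) auto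
      with bg have "big bs (e * (k' * V / l)) ((\<Inter>i\<in>Z. C d i) \<inter> H u)"
        unfolding eq by (elim big_mono) auto
      with dZ show ?thesis by (intro exI[of _ "(d, Z)"]) simp
    qed
    \<comment> \<open>There are more levels \<open>u j\<close> than pairs (class, subset), so one pair serves two levels, and
      by convexity everything in between.\<close>
    define u where "u j = x + l * real j / real M" for j :: nat
    have u: "u j \<in> {x..x + l}" if "j \<in> {0..M}" for j
      using that M l by (auto simp: u_def field_simps)
    have "\<forall>j\<in>{0..M}. \<exists>q. fst q \<in> Ct - {c} \<and> snd q \<subseteq> Y (fst q) \<and> card (snd q) = k \<and>
        big bs (e * (k' * V / l)) ((\<Inter>i\<in>snd q. C (fst q) i) \<inter> H (u j))"
      using level u by blast
    from bchoice[OF this] obtain q where q: "\<And>j. j \<in> {0..M} \<Longrightarrow> fst (q j) \<in> Ct - {c} \<and> snd (q j) \<subseteq> Y (fst (q j)) \<and>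
        card (snd (q j)) = k \<and> big bs (e * (k' * V / l)) ((\<Inter>i\<in>snd (q j). C (fst (q j)) i) \<inter> H (u j))"
      by blast
    define O' where "O' = Sigma (Ct - {c}) (\<lambda>d. Pow (Y d))"
    have finY: "finite (Y d)" if "d \<in> Ct" for d
      using Y[OF that] fX[OF that] by (auto intro: finite_subset)
    have "card O' = (\<Sum>d\<in>Ct - {c}. 2 ^ n)"
      unfolding O'_def using \<open>finite Ct\<close> finY Y by (subst card_SigmaI) (auto simp: card_Pow)
    also have "\<dots> \<le> M" unfolding M_def by (simp add: card_Diff1_le \<open>finite Ct\<close>)
    finally have cO: "card O' \<le> M" .
    have "finite O'" unfolding O'_def using \<open>finite Ct\<close> finY by auto
    moreover have "q ` {0..M} \<subseteq> O'"
    proof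
      fix z assume "z \<in> q ` {0..M}"
      then obtain j where "j \<in> {0..M}" "z = q j" by blast
      with q[of j] have "(fst z, snd z) \<in> O'" unfolding O'_def by blast
      then show "z \<in> O'" by simp
    qed
    ultimately have "card (q ` {0..M}) \<le> card O'" by (intro card_mono)
    with cO have "card (q ` {0..M}) \<noteq> card {0..M}" by simp
    then have "\<not> inj_on q {0..M}" using card_image by blast
    then obtain i j where ij: "i \<in> {0..M}" "j \<in> {0..M}" "i < j" "q i = q j"
      unfolding inj_on_def by (metis linorder_neqE_nat)
    obtain d Z where dZ: "q j = (d, Z)" by fastforce
    define S where "S = (\<Inter>i\<in>Z. C d i)"
    have dp: "d \<in> Ct" "Z \<subseteq> X d" "card Z = k" using q[OF ij(2)] dZ Y[of d] by auto
    have bi: "big bs (e * (k' * V / l)) (S \<inter> {x. x \<bullet> b = u i})"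
      using q[OF ij(1)] unfolding ij(4) dZ by (simp add: S_def H_def)
    have "big bs (e * (k' * V / l)) (S \<inter> {x. x \<bullet> b = u j})"
      using q[OF ij(2)] unfolding dZ by (simp add: S_def H_def)
    from big_nonempty[OF this] obtain y where y: "y \<in> S" "y \<bullet> b = u j" by auto
    have convS: "convex S" unfolding S_def using dp by (intro convex_INT conv) auto
    define l' where "l' = l / (2 * real M)"
    have l': "l' > 0" using l M by (simp add: l'_def)
    have "real i + 1 \<le> real j" using ij by simp
    then have "l * (real i + 1) / real M \<le> l * real j / real M"
      using l M by (intro divide_right_mono mult_left_mono) auto
    then have uij: "u i + 2 * l' \<le> u j"
      by (simp add: u_def l'_def field_simps add_divide_distrib)
    have "big bs (e' * V / l') (S \<inter> {x. x \<bullet> b = t})" if t: "t \<in> {u i..u i + l'}" for t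
    proof -
      have "big bs (e * (k' * V / l) / 2 ^ length bs) (S \<inter> {x. x \<bullet> b = t})"
        using t uij y e k' V l by (intro big_slice_midpoint_right[OF convS bi y(1)]) auto
      moreover have "e' * V / l' = e * (k' * V / l) / 2 ^ length bs"
        using M l by (simp add: e'_def l'_def field_simps)
      ultimately show ?thesis by simp
    qed
    then have "big (b # bs) (e' * V) S"
      unfolding big.simps using l' by blast
    then show "\<exists>c\<in>Ct. \<exists>Z\<subseteq>X c. card Z = k \<and> big (b # bs) (e' * V) (\<Inter>i\<in>Z. C c i)"
      unfolding S_def using dp by blast
  qed
qed

section \<open>Triangular simplices\<close>

lemma flat_part_full: "set bs = Basis \<Longrightarrow> flat_part bs z C = C"
  by (auto simp: flat_part_def)

lemma emeasure_ge_of_big: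
  fixes C :: "'a::euclidean_space set"
  assumes "C \<in> sets borel" "distinct bs" "set bs = Basis" "big bs V C"
  shows "ennreal V \<le> emeasure lborel C"
  using iterated_measure_big_ge[of C bs 0 V] emeasure_lborel_iterated[of C bs] assms
  by (simp add: flat_part_full)

text \<open>A convex set may be unbounded and may fail to be Borel. Its frontier is negligible, so
  the interior carries the volume, and intersecting with a large ball keeps volume above 1/2; the
  result is bounded and open.\<close>

lemma big_of_emeasure_ge:
  fixes bs :: "'a::euclidean_space list"
  assumes "distinct bs" "set bs = Basis"
  shows "\<exists>c>0. \<forall>C. convex C \<and> emeasure lebesgue C \<ge> 1 \<longrightarrow> big bs c C"
proof -
  obtain c where c: "c > 0" and c1: "\<forall>C z V. convex C \<and> bounded C \<and> C \<in> sets borel \<and>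
    (\<forall>b\<in>set bs. z \<bullet> b = 0) \<and> V > 0 \<and> ennreal V \<le> iterated_measure bs C z \<longrightarrow> big bs (c * V) (flat_part bs z C)"
    using big_of_iterated_measure[of bs] assms by blast
  have big: "big bs (c * V) C"
    if "convex C" "bounded C" "C \<in> sets borel" "V > 0" "ennreal V \<le> emeasure lborel C" for C V
    using c1[THEN spec, THEN spec, THEN spec, THEN mp, of C 0 V] that assms emeasure_lborel_iterated[of C bs]
    by (simp add: flat_part_full)
  show ?thesis
  proof (intro exI[of _ "c / 2"] conjI allI impI)
    show "c / 2 > 0" using c by simp
    fix C :: "'a set" assume "convex C \<and> emeasure lebesgue C \<ge> 1"
    then have C: "convex C" "emeasure lebesgue C \<ge> 1" by auto
    have fr: "frontier C \<in> null_sets lebesgue"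
      using negligible_convex_frontier[OF C(1)] by (simp add: negligible_iff_null_sets)
    have "interior C \<union> frontier C \<in> sets lebesgue"
      using null_setsD2[OF fr] by (intro sets.Un) auto
    then have "emeasure lebesgue C \<le> emeasure lebesgue (interior C \<union> frontier C)"
      using closure_subset[of C] by (intro emeasure_mono) (auto simp: frontier_def)
    also have "\<dots> = emeasure lebesgue (interior C)"
      using fr by (intro emeasure_Un_null_set) auto
    also have "\<dots> = emeasure lborel (interior C)" by simp
    finally have one: "emeasure lborel (interior C) \<ge> 1" using C(2) by (rule order_trans[rotated])
    define D where "D n = interior C \<inter> ball 0 (real n)" for n
    have "(\<Union>n. D n) = interior C"
      by (auto simp: D_def intro: reals_Archimedean2)
    moreover have "(SUP n. emeasure lborel (D n)) = emeasure lborel (\<Union>n. D n)"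
      by (intro SUP_emeasure_incseq) (auto simp: D_def incseq_def)
    ultimately have "(SUP n. emeasure lborel (D n)) \<ge> 1" using one by simp
    moreover have "ennreal (1/2) < ennreal 1" by (rule ennreal_lessI) auto
    then have "ennreal (1/2) < 1" by simp
    ultimately have "ennreal (1/2) < (SUP n. emeasure lborel (D n))" by (rule order.strict_trans2[rotated])
    then obtain n where "ennreal (1/2) < emeasure lborel (D n)" by (auto simp: less_SUP_iff)
    then have "big bs (c * (1/2)) (D n)"
      using C(1) by (intro big) (auto simp: D_def intro!: convex_Int convex_interior bounded_Int)
    then show "big bs (c / 2) C"
      by (rule big_mono) (use interior_subset in \<open>auto simp: D_def\<close>)
  qed
qed

text \<open>
  \<open>y\<close> and \<open>Y b\<close> (\<open>b \<in> set bs\<close>) are the vertices of a simplex whose edge vectors at \<open>y\<close> form a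
  triangular matrix with positive diagonal. The point of the triangular shape is that the
  product of the diagonal, hence the volume, is a log-concave function of the vertices, so that
  simplices of volume bounded below form a convex family.
\<close>

fun flag :: "'a::euclidean_space list \<Rightarrow> 'a \<Rightarrow> ('a \<Rightarrow> 'a) \<Rightarrow> bool" where
  "flag [] y Y \<longleftrightarrow> True"
| "flag (b # bs) y Y \<longleftrightarrow> (Y b - y) \<bullet> b > 0 \<and> (\<forall>b'\<in>set bs. (Y b' - y) \<bullet> b = 0) \<and> flag bs y Y"

definition edge_prod :: "'a::euclidean_space list \<Rightarrow> 'a \<Rightarrow> ('a \<Rightarrow> 'a) \<Rightarrow> real" where
  "edge_prod bs y Y = prod_list (map (\<lambda>b. (Y b - y) \<bullet> b) bs)"

lemma edge_prod_simps [simp]: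
  "edge_prod [] y Y = 1"
  "edge_prod (b # bs) y Y = (Y b - y) \<bullet> b * edge_prod bs y Y"
  by (simp_all add: edge_prod_def)

lemma flag_cong:
  assumes "\<And>b. b \<in> set bs \<Longrightarrow> Y b = Y' b"
  shows "flag bs y Y = flag bs y Y'" "edge_prod bs y Y = edge_prod bs y Y'"
  using assms by (induction bs) auto

text \<open>All vertices but \<open>Y b\<close> come from the slice at the bottom level
  \<open>a\<close>, and \<open>Y b\<close> is any point at the top level \<open>a + l\<close>; the
  diagonal entry \<open>l\<close> cancels the division by \<open>l\<close> in
  \<open>big\<close>.\<close>

lemma flag_of_big:
  assumes "distinct bs" "big bs V C"
  shows "\<exists>y Y. y \<in> C \<and> (\<forall>b\<in>set bs. Y b \<in> C) \<and> flag bs y Y \<and> V \<le> edge_prod bs y Y"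
  using assms
proof (induction bs arbitrary: V C)
  case Nil
  then show ?case by auto
next
  case (Cons b bs)
  from Cons.prems(2) obtain a l where l: "l > 0"
    and sl: "\<And>t. t \<in> {a..a + l} \<Longrightarrow> big bs (V / l) (C \<inter> {x. x \<bullet> b = t})"
    by (rule big_ConsE) blast
  have "\<exists>y Y. y \<in> C \<inter> {x. x \<bullet> b = a} \<and> (\<forall>b'\<in>set bs. Y b' \<in> C \<inter> {x. x \<bullet> b = a}) \<and> flag bs y Y \<and> V / l \<le> edge_prod bs y Y"
    by (rule Cons.IH) (use Cons.prems sl[of a] l in auto)
  then obtain y Y where y: "y \<in> C" "y \<bullet> b = a" and Y: "\<And>b'. b' \<in> set bs \<Longrightarrow> Y b' \<in> C \<and> Y b' \<bullet> b = a"
    and f: "flag bs y Y" "V / l \<le> edge_prod bs y Y" by blast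
  have "C \<inter> {x. x \<bullet> b = a + l} \<noteq> {}"
    by (rule big_nonempty[OF sl]) (use l in auto)
  then obtain p where p: "p \<in> C" "p \<bullet> b = a + l" by auto
  define Y' where "Y' = Y(b := p)"
  have YY: "Y b' = Y' b'" if "b' \<in> set bs" for b' using that Cons.prems by (auto simp: Y'_def)
  have "flag bs y Y'" "V / l \<le> edge_prod bs y Y'"
    using f flag_cong[of bs Y Y', OF YY] by auto
  moreover have "(Y' b - y) \<bullet> b = l" by (simp add: Y'_def p y inner_diff_left)
  moreover have "(Y' b' - y) \<bullet> b = 0" if "b' \<in> set bs" for b'
    using Y[OF that] YY[OF that] y by (simp add: inner_diff_left)
  ultimately have "flag (b # bs) y Y'" "V \<le> edge_prod (b # bs) y Y'"
    using l by (auto simp: field_simps)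
  moreover have "\<forall>b'\<in>set (b # bs). Y' b' \<in> C" using Y p YY by (auto simp: Y'_def)
  ultimately show ?case using y by blast
qed

text \<open>The hull is a cone with apex \<open>Y b\<close> over the hull of the other vertices,
  which lies at the level of \<open>y\<close>, so the half of the levels nearer to the base is under
  control. This bounds the volume of the simplex from below without a determinant formula.\<close>

lemma big_of_flag:
  fixes bs :: "'a::euclidean_space list"
  shows "\<exists>c>0. \<forall>y Y V. flag bs y Y \<and> 0 \<le> V \<and> V \<le> edge_prod bs y Y \<longrightarrow>
    big bs (c * V) (convex hull (insert y (Y ` set bs)))"
proof (induction bs)
  case Nil
  show ?case by (intro exI[of _ 1]) auto
next
  case (Cons b bs)
  then obtain c where c: "c > 0" and IH: "\<And>y Y V. flag bs y Y \<Longrightarrow> 0 \<le> V \<Longrightarrow> V \<le> edge_prod bs y Y \<Longrightarrow>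
    big bs (c * V) (convex hull (insert y (Y ` set bs)))" by blast
  define c' where "c' = c / (2 * 2 ^ length bs)"
  show ?case
  proof (intro exI[of _ c'] conjI allI impI)
    show "c' > 0" using c by (simp add: c'_def)
    fix y Y V assume *: "flag (b # bs) y Y \<and> 0 \<le> V \<and> V \<le> edge_prod (b # bs) y Y"
    define l where "l = (Y b - y) \<bullet> b"
    have l: "l > 0" and fl: "flag bs y Y" and Y: "\<And>b'. b' \<in> set bs \<Longrightarrow> Y b' \<bullet> b = y \<bullet> b"
      and V: "0 \<le> V / l" "V / l \<le> edge_prod bs y Y"
      using * by (auto simp: l_def inner_diff_left field_simps)
    let ?H = "convex hull (insert y (Y ` set (b # bs)))"
    let ?G = "convex hull (insert y (Y ` set bs))"
    have "?G \<subseteq> {x. x \<bullet> b = y \<bullet> b}"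
      using Y convex_hyperplane[of b "y \<bullet> b"] by (intro hull_minimal) (auto simp: inner_commute)
    moreover have "?G \<subseteq> ?H" by (intro hull_mono) auto
    ultimately have b0: "big bs (c * (V / l)) (?H \<inter> {x. x \<bullet> b = y \<bullet> b})"
      by (intro big_mono[OF IH[OF fl V]]) auto
    have "Y b \<in> insert y (Y ` set (b # bs))" by simp
    then have Yb: "Y b \<in> ?H" by (rule hull_inc)
    have "big bs (c' * V / (l / 2)) (?H \<inter> {x. x \<bullet> b = t})" if t: "t \<in> {y \<bullet> b..y \<bullet> b + l / 2}" for t
    proof -
      have "big bs (c * (V / l) / 2 ^ length bs) (?H \<inter> {x. x \<bullet> b = t})"
      proof (rule big_slice_midpoint_right[OF convex_convex_hull b0 Yb])
        have "Y b \<bullet> b = y \<bullet> b + l" by (simp add: l_def inner_diff_left)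
        then show "2 * t \<le> y \<bullet> b + Y b \<bullet> b" using t by auto
        show "0 \<le> c * (V / l)" using c V by (intro mult_nonneg_nonneg) auto
      qed (use t in auto)
      moreover have "c' * V / (l / 2) = c * (V / l) / 2 ^ length bs"
        using l by (simp add: c'_def field_simps)
      ultimately show ?thesis by simp
    qed
    moreover have "l / 2 > 0" using l by simp
    ultimately show "big (b # bs) (c' * V) ?H" unfolding big.simps by blast
  qed
qed

text \<open>The vanishing and positivity conditions are preserved because every entry is linear in
  the vertices. The weighted inequality of arithmetic and geometric means for each diagonal entry,
  multiplied over the diagonal, gives log-concavity.\<close>

lemma flag_convex:
  assumes "flag bs y Y" "flag bs y' Y'" "u \<ge> 0" "v \<ge> 0" "u + v = 1"
  shows "flag bs (u *\<^sub>R y + v *\<^sub>R y') (\<lambda>b. u *\<^sub>R Y b + v *\<^sub>R Y' b) \<and>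
    edge_prod bs y Y > 0 \<and> edge_prod bs y' Y' > 0 \<and>
    edge_prod bs y Y powr u * edge_prod bs y' Y' powr v \<le>
      edge_prod bs (u *\<^sub>R y + v *\<^sub>R y') (\<lambda>b. u *\<^sub>R Y b + v *\<^sub>R Y' b)"
  using assms(1,2)
proof (induction bs)
  case Nil
  then show ?case by auto
next
  case (Cons b bs)
  define p q where "p = (Y b - y) \<bullet> b" and "q = (Y' b - y') \<bullet> b"
  have pq: "p > 0" "q > 0" using Cons.prems by (auto simp: p_def q_def)
  have eq: "(u *\<^sub>R Y b' + v *\<^sub>R Y' b' - (u *\<^sub>R y + v *\<^sub>R y')) \<bullet> b =
    u * ((Y b' - y) \<bullet> b) + v * ((Y' b' - y') \<bullet> b)" for b'
    by (simp add: algebra_simps)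
  have young: "p powr u * q powr v \<le> u * p + v * q"
    by (rule Youngs_inequality_0) (use assms pq in auto)
  moreover have "p powr u * q powr v > 0" using pq by simp
  ultimately have pos: "u * p + v * q > 0" by linarith
  have IH: "flag bs (u *\<^sub>R y + v *\<^sub>R y') (\<lambda>b. u *\<^sub>R Y b + v *\<^sub>R Y' b)"
    "edge_prod bs y Y > 0" "edge_prod bs y' Y' > 0"
    "edge_prod bs y Y powr u * edge_prod bs y' Y' powr v \<le>
      edge_prod bs (u *\<^sub>R y + v *\<^sub>R y') (\<lambda>b. u *\<^sub>R Y b + v *\<^sub>R Y' b)"
    using Cons by auto
  have "(p * edge_prod bs y Y) powr u * (q * edge_prod bs y' Y') powr v =
    (p powr u * q powr v) * (edge_prod bs y Y powr u * edge_prod bs y' Y' powr v)"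
    using pq IH by (simp add: powr_mult)
  also have "\<dots> \<le> (u * p + v * q) * edge_prod bs (u *\<^sub>R y + v *\<^sub>R y') (\<lambda>b. u *\<^sub>R Y b + v *\<^sub>R Y' b)"
    using young IH(4) pos by (intro mult_mono) auto
  finally show ?case
    using IH pos pq Cons.prems eq by (auto simp: p_def q_def)
qed

corollary flag_convex_ge:
  assumes "flag bs y Y" "flag bs y' Y'" "u \<ge> 0" "v \<ge> 0" "u + v = 1"
    "V > 0" "V \<le> edge_prod bs y Y" "V \<le> edge_prod bs y' Y'"
  shows "flag bs (u *\<^sub>R y + v *\<^sub>R y') (\<lambda>b. u *\<^sub>R Y b + v *\<^sub>R Y' b) \<and>
    V \<le> edge_prod bs (u *\<^sub>R y + v *\<^sub>R y') (\<lambda>b. u *\<^sub>R Y b + v *\<^sub>R Y' b)"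
proof -
  note fc = flag_convex[OF assms(1-5)]
  have "V = V powr u * V powr v" using assms by (simp flip: powr_add)
  also have "\<dots> \<le> edge_prod bs y Y powr u * edge_prod bs y' Y' powr v"
    using assms by (intro mult_mono powr_mono2) auto
  finally show ?thesis using fc by auto
qed

text \<open>Contracting \<open>H\<close> towards one of its own points stays inside \<open>H\<close>
  and attains the exact volume demanded of the members of a transversal.\<close>

lemma exact_volume_body:
  fixes H :: "'a::euclidean_space set"
  assumes "compact H" "convex H" "v > 0" "ennreal v \<le> emeasure lborel H"
  shows "\<exists>K\<subseteq>H. compact K \<and> convex K \<and> interior K \<noteq> {} \<and> measure lebesgue K = v"
proof -
  have Hl: "H \<in> lmeasurable" using assms by (simp add: lmeasurable_compact)
  define m where "m = measure lebesgue H"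
  have "emeasure lborel H = emeasure lebesgue H"
    using assms(1) by (simp add: borel_compact)
  also have "\<dots> = ennreal m" using Hl by (simp add: m_def emeasure_eq_measure2)
  finally have m: "v \<le> m" using assms by (simp add: m_def)
  then have "m > 0" using assms by simp
  have "H \<noteq> {}" using \<open>m > 0\<close> by (auto simp: m_def)
  then obtain y where y: "y \<in> H" by auto
  define r where "r = root DIM('a) (v / m)"
  have rp: "r ^ DIM('a) = v / m" using assms \<open>m > 0\<close> by (simp add: r_def)
  have r: "0 < r" "r \<le> 1" using m assms \<open>m > 0\<close> by (auto simp: r_def)
  define K where "K = (\<lambda>x. (1 - r) *\<^sub>R y + r *\<^sub>R x) ` H"
  show ?thesis
  proof (intro exI[of _ K] conjI)
    show "K \<subseteq> H" using assms(2) y r by (auto simp: K_def intro!: convexD)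
    show "compact K" unfolding K_def
      by (intro compact_continuous_image continuous_intros assms)
    show "convex K" unfolding K_def by (rule convex_affinity[OF assms(2)])
    have "measure lebesgue K = r ^ DIM('a) * m"
      unfolding K_def using measure_lebesgue_affine[of r "(1 - r) *\<^sub>R y" H] r
      by (simp add: m_def add.commute)
    then show mK: "measure lebesgue K = v" using rp \<open>m > 0\<close> by simp
    show "interior K \<noteq> {}"
    proof
      assume "interior K = {}"
      then have "negligible K" using \<open>convex K\<close> by (simp add: negligible_convex_interior)
      then show False using mK assms(3) negligible_imp_measure0 by force
    qed
  qed
qed

section \<open>The Alon-Kleitman theorem\<close>

text \<open>
  If every one of the closest points violated its constraint, it would be closer to the origin
  than the closest point of the full intersection; Helly's theorem for the sets and the open ball
  with that radius is then contradicted.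
\<close>

lemma helly_closest_point:
  fixes C :: "'i \<Rightarrow> 'b::euclidean_space set"
  assumes T: "card T = DIM('b) + 1" and C: "\<And>i. i \<in> T \<Longrightarrow> compact (C i) \<and> convex (C i)"
    and ne: "(\<Inter>i\<in>T. C i) \<noteq> {}"
  shows "\<exists>i\<in>T. closest_point (\<Inter>j\<in>T - {i}. C j) 0 \<in> C i"
proof (rule ccontr)
  assume no: "\<not> ?thesis"
  define I where "I i = (\<Inter>j\<in>T - {i}. C j)" for i
  define p where "p i = closest_point (I i) 0" for i
  define x where "x = closest_point (\<Inter>i\<in>T. C i) 0"
  have finT: "finite T" using T card.infinite by fastforce
  have CC: "closed (C i)" "convex (C i)" if "i \<in> T" for i
    using C[OF that] by (auto intro: compact_imp_closed)
  have clT: "closed (\<Inter>i\<in>T. C i)" using CC(1) by (rule closed_INT[OF ballI])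
  have clI: "closed (I i)" "convex (I i)" for i
    unfolding I_def by (rule closed_INT convex_INT; use CC in auto)+
  have x: "x \<in> (\<Inter>i\<in>T. C i)" unfolding x_def by (rule closest_point_in_set[OF clT ne])
  then have xC: "x \<in> C i" if "i \<in> T" for i using that by blast
  then have xI: "x \<in> I i" for i by (auto simp: I_def)
  have pI: "p i \<in> I i" for i
    unfolding p_def by (rule closest_point_in_set[OF clI(1)]) (use xI in blast)
  have pC: "p i \<notin> C i" if "i \<in> T" for i using no that by (auto simp: p_def I_def)
  have norm_p: "norm (p i) < norm x" if "i \<in> T" for i
  proof -
    have le: "norm (p i) \<le> norm z" if "z \<in> I i" for z
      using closest_point_le[OF clI(1) that, of 0] by (simp add: p_def)
    have "norm (p i) \<noteq> norm x"
    proof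
      assume "norm (p i) = norm x"
      then have "x = closest_point (I i) 0"
        using le xI by (intro closest_point_unique clI) auto
      then show False using pC[OF that] xC[OF that] by (simp add: p_def)
    qed
    with le[OF xI] show ?thesis by simp
  qed
  have inj: "inj_on C T"
  proof (rule inj_onI, rule ccontr)
    fix i j assume ij: "i \<in> T" "j \<in> T" "C i = C j" "i \<noteq> j"
    then have "p i \<in> C j" using pI[of i] by (auto simp: I_def)
    then show False using pC ij by auto
  qed
  define F where "F = insert (ball 0 (norm x)) (C ` T)"
  have ballC: "ball 0 (norm x) \<notin> C ` T" using xC by force
  have cF: "card F = DIM('b) + 2" and finF: "finite F"
    using ballC finT T by (auto simp: F_def card_image[OF inj])
  have "\<Inter>F \<noteq> {}"
  proof (rule Helly)
    show "DIM('b) + 1 \<le> card F" using cF by simp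
    show "\<forall>s\<in>F. convex s" using C by (auto simp: F_def)
    fix t assume t: "t \<subseteq> F" "card t = DIM('b) + 1"
    then have "t \<noteq> F" using cF by auto
    then obtain s where s: "s \<in> F" "s \<notin> t" using t by blast
    show "\<Inter>t \<noteq> {}"
    proof (cases "s = ball 0 (norm x)")
      case True
      then have "x \<in> \<Inter>t" using t s xC by (auto simp: F_def)
      then show ?thesis by blast
    next
      case False
      then obtain i where i: "i \<in> T" "s = C i" using s by (auto simp: F_def)
      have "p i \<in> y" if y: "y \<in> t" for y
      proof (cases "y = ball 0 (norm x)")
        case False
        then obtain j where j: "j \<in> T" "y = C j" using t y by (auto simp: F_def)
        moreover have "j \<noteq> i" using s i y j by auto
        ultimately show ?thesis using pI[of i] by (auto simp: I_def)
      qed (use norm_p[OF i(1)] in auto)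
      then show ?thesis by blast
    qed
  qed
  then obtain z where z: "z \<in> \<Inter>F" by blast
  then have "z \<in> (\<Inter>i\<in>T. C i)" "norm z < norm x" by (auto simp: F_def)
  with closest_point_le[OF clT, of z 0] show False by (simp add: x_def)
qed

section \<open>Independent random tuples and the weighted fractional Helly theorem\<close>

lemma sum_PiE_split:
  assumes "B \<subseteq> A"
  shows "(\<Sum>f\<in>PiE A (\<lambda>_. I). F (restrict f (A - B)) (restrict f B)) =
    (\<Sum>h\<in>PiE (A - B) (\<lambda>_. I). \<Sum>g\<in>PiE B (\<lambda>_. I). F h g)"
  unfolding sum.cartesian_product
  by (rule sum.reindex_bij_witness[where i = "\<lambda>(h, g) x. if x \<in> B then g x else h x"
        and j = "\<lambda>f. (restrict f (A - B), restrict f B)"])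
    (use assms in \<open>auto simp: fun_eq_iff PiE_iff extensional_def restrict_def split: if_splits\<close>)

lemma sum_PiE_weights:
  fixes w :: "'i \<Rightarrow> real"
  assumes "finite A" "finite I" "sum w I = 1"
  shows "(\<Sum>f\<in>PiE A (\<lambda>_. I). \<Prod>j\<in>A. w (f j)) = 1"
  using prod_sum_PiE[of A "\<lambda>_. I" "\<lambda>_. w"] assms by simp

lemma prod_split_restrict:
  assumes "finite A" "B \<subseteq> A"
  shows "(\<Prod>j\<in>A. w (f j)) =
    (\<Prod>j\<in>A - B. w (restrict f (A - B) j)) * (\<Prod>j\<in>B. w (restrict f B j) :: real)"
  using prod.subset_diff[OF assms(2,1), of "\<lambda>j. w (f j)"] by simp

text \<open>Draw a tuple with independent coordinates distributed by \<open>w\<close>. Every tuple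
  satisfies one of \<open>card L\<close> relations, so some relation has probability at least
  \<open>1 / card L\<close>, and by averaging this persists after the coordinates outside
  \<open>B l\<close> are fixed suitably as \<open>h\<close>.\<close>

lemma weighted_pigeonhole:
  fixes w :: "'i \<Rightarrow> real"
  assumes fin: "finite A" "finite I" "finite L" and w: "\<And>i. i \<in> I \<Longrightarrow> w i \<ge> 0" "sum w I = 1"
    and B: "\<And>l. l \<in> L \<Longrightarrow> B l \<subseteq> A"
    and R: "\<And>f. f \<in> PiE A (\<lambda>_. I) \<Longrightarrow> \<exists>l\<in>L. R l (restrict f (A - B l)) (restrict f (B l))"
  shows "\<exists>l\<in>L. \<exists>h. 1 \<le> card L * (\<Sum>g\<in>PiE (B l) (\<lambda>_. I). (\<Prod>j\<in>B l. w (g j)) * of_bool (R l h g))"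
proof (rule ccontr)
  define W where "W A f = (\<Prod>j\<in>A. w (f j))" for A and f :: "'a \<Rightarrow> 'i"
  define S where "S l h = (\<Sum>g\<in>PiE (B l) (\<lambda>_. I). W (B l) g * of_bool (R l h g))" for l h
  assume "\<not> ?thesis"
  then have no: "card L * S l h < 1" if "l \<in> L" for l h
    using that by (force simp: S_def W_def not_le)
  have W0: "W A f \<ge> 0" if "f \<in> PiE A (\<lambda>_. I)" for A and f :: "'a \<Rightarrow> 'i"
    unfolding W_def using that w(1) by (intro prod_nonneg) auto
  have W1: "(\<Sum>f\<in>PiE A' (\<lambda>_. I). W A' f) = 1" if "A' \<subseteq> A" for A'
    unfolding W_def using that fin by (intro sum_PiE_weights w) (auto intro: finite_subset)
  obtain f0 where "f0 \<in> PiE A (\<lambda>_. I)" using W1[of A] by fastforce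
  then have "L \<noteq> {}" using R by blast
  then have cL: "card L > 0" using fin by (simp add: card_gt_0_iff)
  have "1 = (\<Sum>f\<in>PiE A (\<lambda>_. I). W A f)" using W1 by simp
  also have "\<dots> \<le> (\<Sum>f\<in>PiE A (\<lambda>_. I). \<Sum>l\<in>L. W A f * of_bool (R l (restrict f (A - B l)) (restrict f (B l))))"
  proof (rule sum_mono)
    fix f assume f: "f \<in> PiE A (\<lambda>_. I)"
    then obtain l where l: "l \<in> L" "R l (restrict f (A - B l)) (restrict f (B l))" using R by blast
    have "W A f * of_bool (R l (restrict f (A - B l)) (restrict f (B l))) \<le>
      (\<Sum>l\<in>L. W A f * of_bool (R l (restrict f (A - B l)) (restrict f (B l))))"
      using l fin W0[OF f] by (intro member_le_sum) auto
    then show "W A f \<le> (\<Sum>l\<in>L. W A f * of_bool (R l (restrict f (A - B l)) (restrict f (B l))))"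
      using l by simp
  qed
  also have "\<dots> = (\<Sum>l\<in>L. \<Sum>f\<in>PiE A (\<lambda>_. I). W A f * of_bool (R l (restrict f (A - B l)) (restrict f (B l))))"
    by (rule sum.swap)
  also have "\<dots> = (\<Sum>l\<in>L. \<Sum>h\<in>PiE (A - B l) (\<lambda>_. I). W (A - B l) h * S l h)"
  proof (rule sum.cong[OF refl])
    fix l assume l: "l \<in> L"
    have "(\<Sum>f\<in>PiE A (\<lambda>_. I). W A f * of_bool (R l (restrict f (A - B l)) (restrict f (B l)))) =
      (\<Sum>f\<in>PiE A (\<lambda>_. I). W (A - B l) (restrict f (A - B l)) * (W (B l) (restrict f (B l)) *
         of_bool (R l (restrict f (A - B l)) (restrict f (B l)))))"
      unfolding W_def prod_split_restrict[OF fin(1) B[OF l]] by (simp only: mult.assoc)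
    also have "\<dots> = (\<Sum>h\<in>PiE (A - B l) (\<lambda>_. I). \<Sum>g\<in>PiE (B l) (\<lambda>_. I). W (A - B l) h * (W (B l) g * of_bool (R l h g)))"
      by (rule sum_PiE_split[OF B[OF l]])
    finally show "(\<Sum>f\<in>PiE A (\<lambda>_. I). W A f * of_bool (R l (restrict f (A - B l)) (restrict f (B l)))) =
      (\<Sum>h\<in>PiE (A - B l) (\<lambda>_. I). W (A - B l) h * S l h)"
      by (simp add: S_def sum_distrib_left)
  qed
  also have "\<dots> < (\<Sum>l\<in>L. 1 / card L)"
  proof (rule sum_strict_mono[OF fin(3) \<open>L \<noteq> {}\<close>])
    fix l assume l: "l \<in> L"
    have "finite (PiE (A - B l) (\<lambda>_. I))" using fin by (intro finite_PiE) auto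
    define M where "M = Max ((\<lambda>h. S l h) ` PiE (A - B l) (\<lambda>_. I))"
    have ne: "PiE (A - B l) (\<lambda>_. I) \<noteq> {}" using W1[of "A - B l"] by fastforce
    have "(\<Sum>h\<in>PiE (A - B l) (\<lambda>_. I). W (A - B l) h * S l h) \<le> (\<Sum>h\<in>PiE (A - B l) (\<lambda>_. I). W (A - B l) h * M)"
      unfolding M_def using \<open>finite (PiE (A - B l) (\<lambda>_. I))\<close>
      by (intro sum_mono mult_left_mono W0 Max_ge) auto
    also have "\<dots> = M" using W1[of "A - B l"] by (simp flip: sum_distrib_right)
    also have "M < 1 / card L"
    proof -
      have "M \<in> (\<lambda>h. S l h) ` PiE (A - B l) (\<lambda>_. I)"
        unfolding M_def using \<open>finite (PiE (A - B l) (\<lambda>_. I))\<close> ne by (intro Max_in) auto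
      then show ?thesis using no[OF l] cL by (auto simp: field_simps)
    qed
    finally show "(\<Sum>h\<in>PiE (A - B l) (\<lambda>_. I). W (A - B l) h * S l h) < 1 / card L" .
  qed
  also have "\<dots> = 1" using cL by simp
  finally show False by simp
qed

text \<open>A label is a pair of \<open>T\<close> and \<open>i\<close>. The closest point attached
  to it depends only on the sets other than the \<open>i\<close>-th, so it is a fixed point once
  these are fixed, and the \<open>i\<close>-th set, drawn at random, contains it with probability at
  least the reciprocal of the number \<open>2 ^ n * n\<close> of labels.\<close>

lemma weighted_fractional_helly:
  fixes C :: "'i \<Rightarrow> 'b::euclidean_space set" and w :: "'i \<Rightarrow> real"
  assumes fin: "finite I" and C: "\<And>i. i \<in> I \<Longrightarrow> compact (C i) \<and> convex (C i)"
    and w: "\<And>i. i \<in> I \<Longrightarrow> w i \<ge> 0" "sum w I = 1"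
    and T: "\<And>f. f \<in> PiE {..<n} (\<lambda>_. I) \<Longrightarrow> \<exists>T\<subseteq>{..<n}. card T = DIM('b) + 1 \<and> (\<Inter>j\<in>T. C (f j)) \<noteq> {}"
  shows "\<exists>z. 1 \<le> real (2 ^ n * n) * (\<Sum>i\<in>I. w i * of_bool (z \<in> C i))"
proof -
  define L where "L = Pow {..<n} \<times> {..<n}"
  define R where "R l h g \<longleftrightarrow> closest_point (\<Inter>j\<in>fst l - {snd l}. C (h j)) 0 \<in> C (g (snd l))"
    for l :: "nat set \<times> nat" and h g :: "nat \<Rightarrow> 'i"
  have cL: "card L = 2 ^ n * n" by (simp add: L_def card_cartesian_product card_Pow)
  have "\<exists>l\<in>L. \<exists>h. 1 \<le> card L * (\<Sum>g\<in>PiE {snd l} (\<lambda>_. I). (\<Prod>j\<in>{snd l}. w (g j)) * of_bool (R l h g))"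
  proof (rule weighted_pigeonhole[where A = "{..<n}"])
    fix f assume f: "f \<in> PiE {..<n} (\<lambda>_. I)"
    then obtain T where T: "T \<subseteq> {..<n}" "card T = DIM('b) + 1" "(\<Inter>j\<in>T. C (f j)) \<noteq> {}"
      using T by blast
    have "f j \<in> I" if "j \<in> T" for j using f T that by (auto simp: PiE_iff)
    then obtain i where i: "i \<in> T" "closest_point (\<Inter>j\<in>T - {i}. C (f j)) 0 \<in> C (f i)"
      using helly_closest_point[of T "\<lambda>j. C (f j)"] T C by blast
    have "(\<Inter>j\<in>T - {i}. C (restrict f ({..<n} - {i}) j)) = (\<Inter>j\<in>T - {i}. C (f j))"
      using T by (intro INF_cong) auto
    then have "R (T, i) (restrict f ({..<n} - {i})) (restrict f {i})"
      using i by (simp add: R_def)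
    moreover have "(T, i) \<in> L" using T i by (auto simp: L_def)
    ultimately show "\<exists>l\<in>L. R l (restrict f ({..<n} - {snd l})) (restrict f {snd l})"
      by (intro bexI[of _ "(T, i)"]) simp_all
  qed (use fin w in \<open>auto simp: L_def\<close>)
  then obtain l h where lh: "1 \<le> card L * (\<Sum>g\<in>PiE {snd l} (\<lambda>_. I). (\<Prod>j\<in>{snd l}. w (g j)) * of_bool (R l h g))"
    by blast
  define z where "z = closest_point (\<Inter>j\<in>fst l - {snd l}. C (h j)) 0"
  have "(\<Sum>g\<in>PiE {snd l} (\<lambda>_. I). (\<Prod>j\<in>{snd l}. w (g j)) * of_bool (R l h g)) = (\<Sum>i\<in>I. w i * of_bool (z \<in> C i))"
    by (rule sum.reindex_bij_witness[where i = "\<lambda>i. \<lambda>x\<in>{snd l}. i" and j = "\<lambda>g. g (snd l)"])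
      (auto simp: R_def z_def fun_eq_iff PiE_iff extensional_def)
  with lh cL show ?thesis by auto
qed

text \<open>
  A substitute for linear programming duality by multiplicative weights: each chosen point halves
  the weights of the sets that contain it.
\<close>

lemma dense_sequence:
  assumes b: "0 < b" "b \<le> 1"
  shows "\<exists>e::real>0. \<forall>I (C :: 'i \<Rightarrow> 'b set). finite I \<and> I \<noteq> {} \<and>
    (\<forall>w. (\<forall>i\<in>I. w i \<ge> 0) \<and> sum w I = (1::real) \<longrightarrow> (\<exists>z. b \<le> (\<Sum>i\<in>I. w i * of_bool (z \<in> C i)))) \<longrightarrow>
    (\<exists>N x. N \<ge> (1::nat) \<and> (\<forall>i\<in>I. e * real N \<le> card {s. s < N \<and> x s \<in> C i}))"
proof -
  \<comment> \<open>The total weight shrinks at least by the factor \<open>r * r\<close> in each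
    round. One factor \<open>r ^ t\<close> of the decay absorbs \<open>card I\<close>; the other
    equals \<open>2 powr (- (e * t))\<close> and bounds every single weight.\<close>
  define r where "r = sqrt (1 - b / 2)"
  have r: "0 < r" "r < 1" "r * r = 1 - b / 2" using b by (auto simp: r_def)
  define e where "e = - log 2 r"
  have e: "e > 0" using r by (simp add: e_def)
  show ?thesis
  proof (intro exI[of _ e] conjI allI impI)
    fix I and C :: "'i \<Rightarrow> 'b set"
    assume "finite I \<and> I \<noteq> {} \<and>
      (\<forall>w. (\<forall>i\<in>I. w i \<ge> 0) \<and> sum w I = 1 \<longrightarrow> (\<exists>z. b \<le> (\<Sum>i\<in>I. w i * of_bool (z \<in> C i))))"
    then have I: "finite I" "I \<noteq> {}"
      and H: "\<And>w. (\<And>i. i \<in> I \<Longrightarrow> w i \<ge> 0) \<Longrightarrow> sum w I = 1 \<Longrightarrow> \<exists>z. b \<le> (\<Sum>i\<in>I. w i * of_bool (z \<in> C i))"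
      by blast+
    have step: "\<exists>z. b * (\<Sum>i\<in>I. (1/2) ^ k i) \<le> (\<Sum>i\<in>I. (1/2) ^ k i * of_bool (z \<in> C i))" for k :: "'i \<Rightarrow> nat"
    proof -
      define W :: real where "W = (\<Sum>i\<in>I. (1/2) ^ k i)"
      have W: "W > 0" unfolding W_def using I by (intro sum_pos) auto
      obtain z where "b \<le> (\<Sum>i\<in>I. ((1/2) ^ k i / W) * of_bool (z \<in> C i))"
        using H[of "\<lambda>i. (1/2) ^ k i / W"] W by (auto simp: W_def simp flip: sum_divide_distrib)
      also have "\<dots> = (\<Sum>i\<in>I. (1/2) ^ k i * of_bool (z \<in> C i)) / W"
        by (simp add: sum_divide_distrib)
      finally show ?thesis using W by (auto simp: W_def field_simps)
    qed
    then obtain z where z: "\<And>k :: 'i \<Rightarrow> nat. b * (\<Sum>i\<in>I. (1/2) ^ k i) \<le> (\<Sum>i\<in>I. (1/2) ^ k i * of_bool (z k \<in> C i))"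
      by metis
    define K where "K = rec_nat (\<lambda>_. 0) (\<lambda>_ k i. k i + of_bool (z k \<in> C i))"
    have K: "K 0 = (\<lambda>_. 0)" "K (Suc t) = (\<lambda>i. K t i + of_bool (z (K t) \<in> C i))" for t
      by (simp_all add: K_def)
    define x where "x t = z (K t)" for t
    have Kcard: "K t i = card {s. s < t \<and> x s \<in> C i}" for t i
    proof (induction t)
      case (Suc t)
      have "{s. s < Suc t \<and> x s \<in> C i} = (if x t \<in> C i then insert t {s. s < t \<and> x s \<in> C i} else {s. s < t \<and> x s \<in> C i})"
        by (auto simp: less_Suc_eq)
      then show ?case by (simp add: K Suc x_def)
    qed (simp add: K)
    have pot: "(\<Sum>i\<in>I. (1/2) ^ K t i) \<le> card I * (r * r) ^ t" for t
    proof (induction t)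
      case (Suc t)
      have "(\<Sum>i\<in>I. (1/2) ^ K (Suc t) i) = (\<Sum>i\<in>I. (1/2) ^ K t i - (1/2) ^ K t i * of_bool (z (K t) \<in> C i) / 2 :: real)"
        by (intro sum.cong) (auto simp: K)
      also have "\<dots> = (\<Sum>i\<in>I. (1/2) ^ K t i) - (\<Sum>i\<in>I. (1/2) ^ K t i * of_bool (z (K t) \<in> C i)) / 2"
        by (simp add: sum_subtractf sum_divide_distrib)
      also have "\<dots> \<le> (\<Sum>i\<in>I. (1/2) ^ K t i) * (r * r)"
        using z[of "K t"] by (simp add: r algebra_simps)
      also have "\<dots> \<le> card I * (r * r) ^ t * (r * r)"
        using r b by (intro mult_right_mono Suc) auto
      finally show ?case by (simp add: algebra_simps)
    qed (simp add: K)
    obtain t0 where t0: "r ^ t0 < 1 / card I"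
      using real_arch_pow_inv[of "1 / card I" r] r I by (auto simp: card_gt_0_iff)
    define t where "t = Suc t0"
    have "r ^ t \<le> r ^ t0" unfolding t_def using r by (intro power_decreasing) auto
    then have "card I * r ^ t \<le> card I * r ^ t0" by (intro mult_left_mono) auto
    also have "\<dots> < 1" using t0 I by (simp add: card_gt_0_iff field_simps)
    finally have t: "card I * r ^ t < 1" .
    have "e * t \<le> K t i" if i: "i \<in> I" for i
    proof (rule ccontr)
      assume "\<not> ?thesis"
      then have "2 powr (- (e * t)) < 2 powr (- real (K t i))" by simp
      also have "\<dots> = (1/2) ^ K t i"
        by (simp add: powr_minus powr_realpow power_one_over inverse_eq_divide)
      also have "\<dots> \<le> (\<Sum>i\<in>I. (1/2) ^ K t i)" using I i by (intro member_le_sum) auto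
      also have "\<dots> \<le> card I * r ^ t * r ^ t" using pot[of t] by (simp add: power_mult_distrib)
      also have "2 powr (- (e * t)) = r ^ t"
      proof -
        have "2 powr (- (e * t)) = (2 powr log 2 r) powr t" by (simp add: e_def powr_powr)
        also have "\<dots> = r ^ t" using r by (simp add: powr_realpow)
        finally show ?thesis .
      qed
      finally have "r ^ t < (card I * r ^ t) * r ^ t" .
      moreover have "(card I * r ^ t) * r ^ t \<le> 1 * r ^ t" using t r by (intro mult_right_mono) auto
      ultimately show False by simp
    qed
    then show "\<exists>N x. N \<ge> 1 \<and> (\<forall>i\<in>I. e * real N \<le> card {s. s < N \<and> x s \<in> C i})"
      by (intro exI[of _ t] exI[of _ x]) (auto simp: Kcard t_def)
  qed (rule e)
qed

section \<open>Centre points, the selection lemma and weak nets\<close>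

lemma deep_point_exists:
  fixes f :: "nat \<Rightarrow> 'b::euclidean_space"
  assumes n: "(DIM('b) + 1) * q < n"
  shows "\<exists>c. \<forall>A\<subseteq>{..<n}. card ({..<n} - A) \<le> q \<longrightarrow> c \<in> convex hull (f ` A)"
proof -
  define F where "F = (\<lambda>A. convex hull (f ` A)) ` {A. A \<subseteq> {..<n} \<and> card ({..<n} - A) \<le> q}"
  have finF: "finite F" unfolding F_def by simp
  \<comment> \<open>Each set drops at most \<open>q\<close> indices, so \<open>DIM('b) + 1\<close>
    of them cannot drop all \<open>n\<close>, and a common index gives a common point.\<close>
  have meet: "\<Inter>t \<noteq> {}" if t: "t \<subseteq> F" "card t \<le> DIM('b) + 1" for t
  proof -
    have "\<forall>s\<in>t. \<exists>A. A \<subseteq> {..<n} \<and> card ({..<n} - A) \<le> q \<and> s = convex hull (f ` A)"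
      using t by (auto simp: F_def)
    then obtain A where A: "\<And>s. s \<in> t \<Longrightarrow> A s \<subseteq> {..<n} \<and> card ({..<n} - A s) \<le> q \<and> s = convex hull (f ` A s)"
      by metis
    have "card (\<Union>s\<in>t. {..<n} - A s) \<le> (\<Sum>s\<in>t. card ({..<n} - A s))"
      using finF t by (intro card_UN_le) (auto intro: finite_subset)
    also have "\<dots> \<le> card t * q" using sum_bounded_above[of t "\<lambda>s. card ({..<n} - A s)" q] A by simp
    also have "\<dots> \<le> (DIM('b) + 1) * q" using t by (intro mult_right_mono) auto
    finally have "card (\<Union>s\<in>t. {..<n} - A s) < card {..<n}" using n by simp
    then have "\<not> {..<n} \<subseteq> (\<Union>s\<in>t. {..<n} - A s)"
      using finite_subset[OF t(1) finF] by (intro notI) (auto dest!: card_mono[rotated])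
    then obtain j where j: "j < n" "\<And>s. s \<in> t \<Longrightarrow> j \<in> A s" by blast
    have "f j \<in> s" if "s \<in> t" for s
      using A[OF that] j(2)[OF that] hull_inc[of "f j" "f ` A s" convex] by simp
    then show ?thesis by blast
  qed
  have "\<Inter>F \<noteq> {}"
  proof (cases "card F \<ge> DIM('b) + 1")
    case True
    then show ?thesis
      by (rule Helly) (use meet in \<open>auto simp: F_def convex_convex_hull\<close>)
  next
    case False
    then show ?thesis by (intro meet) auto
  qed
  then obtain c where c: "c \<in> \<Inter>F" by blast
  then show ?thesis by (intro exI[of _ c]) (auto simp: F_def)
qed

text \<open>By Caratheodory's theorem a deep point lies in the hull of at most
  \<open>DIM('b) + 1\<close> of the points. When their indices are removed and this is repeated, at
  most \<open>DIM('b) * (DIM('b) + 1)\<close> indices are gone before the last round, and the depth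
  keeps the point in the hull of the rest. The cube is large enough for that depth.\<close>

lemma weak_tverberg:
  fixes f :: "nat \<Rightarrow> 'b::euclidean_space"
  shows "\<exists>P. (\<forall>j\<le>DIM('b). P j \<subseteq> {..<(DIM('b) + 1) ^ 3}) \<and> disjoint_family_on P {..DIM('b)} \<and>
    (\<Inter>j\<le>DIM('b). convex hull (f ` P j)) \<noteq> {}"
proof -
  let ?d = "DIM('b)" and ?n = "(DIM('b) + 1) ^ 3"
  have "(?d + 1) * (?d * (?d + 1)) < ?n"
    by (simp add: power3_eq_cube algebra_simps)
  from deep_point_exists[OF this, of f] obtain c where
    c: "\<And>A. A \<subseteq> {..<?n} \<Longrightarrow> card ({..<?n} - A) \<le> ?d * (?d + 1) \<Longrightarrow> c \<in> convex hull (f ` A)" by blast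
  have "\<exists>P. (\<forall>j<k. P j \<subseteq> {..<?n} \<and> card (P j) \<le> ?d + 1 \<and> c \<in> convex hull (f ` P j)) \<and> disjoint_family_on P {..<k}"
    if "k \<le> ?d + 1" for k
    using that
  proof (induction k)
    case 0
    then show ?case by (simp add: disjoint_family_on_def)
  next
    case (Suc k)
    then obtain P where P: "\<And>j. j < k \<Longrightarrow> P j \<subseteq> {..<?n} \<and> card (P j) \<le> ?d + 1 \<and> c \<in> convex hull (f ` P j)"
      and disj: "disjoint_family_on P {..<k}" by auto
    define A where "A = {..<?n} - (\<Union>j<k. P j)"
    have "card ({..<?n} - A) \<le> card (\<Union>j<k. P j)"
      using P by (intro card_mono) (auto simp: A_def intro: finite_subset)
    also have "\<dots> \<le> (\<Sum>j<k. card (P j))" by (rule card_UN_le) simp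
    also have "\<dots> \<le> k * (?d + 1)" using sum_bounded_above[of "{..<k}" "\<lambda>j. card (P j)" "?d + 1"] P by simp
    also have "\<dots> \<le> ?d * (?d + 1)" using Suc.prems by (intro mult_right_mono) auto
    finally have "c \<in> convex hull (f ` A)" by (intro c) (auto simp: A_def)
    then obtain S where S: "S \<subseteq> f ` A" "card S \<le> ?d + 1" "c \<in> convex hull S"
      unfolding caratheodory[of "f ` A"] by auto
    then obtain U where U: "U \<subseteq> A" "inj_on f U" "S = f ` U" by (auto simp: subset_image_inj)
    define P' where "P' = P(k := U)"
    show ?case
    proof (intro exI[of _ P'] conjI allI impI)
      fix j assume "j < Suc k"
      then show "P' j \<subseteq> {..<?n}" "card (P' j) \<le> ?d + 1" "c \<in> convex hull (f ` P' j)"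
        using P[of j] U S by (auto simp: P'_def A_def card_image less_Suc_eq)
    next
      have "U \<inter> P j = {}" if "j < k" for j using U that by (auto simp: A_def)
      moreover have "disjoint_family_on P' {..<k}"
        using disj by (simp add: P'_def disjoint_family_on_def)
      ultimately show "disjoint_family_on P' {..<Suc k}"
        unfolding lessThan_Suc by (subst disjoint_family_on_insert) (auto simp: P'_def)
    qed
  qed
  from this[of "?d + 1"] obtain P where
    P: "\<forall>j<?d + 1. P j \<subseteq> {..<?n} \<and> card (P j) \<le> ?d + 1 \<and> c \<in> convex hull (f ` P j)"
    "disjoint_family_on P {..<?d + 1}" by auto
  have eq: "{..<?d + 1} = {..?d}" by auto
  have "c \<in> (\<Inter>j\<le>?d. convex hull (f ` P j))" using P(1) unfolding eq[symmetric] by blast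
  then show ?thesis
    using P unfolding eq by (intro exI[of _ P]) (auto simp: less_Suc_eq_le)
qed

text \<open>
  The exponent is chosen so that a weak Tverberg partition always exists; no attempt is made to
  select simplices, as tuples of any fixed length are good enough for weak nets.
\<close>

lemma first_selection:
  "\<exists>e::real>0. \<forall>S (x :: 'i \<Rightarrow> 'b::euclidean_space). finite S \<and> S \<noteq> {} \<longrightarrow>
    (\<exists>z. e * real (card S) ^ (DIM('b) + 1) ^ 3 \<le>
      card {f \<in> PiE {..<(DIM('b) + 1) ^ 3} (\<lambda>_. S). z \<in> convex hull (x ` f ` {..<(DIM('b) + 1) ^ 3})})"
proof -
  let ?d = "DIM('b)" and ?n = "(DIM('b) + 1) ^ 3"
  \<comment> \<open>A label is a system of disjoint blocks of positions together with the block that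
    \<open>helly_closest_point\<close> singles out.\<close>
  define L where "L = (PiE {..?d} (\<lambda>_. Pow {..<?n}) \<inter> {P. disjoint_family_on P {..?d}}) \<times> {..?d}"
  have finL: "finite L" unfolding L_def by (intro finite_cartesian_product finite_Int disjI1 finite_PiE) auto
  have "(\<lambda>j\<in>{..?d}. {}, 0) \<in> L" by (auto simp: L_def disjoint_family_on_def)
  then have cL: "card L > 0" using finL by (auto simp: card_gt_0_iff)
  show ?thesis
  proof (intro exI[of _ "1 / card L"] conjI allI impI)
    show "1 / real (card L) > 0" using cL by simp
    fix S :: "'i set" and x :: "'i \<Rightarrow> 'b"
    assume "finite S \<and> S \<noteq> {}"
    then have S: "finite S" "S \<noteq> {}" and cS: "card S > 0" by (auto simp: card_gt_0_iff)
    define B where "B l = fst l (snd l)" for l :: "(nat \<Rightarrow> nat set) \<times> nat"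
    define Z where "Z l h = closest_point (\<Inter>j\<in>{..?d} - {snd l}. convex hull (x ` h ` fst l j)) 0"
      for l :: "(nat \<Rightarrow> nat set) \<times> nat" and h :: "nat \<Rightarrow> 'i"
    define R where "R l h g \<longleftrightarrow> Z l h \<in> convex hull (x ` g ` B l)" for l h g
    define w where "w i = 1 / real (card S)" for i :: 'i
    have w1: "sum w S = 1" using cS by (simp add: w_def)
    have BL: "B l \<subseteq> {..<?n}" if "l \<in> L" for l
    proof -
      have "fst l \<in> PiE {..?d} (\<lambda>_. Pow {..<?n})" "snd l \<in> {..?d}"
        using that unfolding L_def mem_Times_iff Int_iff by blast+
      from PiE_mem[OF this] show ?thesis by (simp add: B_def)
    qed
    have "\<exists>l\<in>L. \<exists>h. 1 \<le> card L * (\<Sum>g\<in>PiE (B l) (\<lambda>_. S). (\<Prod>j\<in>B l. w (g j)) * of_bool (R l h g))"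
    proof (rule weighted_pigeonhole[where A = "{..<?n}"])
      fix f assume f: "f \<in> PiE {..<?n} (\<lambda>_. S)"
      from weak_tverberg[of "x \<circ> f"] obtain P where P: "\<And>j. j \<le> ?d \<Longrightarrow> P j \<subseteq> {..<?n}"
        "disjoint_family_on P {..?d}" "(\<Inter>j\<le>?d. convex hull ((x \<circ> f) ` P j)) \<noteq> {}" by auto
      have "\<exists>i\<in>{..?d}. closest_point (\<Inter>j\<in>{..?d} - {i}. convex hull ((x \<circ> f) ` P j)) 0 \<in> convex hull ((x \<circ> f) ` P i)"
      proof (rule helly_closest_point)
        show "compact (convex hull ((x \<circ> f) ` P i)) \<and> convex (convex hull ((x \<circ> f) ` P i))" if "i \<in> {..?d}" for i
          using finite_subset[OF P(1)[of i]] that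
          by (simp add: finite_imp_compact_convex_hull convex_convex_hull)
      qed (use P(3) in simp_all)
      then obtain i where i: "i \<le> ?d"
        "closest_point (\<Inter>j\<in>{..?d} - {i}. convex hull (x ` f ` P j)) 0 \<in> convex hull (x ` f ` P i)"
        by (auto simp: image_comp)
      define l where "l = (restrict P {..?d}, i)"
      have "restrict P {..?d} \<in> PiE {..?d} (\<lambda>_. Pow {..<?n})" using P(1) by auto
      moreover have "disjoint_family_on (restrict P {..?d}) {..?d}"
        using P(2) by (simp add: disjoint_family_on_def)
      ultimately have l: "l \<in> L"
        using i by (simp add: l_def L_def)
      have B: "B l = P i" using i by (simp add: B_def l_def)
      \<comment> \<open>As the blocks are disjoint, forgetting \<open>f\<close> on
        \<open>P i\<close> does not affect the other hulls, so \<open>Z\<close> depends on the outer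
        coordinates only.\<close>
      have eq: "(\<Inter>j\<in>{..?d} - {i}. convex hull (x ` restrict f ({..<?n} - P i) ` P j)) =
        (\<Inter>j\<in>{..?d} - {i}. convex hull (x ` f ` P j))"
      proof (rule INF_cong[OF refl])
        fix j assume j: "j \<in> {..?d} - {i}"
        then have "P j \<inter> P i = {}" using P(2) i by (auto simp: disjoint_family_on_def)
        then have "restrict f ({..<?n} - P i) ` P j = f ` P j"
          using P(1)[of j] j by (intro image_cong) auto
        then show "convex hull (x ` restrict f ({..<?n} - P i) ` P j) = convex hull (x ` f ` P j)" by simp
      qed
      have eq': "(\<Inter>j\<in>{..?d} - {i}. convex hull (x ` restrict f ({..<?n} - P i) ` restrict P {..?d} j)) =
        (\<Inter>j\<in>{..?d} - {i}. convex hull (x ` restrict f ({..<?n} - P i) ` P j))"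
        by (rule INF_cong[OF refl]) simp
      have "Z l (restrict f ({..<?n} - B l)) = closest_point (\<Inter>j\<in>{..?d} - {i}. convex hull (x ` f ` P j)) 0"
        unfolding B unfolding Z_def l_def fst_conv snd_conv eq' eq ..
      moreover have "restrict f (B l) ` B l = f ` P i" by (simp add: B)
      ultimately have "R l (restrict f ({..<?n} - B l)) (restrict f (B l))"
        using i by (simp add: R_def)
      with l show "\<exists>l\<in>L. R l (restrict f ({..<?n} - B l)) (restrict f (B l))" by blast
    qed (use S finL BL w1 in \<open>auto simp: w_def\<close>)
    then obtain l h where l: "l \<in> L"
      and lh: "1 \<le> card L * (\<Sum>g\<in>PiE (B l) (\<lambda>_. S). (\<Prod>j\<in>B l. w (g j)) * of_bool (R l h g))" by blast
    define z where "z = Z l h"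
    let ?A = "{..<?n}"
    \<comment> \<open>The pigeonhole bound concerns tuples indexed by \<open>B l\<close>;
      multiplying by the total mass 1 of the remaining coordinates turns it into a statement about
      tuples of full length.\<close>
    have "(\<Sum>g\<in>PiE (B l) (\<lambda>_. S). (\<Prod>j\<in>B l. w (g j)) * of_bool (R l h g)) =
      (\<Sum>h'\<in>PiE (?A - B l) (\<lambda>_. S). \<Prod>j\<in>?A - B l. w (h' j)) *
      (\<Sum>g\<in>PiE (B l) (\<lambda>_. S). (\<Prod>j\<in>B l. w (g j)) * of_bool (R l h g))"
      using S w1 by (simp add: sum_PiE_weights)
    also have "\<dots> = (\<Sum>h'\<in>PiE (?A - B l) (\<lambda>_. S). \<Sum>g\<in>PiE (B l) (\<lambda>_. S).
      (\<Prod>j\<in>?A - B l. w (h' j)) * ((\<Prod>j\<in>B l. w (g j)) * of_bool (R l h g)))"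
      by (rule sum_product)
    also have "\<dots> = (\<Sum>f\<in>PiE ?A (\<lambda>_. S).
      (\<Prod>j\<in>?A - B l. w (restrict f (?A - B l) j)) * ((\<Prod>j\<in>B l. w (restrict f (B l) j)) * of_bool (R l h (restrict f (B l)))))"
      by (rule sum_PiE_split[OF BL[OF l], symmetric])
    also have "\<dots> = (\<Sum>f\<in>PiE ?A (\<lambda>_. S). (\<Prod>j\<in>?A. w (f j)) * of_bool (R l h (restrict f (B l))))"
      unfolding prod_split_restrict[OF finite_lessThan BL[OF l], of w] by (simp only: mult.assoc)
    also have "\<dots> = (\<Sum>f\<in>PiE ?A (\<lambda>_. S). (1 / card S) ^ ?n * of_bool (R l h (restrict f (B l))))"
      by (simp add: w_def)
    also have "\<dots> \<le> (\<Sum>f\<in>PiE ?A (\<lambda>_. S). (1 / card S) ^ ?n * of_bool (z \<in> convex hull (x ` f ` ?A)))"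
    proof (rule sum_mono)
      fix f
      have "x ` restrict f (B l) ` B l \<subseteq> x ` f ` ?A" using BL[OF l] by auto
      then have "R l h (restrict f (B l)) \<Longrightarrow> z \<in> convex hull (x ` f ` ?A)"
        unfolding R_def z_def using hull_mono by blast
      then show "(1 / real (card S)) ^ ?n * of_bool (R l h (restrict f (B l)))
        \<le> (1 / card S) ^ ?n * of_bool (z \<in> convex hull (x ` f ` ?A))" by auto
    qed
    also have "\<dots> = (1 / card S) ^ ?n * card {f \<in> PiE ?A (\<lambda>_. S). z \<in> convex hull (x ` f ` ?A)}"
      using S by (simp add: sum_distrib_left[symmetric] finite_PiE sum_of_bool_eq Int_def)
    finally have le: "(\<Sum>g\<in>PiE (B l) (\<lambda>_. S). (\<Prod>j\<in>B l. w (g j)) * of_bool (R l h g)) \<le>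
      (1 / card S) ^ ?n * card {f \<in> PiE ?A (\<lambda>_. S). z \<in> convex hull (x ` f ` ?A)}" .
    have "1 \<le> card L * ((1 / card S) ^ ?n * card {f \<in> PiE ?A (\<lambda>_. S). z \<in> convex hull (x ` f ` ?A)})"
      using lh le cL by (meson mult_left_mono of_nat_0_le_iff order_trans)
    then have "1 / card L * real (card S) ^ ?n \<le> card {f \<in> PiE ?A (\<lambda>_. S). z \<in> convex hull (x ` f ` ?A)}"
      using cL cS by (simp add: power_one_over field_simps)
    then show "\<exists>z. 1 / real (card L) * real (card S) ^ ?n \<le>
      card {f \<in> PiE ?A (\<lambda>_. S). z \<in> convex hull (x ` f ` ?A)}" by blast
  qed
qed

text \<open>
  Greedy choice: as long as some set is missed, the selection lemma yields a point that lies in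
  the hulls of a positive fraction of all tuples, none of which was hit before.
\<close>

lemma weak_net:
  assumes "e > 0"
  shows "\<exists>r. \<forall>N (x :: nat \<Rightarrow> 'b::euclidean_space) I (C :: 'i \<Rightarrow> 'b set).
    N \<ge> 1 \<and> (\<forall>i\<in>I. convex (C i) \<and> e * real N \<le> card {s. s < N \<and> x s \<in> C i}) \<longrightarrow>
    (\<exists>Z. finite Z \<and> card Z \<le> r \<and> (\<forall>i\<in>I. C i \<inter> Z \<noteq> {}))"
proof -
  let ?n = "(DIM('b) + 1) ^ 3"
  obtain d :: real where d: "d > 0" and
    sel': "\<forall>S (x :: nat \<Rightarrow> 'b). finite S \<and> S \<noteq> {} \<longrightarrow>
      (\<exists>z. d * real (card S) ^ ?n \<le> card {f \<in> PiE {..<?n} (\<lambda>_. S). z \<in> convex hull (x ` f ` {..<?n})})"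
    using first_selection[where ?'i = nat and ?'b = 'b] by (elim exE conjE) (rule that; assumption)
  have sel: "\<exists>z. d * real (card S) ^ ?n \<le> card {f \<in> PiE {..<?n} (\<lambda>_. S). z \<in> convex hull (x ` f ` {..<?n})}"
    if "finite S" "S \<noteq> {}" for S and x :: "nat \<Rightarrow> 'b"
    using sel' that by blast
  \<comment> \<open>Each round hits at least \<open>d * (e * real N) ^ ?n\<close> new tuples out of
    \<open>N ^ ?n\<close>, so \<open>r\<close> rounds cannot all leave some set missed.\<close>
  obtain r :: nat where r: "1 < real r * (d * e ^ ?n)"
    using reals_Archimedean3[of "d * e ^ ?n"] d \<open>e > 0\<close> by auto
  show ?thesis
  proof (intro exI[of _ r] allI impI)
    fix N and x :: "nat \<Rightarrow> 'b" and I and C :: "'i \<Rightarrow> 'b set"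
    assume "N \<ge> 1 \<and> (\<forall>i\<in>I. convex (C i) \<and> e * real N \<le> card {s. s < N \<and> x s \<in> C i})"
    then have N: "N \<ge> 1" and conv: "\<And>i. i \<in> I \<Longrightarrow> convex (C i)"
      and dense: "\<And>i. i \<in> I \<Longrightarrow> e * real N \<le> card {s. s < N \<and> x s \<in> C i}" by blast+
    define hl where "hl f = convex hull (x ` f ` {..<?n})" for f :: "nat \<Rightarrow> nat"
    define E where "E Z = {f \<in> PiE {..<?n} (\<lambda>_. {..<N}). Z \<inter> hl f \<noteq> {}}" for Z
    have finE: "finite (PiE {..<?n} (\<lambda>_. {..<N}))" by (intro finite_PiE) auto
    define a where "a = d * (e * real N) ^ ?n"
    have "\<exists>Z. finite Z \<and> card Z \<le> t \<and> ((\<forall>i\<in>I. C i \<inter> Z \<noteq> {}) \<or> real t * a \<le> card (E Z))" for t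
    proof (induction t)
      case 0
      then show ?case by (intro exI[of _ "{}"]) simp
    next
      case (Suc t)
      then obtain Z where Z: "finite Z" "card Z \<le> t"
        and alt: "(\<forall>i\<in>I. C i \<inter> Z \<noteq> {}) \<or> real t * a \<le> card (E Z)" by blast
      show ?case
      proof (cases "\<forall>i\<in>I. C i \<inter> Z \<noteq> {}")
        case True
        then show ?thesis using Z by (intro exI[of _ Z]) auto
      next
        case False
        then obtain i where i: "i \<in> I" "C i \<inter> Z = {}" by blast
        define S where "S = {s. s < N \<and> x s \<in> C i}"
        have S: "finite S" "S \<subseteq> {..<N}" by (auto simp: S_def)
        have eN: "e * real N \<le> card S" "e * real N > 0"
          using dense[OF i(1)] \<open>e > 0\<close> N by (auto simp: S_def)
        then have "S \<noteq> {}" by auto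
        from sel[OF S(1) this, of x] obtain z where
          z: "d * real (card S) ^ ?n \<le> card {f \<in> PiE {..<?n} (\<lambda>_. S). z \<in> hl f}"
          unfolding hl_def by blast
        define G where "G = {f \<in> PiE {..<?n} (\<lambda>_. S). z \<in> hl f}"
        have "hl f \<subseteq> C i" if "f \<in> PiE {..<?n} (\<lambda>_. S)" for f
          unfolding hl_def using that by (intro hull_minimal conv i) (auto simp: S_def PiE_iff)
        then have "E Z \<inter> G = {}" using i(2) by (auto simp: E_def G_def)
        moreover have "PiE {..<?n} (\<lambda>_. S) \<subseteq> PiE {..<?n} (\<lambda>_. {..<N})"
          using S by (intro PiE_mono) auto
        then have sub: "E Z \<union> G \<subseteq> E (insert z Z)" by (auto simp: E_def G_def)
        have finEE: "finite (E Z')" for Z' using finE by (simp add: E_def)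
        then have "finite G" using sub finite_subset by blast
        ultimately have "card (E Z) + card G = card (E Z \<union> G)"
          using finEE by (intro card_Un_disjoint[symmetric])
        also have "\<dots> \<le> card (E (insert z Z))" using sub finEE by (intro card_mono)
        finally have "card (E Z) + card G \<le> card (E (insert z Z))" .
        moreover have "a \<le> d * real (card S) ^ ?n"
          unfolding a_def using eN d by (intro mult_left_mono power_mono) auto
        then have "a \<le> card G" using z by (simp add: G_def)
        moreover have "real t * a \<le> card (E Z)" using alt False by blast
        ultimately have "real (Suc t) * a \<le> card (E (insert z Z))"
          by (simp add: algebra_simps)
        moreover have "card (insert z Z) \<le> Suc t" using Z by (simp add: card_insert_if)
        ultimately show ?thesis using Z by (intro exI[of _ "insert z Z"]) auto
      qed
    qed
    then obtain Z where Z: "finite Z" "card Z \<le> r" "(\<forall>i\<in>I. C i \<inter> Z \<noteq> {}) \<or> real r * a \<le> card (E Z)" by blast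
    have "card (E Z) \<le> card (PiE {..<?n} (\<lambda>_. {..<N}))"
      using finE by (intro card_mono) (auto simp: E_def)
    also have "\<dots> = N ^ ?n" by (simp add: card_PiE)
    finally have "real (card (E Z)) \<le> 1 * real N ^ ?n" by (metis mult_1 of_nat_le_iff of_nat_power)
    also have "\<dots> < (real r * (d * e ^ ?n)) * real N ^ ?n"
      using r N by (intro mult_strict_right_mono) auto
    also have "\<dots> = real r * a" by (simp add: a_def power_mult_distrib)
    finally have "\<forall>i\<in>I. C i \<inter> Z \<noteq> {}" using Z by linarith
    with Z show "\<exists>Z. finite Z \<and> card Z \<le> r \<and> (\<forall>i\<in>I. C i \<inter> Z \<noteq> {})" by blast
  qed
qed

text \<open>Fractional Helly for all weights yields one sequence that meets every set often, and a
  weak net for this sequence is the transversal. The hypothesis is about tuples with repetitions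
  because the random tuples may draw the same set several times.\<close>

theorem p_q_transversal:
  fixes n :: nat
  shows "\<exists>r. \<forall>I (C :: 'i \<Rightarrow> 'b::euclidean_space set).
    finite I \<and> (\<forall>i\<in>I. compact (C i) \<and> convex (C i)) \<and>
    (\<forall>f\<in>PiE {..<n} (\<lambda>_. I). \<exists>T\<subseteq>{..<n}. card T = DIM('b) + 1 \<and> (\<Inter>j\<in>T. C (f j)) \<noteq> {}) \<longrightarrow>
    (\<exists>Z. finite Z \<and> card Z \<le> r \<and> (\<forall>i\<in>I. C i \<inter> Z \<noteq> {}))"
proof -
  define b where "b = 1 / real (2 ^ n * (n + 1))"
  have "(1::nat) \<le> 2 ^ n * (n + 1)" by (simp add: Suc_le_eq)
  then have "1 \<le> real (2 ^ n * (n + 1))" by (metis of_nat_1 of_nat_le_iff)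
  then have b: "0 < b" "b \<le> 1" unfolding b_def by (auto simp only: divide_le_eq_1_pos zero_less_divide_1_iff)
  obtain e :: real where e: "e > 0" and ds: "\<forall>I (C :: 'i \<Rightarrow> 'b set). finite I \<and> I \<noteq> {} \<and>
    (\<forall>w. (\<forall>i\<in>I. w i \<ge> 0) \<and> sum w I = (1::real) \<longrightarrow> (\<exists>z. b \<le> (\<Sum>i\<in>I. w i * of_bool (z \<in> C i)))) \<longrightarrow>
    (\<exists>N x. N \<ge> (1::nat) \<and> (\<forall>i\<in>I. e * real N \<le> card {s. s < N \<and> x s \<in> C i}))"
    using dense_sequence[OF b] by (elim exE conjE) (rule that; assumption)
  obtain r where r: "\<forall>N (x :: nat \<Rightarrow> 'b) I (C :: 'i \<Rightarrow> 'b set).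
    N \<ge> 1 \<and> (\<forall>i\<in>I. convex (C i) \<and> e * real N \<le> card {s. s < N \<and> x s \<in> C i}) \<longrightarrow>
    (\<exists>Z. finite Z \<and> card Z \<le> r \<and> (\<forall>i\<in>I. C i \<inter> Z \<noteq> {}))"
    using weak_net[OF e] by (elim exE) (rule that; assumption)
  show ?thesis
  proof (intro exI[of _ r] allI impI)
    fix I and C :: "'i \<Rightarrow> 'b set"
    assume *: "finite I \<and> (\<forall>i\<in>I. compact (C i) \<and> convex (C i)) \<and>
      (\<forall>f\<in>PiE {..<n} (\<lambda>_. I). \<exists>T\<subseteq>{..<n}. card T = DIM('b) + 1 \<and> (\<Inter>j\<in>T. C (f j)) \<noteq> {})"
    then have I: "finite I" "\<And>i. i \<in> I \<Longrightarrow> compact (C i) \<and> convex (C i)"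
      and T: "\<And>f. f \<in> PiE {..<n} (\<lambda>_. I) \<Longrightarrow> \<exists>T\<subseteq>{..<n}. card T = DIM('b) + 1 \<and> (\<Inter>j\<in>T. C (f j)) \<noteq> {}"
      by blast+
    show "\<exists>Z. finite Z \<and> card Z \<le> r \<and> (\<forall>i\<in>I. C i \<inter> Z \<noteq> {})"
    proof (cases "I = {}")
      case True
      then show ?thesis by (intro exI[of _ "{}"]) simp
    next
      case False
      have "\<exists>z. b \<le> (\<Sum>i\<in>I. w i * of_bool (z \<in> C i))"
        if w: "(\<forall>i\<in>I. w i \<ge> 0) \<and> sum w I = 1" for w :: "'i \<Rightarrow> real"
      proof -
        from w have w': "\<And>i. i \<in> I \<Longrightarrow> w i \<ge> 0" "sum w I = 1" by blast+
        obtain z where z: "1 \<le> real (2 ^ n * n) * (\<Sum>i\<in>I. w i * of_bool (z \<in> C i))"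
          using weighted_fractional_helly[where C = C and n = n, OF I w' T] by blast
        also have "\<dots> \<le> real (2 ^ n * (n + 1)) * (\<Sum>i\<in>I. w i * of_bool (z \<in> C i))"
          using w' by (intro mult_right_mono sum_nonneg) auto
        finally have "1 \<le> real (2 ^ n * (n + 1)) * (\<Sum>i\<in>I. w i * of_bool (z \<in> C i))" .
        then have "b \<le> (\<Sum>i\<in>I. w i * of_bool (z \<in> C i))"
          unfolding b_def using \<open>1 \<le> real (2 ^ n * (n + 1))\<close>
          by (subst pos_divide_le_eq) (auto simp: mult.commute)
        then show ?thesis by blast
      qed
      then have "\<forall>w. (\<forall>i\<in>I. w i \<ge> 0) \<and> sum w I = (1::real) \<longrightarrow> (\<exists>z. b \<le> (\<Sum>i\<in>I. w i * of_bool (z \<in> C i)))"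
        by (intro allI impI)
      with I(1) False have "\<exists>N x. N \<ge> (1::nat) \<and> (\<forall>i\<in>I. e * real N \<le> card {s. s < N \<and> x s \<in> C i})"
        by (intro ds[THEN spec, THEN spec, THEN mp] conjI)
      then obtain N x where N: "N \<ge> 1" and x: "\<forall>i\<in>I. e * real N \<le> card {s. s < N \<and> x s \<in> C i}"
        by (elim exE conjE) (rule that; assumption)
      show ?thesis
        by (rule r[THEN spec, THEN spec, THEN spec, THEN spec, THEN mp, of N I C x])
          (use N x I in blast)
    qed
  qed
qed

section \<open>The quantitative theorem\<close>

text \<open>
  The parameter space of simplices must be a Euclidean space, but \<open>Basis\<close> is only a set; hence
  the finite index type.
\<close>

typedef (overloaded) 'a basis_index = "Basis :: 'a::euclidean_space set"
  by (meson nonempty_Basis ex_in_conv)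

instance basis_index :: (euclidean_space) finite
proof
  have "finite (Abs_basis_index ` (Basis :: 'a set))" by simp
  then show "finite (UNIV :: 'a basis_index set)"
    by (simp add: type_definition.Abs_image[OF type_definition_basis_index])
qed

type_synonym 'a simplex_param = "'a \<times> ('a ^ 'a basis_index)"

definition param_vertex :: "'a::euclidean_space simplex_param \<Rightarrow> 'a \<Rightarrow> 'a" where
  "param_vertex q b = snd q $ Abs_basis_index b"

lemma param_vertex_linear:
  "param_vertex (u *\<^sub>R q + v *\<^sub>R q') = (\<lambda>b. u *\<^sub>R param_vertex q b + v *\<^sub>R param_vertex q' b)"
  by (simp add: param_vertex_def fun_eq_iff)

lemma convex_flag_params:
  assumes "V > 0"
  shows "convex {q. flag bs (fst q) (param_vertex q) \<and> V \<le> edge_prod bs (fst q) (param_vertex q)}"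
proof (rule convexI, unfold mem_Collect_eq fst_add fst_scaleR param_vertex_linear, elim conjE)
  fix q q' :: "'a simplex_param" and u v :: real
  assume "0 \<le> u" "0 \<le> v" "u + v = 1"
    "flag bs (fst q) (param_vertex q)" "V \<le> edge_prod bs (fst q) (param_vertex q)"
    "flag bs (fst q') (param_vertex q')" "V \<le> edge_prod bs (fst q') (param_vertex q')"
  then show "flag bs (u *\<^sub>R fst q + v *\<^sub>R fst q') (\<lambda>b. u *\<^sub>R param_vertex q b + v *\<^sub>R param_vertex q' b) \<and>
    V \<le> edge_prod bs (u *\<^sub>R fst q + v *\<^sub>R fst q') (\<lambda>b. u *\<^sub>R param_vertex q b + v *\<^sub>R param_vertex q' b)"
    by (intro flag_convex_ge assms)
qed

lemma convex_params_in:
  assumes "convex C"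
  shows "convex {q. fst q \<in> C \<and> (\<forall>b\<in>B. param_vertex q b \<in> C)}"
  by (rule convexI) (auto simp: param_vertex_linear intro!: convexD[OF assms])

lemma flag_param_of_big:
  assumes "distinct bs" "set bs = Basis" "big bs V C"
  obtains q where "flag bs (fst q) (param_vertex q)" "V \<le> edge_prod bs (fst q) (param_vertex q)"
    "fst q \<in> C" "\<And>b. b \<in> Basis \<Longrightarrow> param_vertex q b \<in> C"
proof -
  obtain y Y where y: "y \<in> C" and Y: "\<forall>b\<in>set bs. Y b \<in> C" and f: "flag bs y Y" "V \<le> edge_prod bs y Y"
    using flag_of_big[OF assms(1,3)] by blast
  define q :: "'a simplex_param" where "q = (y, \<chi> i. Y (Rep_basis_index i))"
  have q: "Y b = param_vertex q b" if "b \<in> set bs" for b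
    using that assms(2) by (simp add: param_vertex_def q_def Abs_basis_index_inverse)
  have "fst q = y" by (simp add: q_def)
  then show thesis
    using f flag_cong[of bs Y "param_vertex q" y, OF q] y Y q assms(2) by (intro that[of q]) auto
qed

text \<open>Colour the subsets of size \<open>DIM('a) + 1\<close> by whether their intersection is
  big. The hypothesis excludes \<open>p\<close> sets all of whose subsets are bad, so Ramsey's
  theorem leaves a large family with only good ones, which is cut into the classes for
  \<open>colorful_big_selection\<close>. That \<open>e\<close> is chosen before \<open>p\<close>
  makes the final volume independent of \<open>p\<close>.\<close>

lemma big_subfamily_of_large:
  fixes bs :: "'a::euclidean_space list"
  assumes bs: "distinct bs" "set bs = Basis" and c: "c > 0" and "k \<ge> 1"
  shows "\<exists>e>0. \<forall>p. \<exists>P. \<forall>F :: 'a set set.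
    (\<forall>C\<in>F. convex C) \<and>
    (\<forall>S\<subseteq>F. card S = p \<longrightarrow> (\<exists>U\<subseteq>S. card U = DIM('a) + 1 \<and> big bs c (\<Inter>U))) \<longrightarrow>
    (\<forall>S\<subseteq>F. card S = P \<longrightarrow> (\<exists>U\<subseteq>S. card U = k \<and> big bs e (\<Inter>U)))"
proof -
  let ?d = "DIM('a)"
  have len: "length bs = ?d" using distinct_card[OF bs(1)] bs(2) by simp
  have pre: "set bs \<subseteq> Basis" "finite {..?d}" "card {..?d} = length bs + 1"
    using bs len by simp_all
  obtain N e where e: "e > 0" and sel: "\<forall>X (C :: nat \<Rightarrow> 'a set \<Rightarrow> 'a set) V w.
    (\<forall>c\<in>{..?d}. finite (X c) \<and> card (X c) \<ge> N) \<and>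
    (\<forall>c\<in>{..?d}. \<forall>i\<in>X c. convex (C c i) \<and> (\<forall>x\<in>C c i. \<forall>b\<in>Basis - set bs. x \<bullet> b = w \<bullet> b)) \<and>
    V > 0 \<and> (\<forall>s\<in>PiE {..?d} X. big bs V (\<Inter>c\<in>{..?d}. C c (s c))) \<longrightarrow>
    (\<exists>c\<in>{..?d}. \<exists>Z\<subseteq>X c. card Z = k \<and> big bs (e * V) (\<Inter>i\<in>Z. C c i))"
    using colorful_big_selection[OF bs(1) pre \<open>k \<ge> 1\<close>, where ?'i = "'a set"]
    by (elim exE conjE) (rule that; assumption)
  show ?thesis
  proof (intro exI[of _ "e * c"] conjI allI)
    show "e * c > 0" using e c by simp
    fix p :: nat
    obtain P :: nat where P: "partn_lst {..<P} [p, (?d + 1) * N] (?d + 1)"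
      using ramsey_full by blast
    show "\<exists>P. \<forall>F :: 'a set set. (\<forall>C\<in>F. convex C) \<and>
      (\<forall>S\<subseteq>F. card S = p \<longrightarrow> (\<exists>U\<subseteq>S. card U = ?d + 1 \<and> big bs c (\<Inter>U))) \<longrightarrow>
      (\<forall>S\<subseteq>F. card S = P \<longrightarrow> (\<exists>U\<subseteq>S. card U = k \<and> big bs (e * c) (\<Inter>U)))"
    \<comment> \<open>A set of positive cardinality \<open>Suc P\<close> is finite.\<close>
    proof (intro exI[of _ "Suc P"] allI impI)
      fix F S :: "'a set set"
      assume *: "(\<forall>C\<in>F. convex C) \<and>
        (\<forall>S\<subseteq>F. card S = p \<longrightarrow> (\<exists>U\<subseteq>S. card U = ?d + 1 \<and> big bs c (\<Inter>U)))"
      then have conv: "\<And>C. C \<in> F \<Longrightarrow> convex C"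
        and pq: "\<And>S. S \<subseteq> F \<Longrightarrow> card S = p \<Longrightarrow> \<exists>U\<subseteq>S. card U = ?d + 1 \<and> big bs c (\<Inter>U)" by blast+
      assume SF: "S \<subseteq> F" and cS: "card S = Suc P"
      then have "finite S" by (metis card.infinite nat.distinct(1))
      then obtain h where h: "bij_betw h {0..<Suc P} S"
        using ex_bij_betw_nat_finite[of S] cS by auto
      have hinj: "inj_on h {..<P}" and hS: "h ` {..<P} \<subseteq> S"
        using h by (auto simp: bij_betw_def intro: inj_on_subset)
      define g where "g X = (if big bs c (\<Inter>(h ` X)) then 1 else 0 :: nat)" for X
      have gg: "g \<in> nsets {..<P} (?d + 1) \<rightarrow> {..<2}" by (auto simp: g_def)
      have l2: "length [p, (?d + 1) * N] = 2" by simp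
      obtain i H where i: "i < 2" and H: "H \<in> nsets {..<P} ([p, (?d + 1) * N] ! i)"
        and gH: "g ` nsets H (?d + 1) \<subseteq> {i}"
        by (rule partn_lstE[OF P gg l2]) (rule that; simp only: l2)
      have HP: "H \<subseteq> {..<P}" "finite H" and cH: "card H = [p, (?d + 1) * N] ! i"
        using H by (auto simp: nsets_def)
      have hH: "inj_on h H" "h ` H \<subseteq> F"
        using hinj hS SF HP by (auto intro: inj_on_subset)
      have sub: "big bs c (\<Inter>U) \<longleftrightarrow> i = 1" if U: "U \<subseteq> h ` H" "card U = ?d + 1" for U
      proof -
        obtain X where X: "X \<subseteq> H" "U = h ` X" using U(1) by (auto simp: subset_image_iff)
        then have "card X = ?d + 1" using U card_image[OF inj_on_subset[OF hH(1) X(1)]] by simp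
        then have "X \<in> nsets H (?d + 1)" using X HP by (auto simp: nsets_def intro: finite_subset)
        then have "g X = i" using gH by blast
        then show ?thesis using X i by (auto simp: g_def split: if_splits)
      qed
      have i1: "i = 1"
      proof (rule ccontr)
        assume "i \<noteq> 1"
        then have "card (h ` H) = p" using i cH by (auto simp: card_image[OF hH(1)] less_2_cases_iff)
        from pq[OF hH(2) this] obtain U where "U \<subseteq> h ` H" "card U = ?d + 1" "big bs c (\<Inter>U)" by blast
        with sub \<open>i \<noteq> 1\<close> show False by blast
      qed
      have "card (h ` H) = (?d + 1) * N" using cH i1 by (simp add: card_image[OF hH(1)])
      then obtain ph where ph: "bij_betw ph {0..<(?d + 1) * N} (h ` H)"
        using ex_bij_betw_nat_finite[of "h ` H"] HP by auto
      define X where "X j = ph ` {j * N..<j * N + N}" for j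
      have blk: "{j * N..<j * N + N} \<subseteq> {0..<(?d + 1) * N}" if "j \<le> ?d" for j
      proof -
        have "(j + 1) * N \<le> (?d + 1) * N" using that by (intro mult_right_mono) auto
        then show ?thesis by (auto simp: algebra_simps)
      qed
      have XH: "X j \<subseteq> h ` H" if "j \<le> ?d" for j
        using image_mono[OF blk[OF that], of ph] bij_betw_imp_surj_on[OF ph] by (simp add: X_def)
      have cX: "card (X j) = N" "finite (X j)" if "j \<le> ?d" for j
        unfolding X_def using card_image[OF inj_on_subset[OF bij_betw_imp_inj_on[OF ph] blk[OF that]]] by auto
      have disj: "X i \<inter> X j = {}" if "i \<le> ?d" "j \<le> ?d" "i \<noteq> j" for i j
      proof -
        have "{i * N..<i * N + N} \<inter> {j * N..<j * N + N} = {}"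
        proof (rule ccontr)
          assume "\<not> ?thesis"
          then obtain t where "t \<in> {i * N..<i * N + N}" "t \<in> {j * N..<j * N + N}" by blast
          then have t: "i * N \<le> t" "t < i * N + N" "j * N \<le> t" "t < j * N + N" by auto
          have "b \<le> a" if "t < a * N + N" "b * N \<le> t" for a b
          proof (rule ccontr)
            assume "\<not> b \<le> a"
            then have "(a + 1) * N \<le> b * N" by (intro mult_right_mono) auto
            then show False using that by simp
          qed
          from this[of i j] this[of j i] t have "i = j" by simp
          with \<open>i \<noteq> j\<close> show False by simp
        qed
        then show ?thesis
          unfolding X_def using inj_on_image_Int[OF bij_betw_imp_inj_on[OF ph] blk[OF that(1)] blk[OF that(2)]]
          by (metis image_empty)
      qed
      have rb: "big bs c (\<Inter>j\<in>{..?d}. s j)" if s: "s \<in> PiE {..?d} X" for s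
      proof -
        have sX: "s j \<in> X j" if "j \<le> ?d" for j using s that by auto
        have "inj_on s {..?d}"
        proof (rule inj_onI, rule ccontr)
          fix i j assume "i \<in> {..?d}" "j \<in> {..?d}" "s i = s j" "i \<noteq> j"
          then show False using disj[of i j] sX[of i] sX[of j] by auto
        qed
        then have "card (s ` {..?d}) = ?d + 1" by (simp add: card_image)
        moreover have "s ` {..?d} \<subseteq> h ` H" using sX XH by blast
        ultimately show ?thesis using sub i1 by blast
      qed
      have hyp: "(\<forall>j\<in>{..?d}. finite (X j) \<and> card (X j) \<ge> N) \<and>
        (\<forall>j\<in>{..?d}. \<forall>i\<in>X j. convex i \<and> (\<forall>x\<in>i. \<forall>b\<in>Basis - set bs. x \<bullet> b = 0 \<bullet> b)) \<and>
        c > 0 \<and> (\<forall>s\<in>PiE {..?d} X. big bs c (\<Inter>j\<in>{..?d}. s j))"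
      proof (intro conjI ballI)
        show "convex i" if "j \<in> {..?d}" "i \<in> X j" for i j
          using that XH[of j] hH(2) by (intro conv) auto
      qed (use cX rb c bs in auto)
      obtain c' Z where "c' \<in> {..?d}" "Z \<subseteq> X c'" "card Z = k" "big bs (e * c) (\<Inter>i\<in>Z. i)"
        using sel[THEN spec[of _ X], THEN spec[of _ "\<lambda>_ i. i"], THEN spec[of _ c], THEN spec[of _ 0], THEN mp, OF hyp]
        by blast
      then have Z: "c' \<le> ?d" "Z \<subseteq> X c'" "card Z = k" "big bs (e * c) (\<Inter>Z)" by simp_all
      have "h ` H \<subseteq> S" using hS HP by blast
      then have "Z \<subseteq> S" using XH[OF Z(1)] Z(2) by blast
      with Z show "\<exists>U\<subseteq>S. card U = k \<and> big bs (e * c) (\<Inter>U)" by blast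
    qed
  qed
qed

text \<open>Bridges tuples with repetitions, as in the Alon-Kleitman hypothesis, and sets of
  distinct members, as in the Ramsey selection: one set repeated \<open>k\<close> times meets
  itself, and among \<open>P\<close> distinct sets the selection applies.\<close>

lemma repeated_or_many_values:
  fixes f :: "nat \<Rightarrow> 'i"
  assumes "k \<ge> 1"
  obtains T where "T \<subseteq> {..<k * P}" "card T = k" "\<And>i j. i \<in> T \<Longrightarrow> j \<in> T \<Longrightarrow> f i = f j"
  | S where "S \<subseteq> f ` {..<k * P}" "card S = P"
proof (cases "card (f ` {..<k * P}) \<ge> P")
  case True
  then obtain S where "S \<subseteq> f ` {..<k * P}" "card S = P"
    by (meson obtain_subset_with_card_n)
  then show thesis by (rule that(2))
next
  case False
  have "\<exists>y\<in>f ` {..<k * P}. card (f -` {y} \<inter> {..<k * P}) \<ge> k"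
  proof (rule ccontr)
    assume no: "\<not> ?thesis"
    have "{..<k * P} = (\<Union>y\<in>f ` {..<k * P}. f -` {y} \<inter> {..<k * P})" by auto
    then have "card {..<k * P} = card (\<Union>y\<in>f ` {..<k * P}. f -` {y} \<inter> {..<k * P})" by (rule arg_cong)
    also have "\<dots> \<le> (\<Sum>y\<in>f ` {..<k * P}. card (f -` {y} \<inter> {..<k * P}))"
      by (rule card_UN_le) simp
    also have "\<dots> \<le> (\<Sum>y\<in>f ` {..<k * P}. k)"
      using no by (intro sum_mono) (meson nat_le_linear)
    also have "\<dots> = card (f ` {..<k * P}) * k" by simp
    also have "\<dots> < P * k" using False \<open>k \<ge> 1\<close> by (intro mult_strict_right_mono) auto
    finally show False by (simp add: mult.commute)
  qed
  then obtain y where "card (f -` {y} \<inter> {..<k * P}) \<ge> k" by blast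
  then obtain T where T: "T \<subseteq> f -` {y} \<inter> {..<k * P}" "card T = k"
    by (meson obtain_subset_with_card_n)
  then show thesis by (intro that(1)[of T]) auto
qed

theorem theorem3:
  shows "\<exists>v::real. v > 0 \<and>
    (\<forall>p::nat. p \<ge> DIM('a::euclidean_space) + 1 \<longrightarrow>
      (\<exists>r::nat. \<forall>F :: 'a set set.
         finite F \<and>
         (\<forall>C\<in>F. convex C \<and> emeasure lebesgue C \<ge> 1) \<and>
         (\<forall>S\<subseteq>F. card S = p \<longrightarrow>
            (\<exists>U\<subseteq>S. card U = DIM('a) + 1 \<and> emeasure lebesgue (\<Inter>U) \<ge> 1))
         \<longrightarrow> (\<exists>T. finite T \<and> card T \<le> r \<and> quant_transversal v T F)))"
proof -
  obtain bs :: "'a list" where bs: "distinct bs" "set bs = Basis"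
    using finite_distinct_list[OF finite_Basis] by blast
  obtain c0 where c0: "c0 > 0" and large_big: "\<And>C :: 'a set. convex C \<Longrightarrow> emeasure lebesgue C \<ge> 1 \<Longrightarrow> big bs c0 C"
    using big_of_emeasure_ge[OF bs] by blast
  define k where "k = DIM('a simplex_param) + 1"
  have "k \<ge> 1" by (simp add: k_def)
  obtain e1 where e1: "e1 > 0" and sub: "\<forall>p. \<exists>P. \<forall>F :: 'a set set. (\<forall>C\<in>F. convex C) \<and>
      (\<forall>S\<subseteq>F. card S = p \<longrightarrow> (\<exists>U\<subseteq>S. card U = DIM('a) + 1 \<and> big bs c0 (\<Inter>U))) \<longrightarrow>
      (\<forall>S\<subseteq>F. card S = P \<longrightarrow> (\<exists>U\<subseteq>S. card U = k \<and> big bs e1 (\<Inter>U)))"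
    using big_subfamily_of_large[OF bs c0 \<open>k \<ge> 1\<close>] by (elim exE conjE) (rule that; assumption)
  \<comment> \<open>The bound has to hold both for selected subfamilies, which have
    \<open>e1\<close>, and for single members, which have \<open>c0\<close>.\<close>
  define e where "e = min c0 e1"
  have e: "e > 0" "e \<le> c0" "e \<le> e1" using c0 e1 by (auto simp: e_def)
  obtain c1 where c1: "c1 > 0" and flag_big: "\<And>y Y V. flag bs y Y \<Longrightarrow> 0 \<le> V \<Longrightarrow> V \<le> edge_prod bs y Y \<Longrightarrow>
      big bs (c1 * V) (convex hull (insert y (Y ` set bs)))"
    using big_of_flag[of bs] by blast
  define v where "v = c1 * e"
  have v: "v > 0" using c1 e by (simp add: v_def)
  define Th where "Th = {q. flag bs (fst q) (param_vertex q) \<and> e \<le> edge_prod bs (fst q) (param_vertex q)}"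
  have convTh: "convex Th" unfolding Th_def by (rule convex_flag_params[OF e(1)])
  have "\<exists>K. K \<subseteq> convex hull (insert (fst q) (param_vertex q ` Basis)) \<and> convex_body K \<and> measure lebesgue K = v"
    if q: "q \<in> Th" for q
  proof -
    let ?H = "convex hull (insert (fst q) (param_vertex q ` Basis))"
    have comp: "compact ?H" by (intro finite_imp_compact_convex_hull) simp
    have "big bs v ?H"
      using flag_big[of "fst q" "param_vertex q" e] q e by (simp add: Th_def v_def bs)
    then have "ennreal v \<le> emeasure lborel ?H"
      using bs comp by (intro emeasure_ge_of_big) (auto intro: borel_compact)
    from exact_volume_body[OF comp convex_convex_hull v this] show ?thesis
      by (auto simp: convex_body_def)
  qed
  then obtain body where body: "\<And>q. q \<in> Th \<Longrightarrow>
      body q \<subseteq> convex hull (insert (fst q) (param_vertex q ` Basis)) \<and> convex_body (body q) \<and> measure lebesgue (body q) = v"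
    by metis
  show ?thesis
  proof (intro exI[of _ v] conjI allI impI)
    show "v > 0" by (rule v)
    fix p :: nat
    from sub[THEN spec[of _ p]] obtain P where P: "\<forall>F :: 'a set set. (\<forall>C\<in>F. convex C) \<and>
      (\<forall>S\<subseteq>F. card S = p \<longrightarrow> (\<exists>U\<subseteq>S. card U = DIM('a) + 1 \<and> big bs c0 (\<Inter>U))) \<longrightarrow>
      (\<forall>S\<subseteq>F. card S = P \<longrightarrow> (\<exists>U\<subseteq>S. card U = k \<and> big bs e1 (\<Inter>U)))"
      by (elim exE) (rule that; assumption)
    obtain r where r: "\<forall>I (C :: 'a set \<Rightarrow> 'a simplex_param set).
      finite I \<and> (\<forall>i\<in>I. compact (C i) \<and> convex (C i)) \<and>
      (\<forall>f\<in>PiE {..<k * P} (\<lambda>_. I). \<exists>T\<subseteq>{..<k * P}. card T = DIM('a simplex_param) + 1 \<and> (\<Inter>j\<in>T. C (f j)) \<noteq> {}) \<longrightarrow>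
      (\<exists>Z. finite Z \<and> card Z \<le> r \<and> (\<forall>i\<in>I. C i \<inter> Z \<noteq> {}))"
      using p_q_transversal[of "k * P", where ?'i = "'a set" and ?'b = "'a simplex_param"]
      by (elim exE) (rule that; assumption)
    show "\<exists>r::nat. \<forall>F :: 'a set set. finite F \<and>
         (\<forall>C\<in>F. convex C \<and> emeasure lebesgue C \<ge> 1) \<and>
         (\<forall>S\<subseteq>F. card S = p \<longrightarrow>
            (\<exists>U\<subseteq>S. card U = DIM('a) + 1 \<and> emeasure lebesgue (\<Inter>U) \<ge> 1))
         \<longrightarrow> (\<exists>T. finite T \<and> card T \<le> r \<and> quant_transversal v T F)"
    proof (intro exI[of _ r] allI impI)
      fix F :: "'a set set"
      assume *: "finite F \<and> (\<forall>C\<in>F. convex C \<and> emeasure lebesgue C \<ge> 1) \<and>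
         (\<forall>S\<subseteq>F. card S = p \<longrightarrow>
            (\<exists>U\<subseteq>S. card U = DIM('a) + 1 \<and> emeasure lebesgue (\<Inter>U) \<ge> 1))"
      then have finF: "finite F" and conv: "\<And>C. C \<in> F \<Longrightarrow> convex C"
        and large: "\<And>C. C \<in> F \<Longrightarrow> emeasure lebesgue C \<ge> 1"
        and pq: "\<And>S. S \<subseteq> F \<Longrightarrow> card S = p \<Longrightarrow> \<exists>U\<subseteq>S. card U = DIM('a) + 1 \<and> emeasure lebesgue (\<Inter>U) \<ge> 1"
        by blast+
      have "\<exists>U\<subseteq>S. card U = DIM('a) + 1 \<and> big bs c0 (\<Inter>U)" if S: "S \<subseteq> F" "card S = p" for S
      proof -
        from pq[OF S] obtain U where U: "U \<subseteq> S" "card U = DIM('a) + 1" "emeasure lebesgue (\<Inter>U) \<ge> 1" by blast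
        then have "convex (\<Inter>U)" using S by (intro convex_Inter conv) auto
        with U large_big show ?thesis by blast
      qed
      then have hyp: "(\<forall>C\<in>F. convex C) \<and>
        (\<forall>S\<subseteq>F. card S = p \<longrightarrow> (\<exists>U\<subseteq>S. card U = DIM('a) + 1 \<and> big bs c0 (\<Inter>U)))"
        using conv by blast
      have Pk: "\<exists>U\<subseteq>S. card U = k \<and> big bs e (\<Inter>U)" if "S \<subseteq> F" "card S = P" for S
      proof -
        note P[THEN spec[of _ F], THEN mp, OF hyp, THEN spec[of _ S], THEN mp, THEN mp, OF that]
        then obtain U where U: "U \<subseteq> S" "card U = k" "big bs e1 (\<Inter>U)" by blast
        from U(3) order_refl e(3) have "big bs e (\<Inter>U)" by (rule big_mono)
        with U show ?thesis by blast
      qed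
      define good where "good U \<longleftrightarrow> U \<subseteq> F \<and> big bs e (\<Inter>U)" for U
      have "\<exists>q. q \<in> Th \<and> (\<forall>C\<in>U. fst q \<in> C \<and> (\<forall>b\<in>Basis. param_vertex q b \<in> C))" if "good U" for U
      proof -
        have bU: "big bs e (\<Inter>U)" using that by (simp add: good_def)
        obtain q where q: "flag bs (fst q) (param_vertex q)" "e \<le> edge_prod bs (fst q) (param_vertex q)"
          "fst q \<in> \<Inter>U" "\<And>b. b \<in> Basis \<Longrightarrow> param_vertex q b \<in> \<Inter>U"
          by (rule flag_param_of_big[OF bs bU]) blast
        then have "q \<in> Th" by (simp add: Th_def)
        moreover have "\<forall>C\<in>U. fst q \<in> C \<and> (\<forall>b\<in>Basis. param_vertex q b \<in> C)"
          using q(3,4) by blast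
        ultimately show ?thesis by blast
      qed
      then obtain th where th: "\<And>U. good U \<Longrightarrow> th U \<in> Th \<and> (\<forall>C\<in>U. fst (th U) \<in> C \<and> (\<forall>b\<in>Basis. param_vertex (th U) b \<in> C))"
        by metis
      \<comment> \<open>The set of all parameters of simplices in \<open>C\<close> need not be
        compact, as \<open>C\<close> is an arbitrary convex set. One sample simplex for each good
        subfamily containing \<open>C\<close> witnesses all intersections used; the hull of these
        finitely many samples is compact and, by convexity, consists of admissible simplices in
        \<open>C\<close>.\<close>
      define Ch where "Ch C = convex hull (th ` {U. good U \<and> C \<in> U})" for C
      have fin: "finite {U. good U \<and> C \<in> U}" for C
        by (rule finite_subset[of _ "Pow F"]) (use finF in \<open>auto simp: good_def\<close>)
      have thCh: "th U \<in> Ch C" if "good U" "C \<in> U" for U C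
        unfolding Ch_def by (rule hull_inc) (use that in blast)
      have ChTh: "Ch C \<subseteq> Th" for C
        unfolding Ch_def using th by (intro hull_minimal convTh) blast
      have ChC: "Ch C \<subseteq> {q. fst q \<in> C \<and> (\<forall>b\<in>Basis. param_vertex q b \<in> C)}" if "C \<in> F" for C
        unfolding Ch_def using th by (intro hull_minimal convex_params_in conv that) blast
      have single: "good {C}" if "C \<in> F" for C
        using big_mono[OF large_big[OF conv large] order_refl e(2)] that by (simp add: good_def)
      have meets: "\<exists>T\<subseteq>{..<k * P}. card T = DIM('a simplex_param) + 1 \<and> (\<Inter>j\<in>T. Ch (f j)) \<noteq> {}"
        if f: "f \<in> PiE {..<k * P} (\<lambda>_. F)" for f
      proof (rule repeated_or_many_values[OF \<open>k \<ge> 1\<close>, of P f])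
        fix T assume T: "T \<subseteq> {..<k * P}" "card T = k" "\<And>i j. i \<in> T \<Longrightarrow> j \<in> T \<Longrightarrow> f i = f j"
        then obtain i where i: "i \<in> T" using \<open>k \<ge> 1\<close> by fastforce
        then have "f i \<in> F" using f T(1) by blast
        then have "th {f i} \<in> (\<Inter>j\<in>T. Ch (f j))"
          using thCh[OF single] T(3)[OF i] by fastforce
        then show ?thesis using T unfolding k_def by blast
      next
        fix S assume S: "S \<subseteq> f ` {..<k * P}" "card S = P"
        then have "S \<subseteq> F" using f by blast
        from Pk[OF this S(2)] obtain U where U: "U \<subseteq> S" "card U = k" "big bs e (\<Inter>U)" by blast
        then have "good U" using \<open>S \<subseteq> F\<close> by (auto simp: good_def)
        have "U \<subseteq> f ` {..<k * P}" using U S by blast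
        then obtain T where T: "T \<subseteq> {..<k * P}" "inj_on f T" "U = f ` T" by (auto simp: subset_image_inj)
        then have "card T = k" using U card_image by metis
        moreover have "th U \<in> (\<Inter>j\<in>T. Ch (f j))" using thCh[OF \<open>good U\<close>] T by blast
        ultimately show ?thesis using T unfolding k_def by blast
      qed
      have "\<exists>Z. finite Z \<and> card Z \<le> r \<and> (\<forall>C\<in>F. Ch C \<inter> Z \<noteq> {})"
      proof (rule r[THEN spec[of _ F], THEN spec[of _ Ch], THEN mp], intro conjI ballI finF meets)
        show "compact (Ch C)" "convex (Ch C)" for C
          unfolding Ch_def using fin by (auto intro!: finite_imp_compact_convex_hull)
      qed
      then obtain Z where Z: "finite Z" "card Z \<le> r" "\<And>C. C \<in> F \<Longrightarrow> Ch C \<inter> Z \<noteq> {}" by blast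
      \<comment> \<open>Points of \<open>Z\<close> outside \<open>Th\<close> parametrize no
        admissible simplex; those that lie in some \<open>Ch C\<close> belong to
        \<open>Th\<close>.\<close>
      define T where "T = body ` (Z \<inter> Th)"
      show "\<exists>T. finite T \<and> card T \<le> r \<and> quant_transversal v T F"
      proof (intro exI[of _ T] conjI)
        show "finite T" using Z by (simp add: T_def)
        have "card T \<le> card (Z \<inter> Th)" unfolding T_def using Z by (intro card_image_le) auto
        also have "\<dots> \<le> card Z" using Z by (intro card_mono) auto
        finally show "card T \<le> r" using Z by simp
        show "quant_transversal v T F"
          unfolding quant_transversal_def
        proof (intro conjI ballI)
          show "convex_body K" "measure lebesgue K = v" if "K \<in> T" for K
            using that body by (auto simp: T_def)
          fix C assume C: "C \<in> F"
          then obtain q where q: "q \<in> Ch C" "q \<in> Z" using Z(3) by blast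
          then have "q \<in> Th" using ChTh by blast
          have "insert (fst q) (param_vertex q ` Basis) \<subseteq> C" using ChC[OF C] q by auto
          then have "convex hull (insert (fst q) (param_vertex q ` Basis)) \<subseteq> C"
            by (intro hull_minimal conv C)
          with body[OF \<open>q \<in> Th\<close>] have "body q \<subseteq> C" by blast
          moreover have "body q \<in> T" using q \<open>q \<in> Th\<close> by (auto simp: T_def)
          ultimately show "\<exists>K\<in>T. K \<subseteq> C" by blast
        qed
      qed
    qed
  qed
qed

end
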